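(* Let $\mathfrak g$ be a finite-dimensional simple Lie algebra over $\mathbb C$, let $\lambda\in P^+$ and $N\in\mathbb Z_{>0}\cup\{\infty\}$. For each positive root $\alpha$ let $q_\alpha,p_\alpha$ be the unique integers with $\lambda(h_\alpha)=Nq_\alpha+p_\alpha$ and $0\le p_\alpha<N$ (with $q_\alpha=0$ and $p_\alpha=\lambda(h_\alpha)$ if $N=\infty$), and let $\xi_N^\lambda=(\xi_N^\lambda(\alpha))_{\alpha\in R^+}$ be the family of partitions $$\xi_N^\lambda(\alpha)=\big((q_\alpha+1)^{(p_\alpha)},\,q_\alpha^{(N-p_\alpha)}\big).$$ Then $CV(\xi_N^\lambda)$ and $W_N(\lambda)$ are isomorphic graded $\mathfrak g[t]$-modules.
   Context: Lie algebra notation. $\mathfrak g$ is a finite-dimensional simple complex Lie algebra with a fixed Cartan subalgebra $\mathfrak h$ and triangular decomposition $\mathfrak g=\mathfrak n^-\oplus\mathfrak h\oplus\mathfrak n^+$; $R^+$ is the set of positive roots, $\alpha_i$ ($i\in I$) the simple roots, $P^+$ the set of dominant integral weights. $\{x_\alpha^\pm,h_i:\alpha\in R^+, i\in I\}$ is a Chevalley basis, $h_\alpha=[x_\alpha^+,x_\alpha^-]$, $x_i^\pm=x_{\alpha_i}^\pm$, $h_i=h_{\alpha_i}$. Current algebras. $\mathfrak g[t]=\mathfrak g\otimes\mathbb C[t]$ with $[x\otimes f,y\otimes g]=[x,y]\otimes fg$, graded by powers of $t$; $\mathfrak g[t]_N=\mathfrak g\otimes\mathbb C[t]/(t^N)$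 for $N\in\mathbb Z_{>0}$ and $\mathfrak g[t]_\infty=\mathfrak g[t]$. Every $\mathfrak g[t]_N$-module is regarded as a $\mathfrak g[t]$-module via the natural projection; $\mathfrak g$ is identified with $\mathfrak g\otimes1$. Weyl modules. For $\lambda\in P^+$ and $N\in\mathbb Z_{>0}\cup\{\infty\}$, $W_N(\lambda)$ is the graded $\mathfrak g[t]_N$-module generated by a vector $v$ of degree $0$ with defining relations $$(\mathfrak n^+\otimes t^r)v=0,\quad (h\otimes t^r)v=\delta_{r,0}\lambda(h)v,\quad (x_i^-)^{\lambda(h_i)+1}v=0\qquad (h\in\mathfrak h,\ r\ge 0,\ i\in I),$$ and $W(\lambda)=W_\infty(\lambda)$. Partitions. A partition is a non-increasing sequence $(m_j)_{j\ge1}$ of nonnegative integers with finitely many nonzero entries; $(k_1^{(a_1)},\dots,k_l^{(a_l)})$ denotes the partition in which $k_j$ is repeated $a_j$ times (zero parts may be ignored). Chari–Venkatesh modules. Let $\xi=(\xi(\alpha))_{\alpha\in R^+}$ be a family such that each $\xi(\alpha)$ is a partition of $\lambda(h_\alpha)$, with $j$-th part $\xi(\alpha)_j$. Then $CV(\xi)$ is the quotient of $W(\lambda)$ by the submodule generated by the elements $$(x_\alpha^+\otimes t)^s(x_\alpha^-)^{s+r}w$$ for all $\alpha\in R^+$ and all positive integers $s,r$ such that $s+r>rk+\sum_{j>k}\xi(\alpha)_j$ for some integer $k>0$, where $w$ is a generator of the weight space $W(\lambda)_\lambda$. *)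

theory Defs
  imports
    Complex_Main
    "HOL-Computational_Algebra.Polynomial"
    "HOL-Library.Poly_Mapping"
    "HOL-Library.Function_Algebras"
    "HOL-Library.Extended_Nat"
begin

section \<open>Complex Lie algebras\<close>

class complex_lie_algebra = ab_group_add +
  fixes cscale :: "complex \<Rightarrow> 'a \<Rightarrow> 'a"
    and lie :: "'a \<Rightarrow> 'a \<Rightarrow> 'a"
  assumes cscale_add_right: "cscale c (x + y) = cscale c x + cscale c y"
    and cscale_add_left: "cscale (c + d) x = cscale c x + cscale d x"
    and cscale_cscale: "cscale c (cscale d x) = cscale (c * d) x"
    and cscale_one: "cscale 1 x = x"
    and lie_add_left: "lie (x + y) z = lie x z + lie y z"
    and lie_add_right: "lie x (y + z) = lie x y + lie x z"
    and lie_cscale_left: "lie (cscale c x) y = cscale c (lie x y)"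
    and lie_cscale_right: "lie x (cscale c y) = cscale c (lie x y)"
    and lie_self: "lie x x = 0"
    and lie_jacobi: "lie x (lie y z) + lie y (lie z x) + lie z (lie x y) = 0"

global_interpretation lie_vs: vector_space "cscale :: complex \<Rightarrow> 'a \<Rightarrow> 'a::complex_lie_algebra"
  by unfold_locales (simp_all add: cscale_add_right cscale_add_left cscale_cscale cscale_one)

definition fin_dim_lie_algebra :: "'g::complex_lie_algebra itself \<Rightarrow> bool" where
  "fin_dim_lie_algebra _ \<longleftrightarrow> (\<exists>B :: 'g set. finite B \<and> lie_vs.span B = UNIV)"

definition lie_ideal :: "'g::complex_lie_algebra set \<Rightarrow> bool" where
  "lie_ideal J \<longleftrightarrow> lie_vs.subspace J \<and> (\<forall>x. \<forall>y\<in>J. lie x y \<in> J)"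

definition simple_lie_algebra :: "'g::complex_lie_algebra itself \<Rightarrow> bool" where
  "simple_lie_algebra _ \<longleftrightarrow>
     (\<exists>x y :: 'g. lie x y \<noteq> 0) \<and> (\<forall>J :: 'g set. lie_ideal J \<longrightarrow> J = {0} \<or> J = UNIV)"

definition lie_subalgebra :: "'g::complex_lie_algebra set \<Rightarrow> bool" where
  "lie_subalgebra S \<longleftrightarrow> lie_vs.subspace S \<and> (\<forall>x\<in>S. \<forall>y\<in>S. lie x y \<in> S)"

fun lower_central :: "'g::complex_lie_algebra set \<Rightarrow> nat \<Rightarrow> 'g set" where
  "lower_central S 0 = S"
| "lower_central S (Suc n) = lie_vs.span {lie x y | x y. x \<in> S \<and> y \<in> lower_central S n}"

definition cartan_subalgebra :: "'g::complex_lie_algebra set \<Rightarrow> bool" where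
  "cartan_subalgebra H \<longleftrightarrow>
     lie_subalgebra H \<and> (\<exists>n. lower_central H n = {0}) \<and> (\<forall>x. (\<forall>h\<in>H. lie x h \<in> H) \<longrightarrow> x \<in> H)"


section \<open>Roots, weights and Chevalley bases\<close>

text \<open>A linear functional on a subspace \<open>H\<close> is represented by the function on the whole Lie
  algebra that vanishes outside \<open>H\<close>, so that functionals are equal as soon as they agree on
  \<open>H\<close>, and \<open>\<alpha> + \<beta>\<close> and \<open>- \<alpha>\<close> are the pointwise operations.\<close>

definition dual_space :: "'g::complex_lie_algebra set \<Rightarrow> ('g \<Rightarrow> complex) set" where
  "dual_space H = {f. (\<forall>x\<in>H. \<forall>y\<in>H. f (x + y) = f x + f y) \<and>
     (\<forall>c. \<forall>x\<in>H. f (cscale c x) = c * f x) \<and> (\<forall>x. x \<notin> H \<longrightarrow> f x = 0)}"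

definition root_space :: "'g::complex_lie_algebra set \<Rightarrow> ('g \<Rightarrow> complex) \<Rightarrow> 'g set" where
  "root_space H \<alpha> = {x. \<forall>h\<in>H. lie h x = cscale (\<alpha> h) x}"

definition roots :: "'g::complex_lie_algebra set \<Rightarrow> ('g \<Rightarrow> complex) set" where
  "roots H = {\<alpha> \<in> dual_space H. \<alpha> \<noteq> 0 \<and> root_space H \<alpha> \<noteq> {0}}"

text \<open>The index set \<open>I\<close> of the simple roots is the set \<open>D\<close> of simple roots itself.\<close>

definition nonneg_comb :: "('g \<Rightarrow> complex) set \<Rightarrow> ('g \<Rightarrow> complex) set" where
  "nonneg_comb D = {\<alpha>. \<exists>c :: ('g \<Rightarrow> complex) \<Rightarrow> nat. \<alpha> = (\<lambda>h. \<Sum>\<beta>\<in>D. of_nat (c \<beta>) * \<beta> h)}"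

definition simple_root_system ::
    "'g::complex_lie_algebra set \<Rightarrow> ('g \<Rightarrow> complex) set \<Rightarrow> bool" where
  "simple_root_system H D \<longleftrightarrow>
     finite D \<and> D \<subseteq> roots H \<and>
     (\<forall>c :: ('g \<Rightarrow> complex) \<Rightarrow> complex. (\<forall>h. (\<Sum>\<beta>\<in>D. c \<beta> * \<beta> h) = 0) \<longrightarrow> (\<forall>\<beta>\<in>D. c \<beta> = 0)) \<and>
     (\<forall>\<alpha>\<in>roots H. \<alpha> \<in> nonneg_comb D \<or> - \<alpha> \<in> nonneg_comb D)"

definition pos_roots ::
    "'g::complex_lie_algebra set \<Rightarrow> ('g \<Rightarrow> complex) set \<Rightarrow> ('g \<Rightarrow> complex) set" where
  "pos_roots H D = roots H \<inter> nonneg_comb D"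

definition n_plus :: "'g::complex_lie_algebra set \<Rightarrow> ('g \<Rightarrow> complex) set \<Rightarrow> 'g set" where
  "n_plus H D = lie_vs.span (\<Union>\<alpha>\<in>pos_roots H D. root_space H \<alpha>)"

text \<open>A family \<open>e\<close> indexed by the roots encodes, for each positive root \<open>\<alpha>\<close>, the elements
  \<open>x\<^sub>\<alpha>\<^sup>+ = e \<alpha>\<close>, \<open>x\<^sub>\<alpha>\<^sup>- = e (- \<alpha>)\<close> and \<open>h\<^sub>\<alpha> = [x\<^sub>\<alpha>\<^sup>+, x\<^sub>\<alpha>\<^sup>-]\<close>.\<close>

definition coroot :: "(('g \<Rightarrow> complex) \<Rightarrow> 'g::complex_lie_algebra) \<Rightarrow> ('g \<Rightarrow> complex) \<Rightarrow> 'g" where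
  "coroot e \<alpha> = lie (e \<alpha>) (e (- \<alpha>))"

definition chevalley_basis ::
    "'g::complex_lie_algebra set \<Rightarrow> ('g \<Rightarrow> complex) set \<Rightarrow> (('g \<Rightarrow> complex) \<Rightarrow> 'g) \<Rightarrow> bool" where
  "chevalley_basis H D e \<longleftrightarrow>
     (\<forall>\<alpha>\<in>pos_roots H D.
        e \<alpha> \<in> root_space H \<alpha> \<and> e (- \<alpha>) \<in> root_space H (- \<alpha>) \<and>
        lie (coroot e \<alpha>) (e \<alpha>) = cscale 2 (e \<alpha>) \<and>
        lie (coroot e \<alpha>) (e (- \<alpha>)) = cscale (- 2) (e (- \<alpha>))) \<and>
     (\<forall>\<alpha>\<in>roots H. \<forall>\<beta>\<in>roots H. \<alpha> + \<beta> \<in> roots H \<longrightarrow>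
        (\<exists>c. lie (e \<alpha>) (e \<beta>) = cscale c (e (\<alpha> + \<beta>)) \<and>
             lie (e (- \<alpha>)) (e (- \<beta>)) = cscale (- c) (e (- (\<alpha> + \<beta>))))) \<and>
     inj_on e (roots H) \<and> inj_on (coroot e) D \<and> e ` roots H \<inter> coroot e ` D = {} \<and>
     lie_vs.independent (e ` roots H \<union> coroot e ` D) \<and>
     lie_vs.span (e ` roots H \<union> coroot e ` D) = UNIV"

definition dominant_weights ::
    "'g::complex_lie_algebra set \<Rightarrow> ('g \<Rightarrow> complex) set \<Rightarrow> (('g \<Rightarrow> complex) \<Rightarrow> 'g)
      \<Rightarrow> ('g \<Rightarrow> complex) set" where
  "dominant_weights H D e = {lam \<in> dual_space H. \<forall>\<alpha>\<in>D. lam (coroot e \<alpha>) \<in> \<nat>}"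


section \<open>Current algebras\<close>

text \<open>The space \<open>\<gg> \<otimes> \<complex>[t]\<close> is the type of polynomials with coefficients in \<open>\<gg>\<close>;
  \<open>x \<otimes> t\<^sup>r\<close> is \<open>monom x r\<close>.\<close>

lemma cscale_zero [simp]: "cscale c (0 :: 'a::complex_lie_algebra) = 0"
  by (rule lie_vs.scale_zero_right)

lemma lie_zero_left [simp]: "lie 0 (x :: 'a::complex_lie_algebra) = 0"
  using lie_add_left[of 0 0 x] by simp

lemma lie_zero_right [simp]: "lie (x :: 'a::complex_lie_algebra) 0 = 0"
  using lie_add_right[of x 0 0] by simp

lemma lie_sum_left: "lie (sum f A) (y :: 'a::complex_lie_algebra) = (\<Sum>i\<in>A. lie (f i) y)"
  by (induction A rule: infinite_finite_induct) (simp_all add: lie_add_left)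

lemma lie_sum_right: "lie (y :: 'a::complex_lie_algebra) (sum f A) = (\<Sum>i\<in>A. lie y (f i))"
  by (induction A rule: infinite_finite_induct) (simp_all add: lie_add_right)

lemma lie_swap: "lie x y = - lie y (x :: 'a::complex_lie_algebra)"
proof -
  have "lie (x + y) (x + y) = 0" by (rule lie_self)
  then have "lie x y + lie y x = 0"
    unfolding lie_add_left lie_add_right by (simp add: lie_self add.commute)
  then show ?thesis by (simp add: eq_neg_iff_add_eq_0)
qed

instantiation poly :: (complex_lie_algebra) complex_lie_algebra
begin

definition cscale_poly :: "complex \<Rightarrow> 'a poly \<Rightarrow> 'a poly" where
  "cscale_poly c p = map_poly (cscale c) p"

definition lie_poly :: "'a poly \<Rightarrow> 'a poly \<Rightarrow> 'a poly" where
  "lie_poly p q =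
     (\<Sum>i\<le>degree p. \<Sum>j\<le>degree q. monom (lie (coeff p i) (coeff q j)) (i + j))"

lemma coeff_cscale_poly: "coeff (cscale c (p :: 'a poly)) n = cscale c (coeff p n)"
  by (simp add: cscale_poly_def coeff_map_poly)

lemma lie_poly_bound:
  fixes p q :: "'a poly"
  assumes "degree p \<le> m" "degree q \<le> n"
  shows "lie p q = (\<Sum>i\<le>m. \<Sum>j\<le>n. monom (lie (coeff p i) (coeff q j)) (i + j))"
proof -
  have "(\<Sum>j\<le>n. monom (lie (coeff p i) (coeff q j)) (i + j))
      = (\<Sum>j\<le>degree q. monom (lie (coeff p i) (coeff q j)) (i + j))" for i
    using assms(2) by (intro sum.mono_neutral_right) (auto simp: coeff_eq_0)
  moreover have "(\<Sum>i\<le>m. \<Sum>j\<le>degree q. monom (lie (coeff p i) (coeff q j)) (i + j))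
      = (\<Sum>i\<le>degree p. \<Sum>j\<le>degree q. monom (lie (coeff p i) (coeff q j)) (i + j))"
    using assms(1) by (intro sum.mono_neutral_right) (auto simp: coeff_eq_0)
  ultimately show ?thesis by (simp add: lie_poly_def)
qed

lemma lie_poly_add_left: "lie (p + p') q = lie p q + lie p' (q :: 'a poly)"
proof -
  define m where "m = max (degree p) (degree p')"
  have "degree (p + p') \<le> m" "degree p \<le> m" "degree p' \<le> m"
    by (auto simp: m_def degree_add_le_max)
  then show ?thesis
    by (simp add: lie_poly_bound[where m = m and n = "degree q"] lie_add_left
        add_monom[symmetric] sum.distrib)
qed

lemma lie_poly_add_right: "lie q (p + p') = lie q p + lie q (p' :: 'a poly)"
proof -
  define m where "m = max (degree p) (degree p')"
  have "degree (p + p') \<le> m" "degree p \<le> m" "degree p' \<le> m"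
    by (auto simp: m_def degree_add_le_max)
  then show ?thesis
    by (simp add: lie_poly_bound[where n = m and m = "degree q"] lie_add_right
        add_monom[symmetric] sum.distrib)
qed

lemma lie_poly_zero: "lie 0 (q :: 'a poly) = 0" "lie q (0 :: 'a poly) = 0"
  by (simp_all add: lie_poly_def)

lemma lie_poly_sum_left: "lie (sum f A) (q :: 'a poly) = (\<Sum>i\<in>A. lie (f i) q)"
  by (induction A rule: infinite_finite_induct) (simp_all add: lie_poly_add_left lie_poly_zero)

lemma lie_poly_sum_right: "lie (q :: 'a poly) (sum f A) = (\<Sum>i\<in>A. lie q (f i))"
  by (induction A rule: infinite_finite_induct) (simp_all add: lie_poly_add_right lie_poly_zero)

lemma lie_poly_monom: "lie (monom x i) (monom y j) = monom (lie x (y :: 'a)) (i + j)"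
proof -
  have "lie (monom x i) (monom y j) =
      (\<Sum>k\<le>i. \<Sum>l\<le>j. monom (lie (coeff (monom x i) k) (coeff (monom y j) l)) (k + l))"
    by (rule lie_poly_bound) (rule degree_monom_le)+
  also have "\<dots> = (\<Sum>k\<le>i. \<Sum>l\<le>j. if k = i \<and> l = j then monom (lie x y) (i + j) else 0)"
    by (intro sum.cong) auto
  also have "\<dots> = (\<Sum>k\<le>i. if k = i then monom (lie x y) (i + j) else 0)"
    by (intro sum.cong refl) auto
  also have "\<dots> = monom (lie x y) (i + j)"
    by simp
  finally show ?thesis .
qed

lemma lie_poly_cscale:
  "lie (cscale c p) q = cscale c (lie p (q :: 'a poly))"
  "lie p (cscale c q) = cscale c (lie p (q :: 'a poly))"
proof -
  have d: "degree (cscale c r) \<le> degree r" for r :: "'a poly"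
    by (rule degree_le) (simp add: coeff_cscale_poly coeff_eq_0)
  have add: "cscale c (r + s) = cscale c r + cscale c s" for r s :: "'a poly"
    by (simp add: poly_eq_iff coeff_cscale_poly cscale_add_right)
  have zero: "cscale c 0 = (0 :: 'a poly)"
    by (simp add: poly_eq_iff coeff_cscale_poly)
  have S: "cscale c (sum f A) = (\<Sum>i\<in>A. cscale c (f i))" for f :: "nat \<Rightarrow> 'a poly" and A
    by (induction A rule: infinite_finite_induct) (simp_all add: add zero)
  have M: "cscale c (monom x n) = monom (cscale c x) n" for x :: 'a and n
    by (simp add: poly_eq_iff coeff_cscale_poly)
  show "lie (cscale c p) q = cscale c (lie p q)"
    by (simp add: lie_poly_bound[OF d order.refl] lie_poly_def[of p q]
        S M coeff_cscale_poly lie_cscale_left)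
  show "lie p (cscale c q) = cscale c (lie p q)"
    by (simp add: lie_poly_bound[OF order.refl d] lie_poly_def[of p q]
        S M coeff_cscale_poly lie_cscale_right)
qed

instance
proof
  fix c d :: complex and p q r :: "'a poly"
  show "cscale c (p + q) = cscale c p + cscale c q"
    by (simp add: poly_eq_iff coeff_cscale_poly cscale_add_right)
  show "cscale (c + d) p = cscale c p + cscale d p"
    by (simp add: poly_eq_iff coeff_cscale_poly cscale_add_left)
  show "cscale c (cscale d p) = cscale (c * d) p"
    by (simp add: poly_eq_iff coeff_cscale_poly cscale_cscale)
  show "cscale 1 p = p"
    by (simp add: poly_eq_iff coeff_cscale_poly cscale_one)
  show "lie (p + q) r = lie p r + lie q r" "lie p (q + r) = lie p q + lie p r"
    by (rule lie_poly_add_left lie_poly_add_right)+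
  show "lie (cscale c p) q = cscale c (lie p q)" "lie p (cscale c q) = cscale c (lie p q)"
    by (rule lie_poly_cscale)+
  have ex: "\<exists>m. s = (\<Sum>i\<le>m. monom (coeff s i) i)" for s :: "'a poly"
    by (metis poly_as_sum_of_monoms)
  obtain m where p: "p = (\<Sum>i\<le>m. monom (coeff p i) i)" using ex by blast
  obtain n where q: "q = (\<Sum>i\<le>n. monom (coeff q i) i)" using ex by blast
  obtain k where r: "r = (\<Sum>i\<le>k. monom (coeff r i) i)" using ex by blast
  have swap: "lie (f :: 'a poly) g = - lie g f" for f g
  proof -
    have "(\<Sum>i\<le>degree f. \<Sum>j\<le>degree g. monom (lie (coeff f i) (coeff g j)) (i + j))
        = (\<Sum>j\<le>degree g. \<Sum>i\<le>degree f. monom (lie (coeff f i) (coeff g j)) (i + j))"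
      by (rule sum.swap)
    also have "\<dots> = (\<Sum>j\<le>degree g. \<Sum>i\<le>degree f. - monom (lie (coeff g j) (coeff f i)) (j + i))"
      by (intro sum.cong refl) (subst lie_swap, simp add: minus_monom add.commute)
    finally show ?thesis by (simp add: lie_poly_def sum_negf)
  qed
  show "lie p p = 0"
  proof (rule poly_eqI)
    fix j
    have "coeff (lie p p) j = - coeff (lie p p) j"
      by (metis swap coeff_minus)
    then have "coeff (lie p p) j + coeff (lie p p) j = 0"
      by (simp add: eq_neg_iff_add_eq_0)
    then have "cscale 2 (coeff (lie p p) j) = 0"
      using cscale_add_left[of 1 1 "coeff (lie p p) j"] by (simp add: cscale_one)
    then show "coeff (lie p p) j = coeff 0 j"
      by simp
  qed
  have J: "lie (monom x a) (lie (monom y b) (monom z d)) + lie (monom y b) (lie (monom z d) (monom x a))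
      + lie (monom z d) (lie (monom x a) (monom y b)) = 0" for x y z :: 'a and a b d
  proof -
    have "b + (d + a) = a + (b + d)" "d + (a + b) = a + (b + d)" by simp_all
    then show ?thesis
      by (simp only: lie_poly_monom add_monom lie_jacobi monom_eq_0)
  qed
  show "lie p (lie q r) + lie q (lie r p) + lie r (lie p q) = 0"
  proof -
    have "lie p (lie q r) = (\<Sum>a\<le>m. \<Sum>b\<le>n. \<Sum>d\<le>k.
        lie (monom (coeff p a) a) (lie (monom (coeff q b) b) (monom (coeff r d) d)))"
      by (subst p, subst q, subst r) (simp only: lie_poly_sum_left, simp only: lie_poly_sum_right)
    moreover have "lie q (lie r p) = (\<Sum>a\<le>m. \<Sum>b\<le>n. \<Sum>d\<le>k.
        lie (monom (coeff q b) b) (lie (monom (coeff r d) d) (monom (coeff p a) a)))"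
    proof -
      have "lie q (lie r p) = (\<Sum>b\<le>n. \<Sum>d\<le>k. \<Sum>a\<le>m.
        lie (monom (coeff q b) b) (lie (monom (coeff r d) d) (monom (coeff p a) a)))"
      by (subst p, subst q, subst r) (simp only: lie_poly_sum_left, simp only: lie_poly_sum_right)
      also have "\<dots> = (\<Sum>b\<le>n. \<Sum>a\<le>m. \<Sum>d\<le>k.
          lie (monom (coeff q b) b) (lie (monom (coeff r d) d) (monom (coeff p a) a)))"
        by (rule sum.cong[OF refl], rule sum.swap)
      also have "\<dots> = (\<Sum>a\<le>m. \<Sum>b\<le>n. \<Sum>d\<le>k.
          lie (monom (coeff q b) b) (lie (monom (coeff r d) d) (monom (coeff p a) a)))"
        by (rule sum.swap)
      finally show ?thesis .
    qed
    moreover have "lie r (lie p q) = (\<Sum>a\<le>m. \<Sum>b\<le>n. \<Sum>d\<le>k.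
        lie (monom (coeff r d) d) (lie (monom (coeff p a) a) (monom (coeff q b) b)))"
    proof -
      have "lie r (lie p q) = (\<Sum>d\<le>k. \<Sum>a\<le>m. \<Sum>b\<le>n.
        lie (monom (coeff r d) d) (lie (monom (coeff p a) a) (monom (coeff q b) b)))"
      by (subst p, subst q, subst r) (simp only: lie_poly_sum_left, simp only: lie_poly_sum_right)
      also have "\<dots> = (\<Sum>a\<le>m. \<Sum>d\<le>k. \<Sum>b\<le>n.
          lie (monom (coeff r d) d) (lie (monom (coeff p a) a) (monom (coeff q b) b)))"
        by (rule sum.swap)
      also have "\<dots> = (\<Sum>a\<le>m. \<Sum>b\<le>n. \<Sum>d\<le>k.
          lie (monom (coeff r d) d) (lie (monom (coeff p a) a) (monom (coeff q b) b)))"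
        by (rule sum.cong[OF refl], rule sum.swap)
      finally show ?thesis .
    qed
    ultimately show ?thesis
      by (simp only: sum.distrib[symmetric] J sum.neutral_const)
  qed
qed

end

text \<open>The truncated current algebra: \<open>\<complex>[t]/(t\<^sup>N)\<close> is represented by the polynomials
  of degree less than \<open>N\<close>, so that the projection from \<open>\<gg>[t]\<close> is the truncation, and the
  bracket is the truncation of the bracket of \<open>\<gg>[t]\<close>. For \<open>N = \<infinity>\<close> nothing is cut off.\<close>

definition trunc :: "enat \<Rightarrow> 'g::zero poly \<Rightarrow> 'g poly" where
  "trunc N p = (case N of enat n \<Rightarrow> poly_cutoff n p | \<infinity> \<Rightarrow> p)"

definition trunc_current :: "enat \<Rightarrow> 'g::complex_lie_algebra poly set" where
  "trunc_current N = range (trunc N)"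

definition trunc_lie ::
    "enat \<Rightarrow> 'g::complex_lie_algebra poly \<Rightarrow> 'g poly \<Rightarrow> 'g poly" where
  "trunc_lie N p q = trunc N (lie p q)"


section \<open>Graded modules\<close>

text \<open>A complex vector space with operators indexed by \<open>'l\<close> and a family of homogeneous
  components.\<close>

record ('l, 'm) gmod =
  carr :: "'m set"
  madd :: "'m \<Rightarrow> 'm \<Rightarrow> 'm"
  msmult :: "complex \<Rightarrow> 'm \<Rightarrow> 'm"
  mact :: "'l \<Rightarrow> 'm \<Rightarrow> 'm"
  mgrade :: "nat \<Rightarrow> 'm set"

definition gmod_submodule :: "('l, 'm) gmod \<Rightarrow> 'm set \<Rightarrow> bool" where
  "gmod_submodule M K \<longleftrightarrow> K \<subseteq> carr M \<and> K \<noteq> {} \<and>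
     (\<forall>a\<in>K. \<forall>b\<in>K. madd M a b \<in> K) \<and> (\<forall>c. \<forall>a\<in>K. msmult M c a \<in> K) \<and>
     (\<forall>x. \<forall>a\<in>K. mact M x a \<in> K)"

definition gmod_generated :: "('l, 'm) gmod \<Rightarrow> 'm set \<Rightarrow> 'm set" where
  "gmod_generated M S = \<Inter> {K. gmod_submodule M K \<and> S \<subseteq> K}"

definition gmod_coset :: "('l, 'm) gmod \<Rightarrow> 'm set \<Rightarrow> 'm \<Rightarrow> 'm set" where
  "gmod_coset M K a = madd M a ` K"

definition gmod_quot :: "('l, 'm) gmod \<Rightarrow> 'm set \<Rightarrow> ('l, 'm set) gmod" where
  "gmod_quot M K = \<lparr>
     carr = gmod_coset M K ` carr M,
     madd = (\<lambda>A B. \<Union>a\<in>A. \<Union>b\<in>B. gmod_coset M K (madd M a b)),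
     msmult = (\<lambda>c A. \<Union>a\<in>A. gmod_coset M K (msmult M c a)),
     mact = (\<lambda>x A. \<Union>a\<in>A. gmod_coset M K (mact M x a)),
     mgrade = (\<lambda>n. gmod_coset M K ` mgrade M n) \<rparr>"

definition graded_isomorphic :: "('l, 'm) gmod \<Rightarrow> ('l, 'n) gmod \<Rightarrow> bool" where
  "graded_isomorphic M M' \<longleftrightarrow> (\<exists>f. bij_betw f (carr M) (carr M') \<and>
     (\<forall>a\<in>carr M. \<forall>b\<in>carr M. f (madd M a b) = madd M' (f a) (f b)) \<and>
     (\<forall>c. \<forall>a\<in>carr M. f (msmult M c a) = msmult M' c (f a)) \<and>
     (\<forall>x. \<forall>a\<in>carr M. f (mact M x a) = mact M' x (f a)) \<and>
     (\<forall>n. f ` mgrade M n = mgrade M' n))"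


section \<open>Universal enveloping algebras\<close>

datatype 'l word = Word (letters: "'l list")

instantiation word :: (type) monoid_add
begin

definition "0 = Word []"

definition "v + w = Word (letters v @ letters w)"

instance
  by standard (simp_all add: zero_word_def plus_word_def)

end

text \<open>The type \<open>'l word \<Rightarrow>\<^sub>0 complex\<close>, with the convolution product of
  \<^theory>\<open>HOL-Library.Poly_Mapping\<close>, is the free associative unital algebra on \<open>'l\<close>.\<close>

definition free_gen :: "'l \<Rightarrow> ('l word \<Rightarrow>\<^sub>0 complex)" where
  "free_gen x = Poly_Mapping.single (Word [x]) 1"

definition free_scale :: "complex \<Rightarrow> ('l word \<Rightarrow>\<^sub>0 complex) \<Rightarrow> ('l word \<Rightarrow>\<^sub>0 complex)" where
  "free_scale c f = Poly_Mapping.single 0 c * f"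

definition free_alg :: "'l set \<Rightarrow> ('l word \<Rightarrow>\<^sub>0 complex) set" where
  "free_alg L = {f. \<forall>w\<in>Poly_Mapping.keys f. set (letters w) \<subseteq> L}"

text \<open>The universal enveloping algebra of a Lie algebra with underlying space \<open>L\<close> and bracket
  \<open>br\<close> is \<open>free_alg L\<close> modulo the following two-sided ideal.\<close>

definition env_relations ::
    "'l::complex_lie_algebra set \<Rightarrow> ('l \<Rightarrow> 'l \<Rightarrow> 'l) \<Rightarrow> ('l word \<Rightarrow>\<^sub>0 complex) set" where
  "env_relations L br =
     {free_gen (x + y) - free_gen x - free_gen y | x y. x \<in> L \<and> y \<in> L} \<union>
     {free_gen (cscale c x) - free_scale c (free_gen x) | c x. x \<in> L} \<union>
     {free_gen x * free_gen y - free_gen y * free_gen x - free_gen (br x y) | x y. x \<in> L \<and> y \<in> L}"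

inductive_set env_ideal ::
    "'l::complex_lie_algebra set \<Rightarrow> ('l \<Rightarrow> 'l \<Rightarrow> 'l) \<Rightarrow> ('l word \<Rightarrow>\<^sub>0 complex) set"
  for L br where
  zero: "0 \<in> env_ideal L br"
| add: "f \<in> env_ideal L br \<Longrightarrow> g \<in> env_ideal L br \<Longrightarrow> f + g \<in> env_ideal L br"
| gen: "r \<in> env_relations L br \<Longrightarrow> u \<in> free_alg L \<Longrightarrow> v \<in> free_alg L \<Longrightarrow> u * r * v \<in> env_ideal L br"

text \<open>\<open>\<gg>[t]\<close> acts on the free algebra on \<open>\<gg>[t]\<^sub>N\<close> by left multiplication through
  the projection; a product of elements \<open>x\<^sub>i \<otimes> t\<^bsup>r i\<^esup>\<close> has degree the sum of the \<open>r i\<close>.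
  This is a \<open>\<gg>[t]\<close>-module only after passing to the quotient.\<close>

definition free_current :: "enat \<Rightarrow> ('g::complex_lie_algebra poly, 'g poly word \<Rightarrow>\<^sub>0 complex) gmod" where
  "free_current N = \<lparr>
     carr = free_alg (trunc_current N),
     madd = (+),
     msmult = free_scale,
     mact = (\<lambda>p f. free_gen (trunc N p) * f),
     mgrade = (\<lambda>n. {f \<in> free_alg (trunc_current N). \<forall>w\<in>Poly_Mapping.keys f.
        \<exists>l :: ('g \<times> nat) list. letters w = map (\<lambda>(x, r). monom x r) l \<and> sum_list (map snd l) = n}) \<rparr>"

abbreviation current_ideal :: "enat \<Rightarrow> ('g::complex_lie_algebra poly word \<Rightarrow>\<^sub>0 complex) set" where
  "current_ideal N \<equiv> env_ideal (trunc_current N) (trunc_lie N)"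

text \<open>\<open>U(\<gg>[t]\<^sub>N)\<close>, as a graded \<open>\<gg>[t]\<close>-module, and its unit.\<close>

definition env_current ::
    "enat \<Rightarrow> ('g::complex_lie_algebra poly, ('g poly word \<Rightarrow>\<^sub>0 complex) set) gmod" where
  "env_current N = gmod_quot (free_current N) (current_ideal N)"

definition env_one :: "enat \<Rightarrow> ('g::complex_lie_algebra poly word \<Rightarrow>\<^sub>0 complex) set" where
  "env_one N = gmod_coset (free_current N) (current_ideal N) 1"


section \<open>Weyl modules and Chari--Venkatesh modules\<close>

definition weyl_relations ::
    "'g::complex_lie_algebra set \<Rightarrow> ('g \<Rightarrow> complex) set \<Rightarrow> (('g \<Rightarrow> complex) \<Rightarrow> 'g) \<Rightarrow> enat
      \<Rightarrow> ('g \<Rightarrow> complex) \<Rightarrow> ('g poly word \<Rightarrow>\<^sub>0 complex) set set" where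
  "weyl_relations H D e N lam =
     (let U = env_current N; v = env_one N in
       {mact U (monom x r) v | x r. x \<in> n_plus H D} \<union>
       {madd U (mact U (monom h r) v) (msmult U (- (if r = 0 then lam h else 0)) v) | h r. h \<in> H} \<union>
       {(mact U (monom (e (- \<alpha>)) 0) ^^ (m + 1)) v | \<alpha> m. \<alpha> \<in> D \<and> of_nat m = lam (coroot e \<alpha>)})"

definition weyl_module ::
    "'g::complex_lie_algebra set \<Rightarrow> ('g \<Rightarrow> complex) set \<Rightarrow> (('g \<Rightarrow> complex) \<Rightarrow> 'g) \<Rightarrow> enat
      \<Rightarrow> ('g \<Rightarrow> complex) \<Rightarrow> ('g poly, ('g poly word \<Rightarrow>\<^sub>0 complex) set set) gmod" where
  "weyl_module H D e N lam =
     gmod_quot (env_current N) (gmod_generated (env_current N) (weyl_relations H D e N lam))"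

definition weight_space ::
    "'g::complex_lie_algebra set \<Rightarrow> ('g poly, 'm) gmod \<Rightarrow> ('g \<Rightarrow> complex) \<Rightarrow> 'm set" where
  "weight_space H M lam = {m \<in> carr M. \<forall>h\<in>H. mact M (monom h 0) m = msmult M (lam h) m}"

text \<open>A partition is given by the list of its parts in non-increasing order, possibly padded
  with zero parts; the sum of the \<open>j\<close>-th parts with \<open>j > k\<close> is \<open>sum_list (drop k xs)\<close>.\<close>

definition partition_of :: "nat \<Rightarrow> nat list \<Rightarrow> bool" where
  "partition_of n xs \<longleftrightarrow> sorted_wrt (\<ge>) xs \<and> sum_list xs = n"

definition cv_relations ::
    "'g::complex_lie_algebra set \<Rightarrow> ('g \<Rightarrow> complex) set \<Rightarrow> (('g \<Rightarrow> complex) \<Rightarrow> 'g)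
      \<Rightarrow> ('g poly, 'm) gmod \<Rightarrow> 'm \<Rightarrow> (('g \<Rightarrow> complex) \<Rightarrow> nat list) \<Rightarrow> 'm set" where
  "cv_relations H D e W w xi =
     {(mact W (monom (e \<alpha>) 1) ^^ s) ((mact W (monom (e (- \<alpha>)) 0) ^^ (s + r)) w) | \<alpha> s r.
        \<alpha> \<in> pos_roots H D \<and> s > 0 \<and> r > 0 \<and>
        (\<exists>k>0. s + r > r * k + sum_list (drop k (xi \<alpha>)))}"

text \<open>\<open>CV(\<xi>)\<close>, formed with the generator \<open>w\<close> of \<open>W(\<lambda>)\<^sub>\<lambda>\<close>.\<close>

definition cv_module ::
    "'g::complex_lie_algebra set \<Rightarrow> ('g \<Rightarrow> complex) set \<Rightarrow> (('g \<Rightarrow> complex) \<Rightarrow> 'g) \<Rightarrow> ('g \<Rightarrow> complex)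
      \<Rightarrow> ('g poly word \<Rightarrow>\<^sub>0 complex) set set \<Rightarrow> (('g \<Rightarrow> complex) \<Rightarrow> nat list)
      \<Rightarrow> ('g poly, ('g poly word \<Rightarrow>\<^sub>0 complex) set set set) gmod" where
  "cv_module H D e lam w xi =
     (let W = weyl_module H D e \<infinity> lam
      in gmod_quot W (gmod_generated W (cv_relations H D e W w xi)))"

definition even_partition :: "enat \<Rightarrow> nat \<Rightarrow> nat list" where
  "even_partition N n = (case N of
       enat M \<Rightarrow> replicate (n mod M) (n div M + 1) @ replicate (M - n mod M) (n div M)
     | \<infinity> \<Rightarrow> replicate n 1)"

lemma partition_of_even_partition:
  assumes "N \<noteq> 0"
  shows "partition_of n (even_partition N n)"
proof (cases N)
  case (enat M)
  then have "M > 0" using assms by (simp add: zero_enat_def)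
  then have "n mod M \<le> M" by (simp add: less_imp_le)
  then have "n mod M * (n div M + 1) + (M - n mod M) * (n div M) = n mod M + M * (n div M)"
    by (simp add: algebra_simps flip: distrib_right add_mult_distrib)
  then show ?thesis using enat
    by (auto simp: partition_of_def even_partition_def sorted_wrt_append sum_list_replicate
        sorted_wrt_iff_nth_less nth_append)
next
  case infinity
  then show ?thesis
    by (simp add: partition_of_def even_partition_def sum_list_replicate sorted_wrt_iff_nth_less)
qed

text \<open>For dominant integral \<open>\<lambda>\<close> and positive \<open>\<alpha>\<close>, the value \<open>\<lambda>(h\<^sub>\<alpha>)\<close>
  is a natural number, and \<open>nat \<lfloor>Re _\<rfloor>\<close> only converts its type.\<close>

definition xi_family ::
    "(('g \<Rightarrow> complex) \<Rightarrow> 'g::complex_lie_algebra) \<Rightarrow> enat \<Rightarrow> ('g \<Rightarrow> complex)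
      \<Rightarrow> ('g \<Rightarrow> complex) \<Rightarrow> nat list" where
  "xi_family e N lam \<alpha> = even_partition N (nat \<lfloor>Re (lam (coroot e \<alpha>))\<rfloor>)"

end

theory Submission
  imports Defs
begin

text \<open>Both modules are quotients of \<open>W(\<lambda>)\<close>. In \<open>W\<^sub>N(\<lambda>)\<close> one kills the vectors
  \<open>(x\<^sub>\<alpha>\<^sup>- \<otimes> t\<^sup>p) w\<close> with \<open>p \<ge> N\<close>. A computation in the current algebra of \<open>sl\<^sub>2\<close> shows that
  \<open>(x\<^sub>\<alpha>\<^sup>+ \<otimes> t)\<^sup>s (x\<^sub>\<alpha>\<^sup>-)\<^bsup>s + r\<^esup> w\<close> is a combination of products of \<open>r\<close> factors
  \<open>x\<^sub>\<alpha>\<^sup>- \<otimes> t\<^sup>a\<close> of total degree \<open>s\<close>, with nonzero sum of coefficients. For \<open>r = 1\<close>, \<open>k = N\<close>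
  this gives \<open>(x\<^sub>\<alpha>\<^sup>- \<otimes> t\<^sup>s) w\<close> for all \<open>s \<ge> N\<close>. Conversely, for the even partition the inequality
  in the definition of \<open>CV(\<xi>)\<close> forces \<open>s + r > \<lambda>(h\<^sub>\<alpha>)\<close>, and then \<open>(x\<^sub>\<alpha>\<^sup>-)\<^bsup>s + r\<^esup> w = 0\<close>
  by integrability, or \<open>s > r (N - 1)\<close>, and then some factor has \<open>a \<ge> N\<close>.\<close>

section \<open>Free algebras and their left ideals\<close>

text \<open>Every quotient is pulled back to one free algebra on g[t] with one fixed grading, so the
  graded isomorphism reduces to equality of two left ideals. The main obstacle is integrability: the
  Weyl relations bound powers of lowering vectors only for simple roots, whereas a power of the
  lowering vector must be known to kill w for every positive root \<alpha>. This is obtained from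
  weights alone: they are stable under simple reflections and bounded above by \<lambda>, which
  makes every lowering root vector locally nilpotent; sl_2 theory for the primitive vector w then
  yields the exact exponent \<lambda>(h_\<alpha>) + 1. The facts about roots behind this have to be
  derived from \<open>chevalley_basis\<close>, which places \<open>e \<alpha>\<close> in a root
  space only for positive roots and their negatives.\<close>

abbreviation cst :: "complex \<Rightarrow> ('l word \<Rightarrow>\<^sub>0 complex)" where
  "cst \<equiv> Poly_Mapping.single 0"

lemma poly_mapping_sum_superset:
  fixes f :: "'a \<Rightarrow>\<^sub>0 'b::comm_monoid_add"
  assumes "finite S" "Poly_Mapping.keys f \<subseteq> S"
  shows "(\<Sum>w\<in>S. Poly_Mapping.single w (Poly_Mapping.lookup f w)) = f"
proof (rule poly_mapping_eqI)
  fix k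
  have "Poly_Mapping.lookup (\<Sum>w\<in>S. Poly_Mapping.single w (Poly_Mapping.lookup f w)) k = (\<Sum>w\<in>S. if w = k then Poly_Mapping.lookup f w else 0)"
    by (simp add: lookup_sum lookup_single when_def)
  also have "\<dots> = Poly_Mapping.lookup f k"
    using assms by (auto simp: in_keys_iff)
  finally show "Poly_Mapping.lookup (\<Sum>w\<in>S. Poly_Mapping.single w (Poly_Mapping.lookup f w)) k = Poly_Mapping.lookup f k" .
qed

lemma free_alg_induct [consumes 1, case_names zero single add]:
  assumes "f \<in> free_alg L"
    and "P 0"
    and "\<And>w c. set (letters w) \<subseteq> L \<Longrightarrow> P (Poly_Mapping.single w c)"
    and add: "\<And>f g. f \<in> free_alg L \<Longrightarrow> g \<in> free_alg L \<Longrightarrow> P f \<Longrightarrow> P g \<Longrightarrow> P (f + g)"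
  shows "P f"
proof -
  have fa: "(\<Sum>w\<in>S. Poly_Mapping.single w (Poly_Mapping.lookup f w)) \<in> free_alg L" if "S \<subseteq> Poly_Mapping.keys f" for S
    using that assms(1) keys_sum[of "\<lambda>w. Poly_Mapping.single w (Poly_Mapping.lookup f w)" S]
    by (fastforce simp: free_alg_def split: if_splits)
  have "P (\<Sum>w\<in>S. Poly_Mapping.single w (Poly_Mapping.lookup f w))" if "finite S" "S \<subseteq> Poly_Mapping.keys f" for S
    using that
  proof (induction S rule: finite_induct)
    case empty
    then show ?case using assms(2) by simp
  next
    case (insert w S)
    have "Poly_Mapping.single w (Poly_Mapping.lookup f w) \<in> free_alg L"
      using insert.prems assms(1) by (auto simp: free_alg_def)
    then show ?case
      using insert assms(1) by (auto simp: free_alg_def intro!: add fa assms(3))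
  qed
  from this[of "Poly_Mapping.keys f"] show ?thesis
    by (simp add: poly_mapping_sum_superset)
qed

lemma free_alg_UNIV [simp]: "free_alg UNIV = UNIV"
  by (simp add: free_alg_def)

lemma single_Word_Cons:
  "Poly_Mapping.single (Word (x # xs)) c = free_gen x * Poly_Mapping.single (Word xs) c"
  by (simp add: free_gen_def mult_single plus_word_def)

lemma single_Word_Nil: "Poly_Mapping.single (Word []) c = cst c"
  by (simp add: zero_word_def)

lemma free_algebra_induct [case_names cst gen add]:
  fixes f :: "'l word \<Rightarrow>\<^sub>0 complex"
  assumes cst: "\<And>c. P (cst c)"
    and gen: "\<And>x g. P g \<Longrightarrow> P (free_gen x * g)"
    and add: "\<And>g h. P g \<Longrightarrow> P h \<Longrightarrow> P (g + h)"
  shows "P f"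
proof -
  have s: "P (Poly_Mapping.single w c)" for w c
  proof (cases w)
    case (Word ls)
    have "P (Poly_Mapping.single (Word ls) c)"
      by (induction ls) (auto simp: single_Word_Nil single_Word_Cons cst gen)
    then show ?thesis by (simp add: Word)
  qed
  have "f \<in> free_alg UNIV" by simp
  then show ?thesis
    by (induction rule: free_alg_induct) (use s[of 0 0] s add in auto)
qed

lemma cst_central: "cst c * f = f * cst c"
proof (induction f rule: free_algebra_induct)
  case (cst d)
  then show ?case by (simp add: mult_single mult.commute)
next
  case (gen x g)
  have "cst c * (free_gen x * g) = (cst c * free_gen x) * g"
    by (rule mult.assoc[symmetric])
  also have "cst c * free_gen x = free_gen x * cst c"
    by (simp add: free_gen_def mult_single)
  also have "(free_gen x * cst c) * g = free_gen x * (cst c * g)"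
    by (rule mult.assoc)
  also have "\<dots> = free_gen x * (g * cst c)"
    by (simp only: gen)
  also have "\<dots> = free_gen x * g * cst c"
    by (rule mult.assoc[symmetric])
  finally show ?case .
qed (simp only: distrib_left distrib_right)

lemma free_scale_mult_left: "free_scale c f * g = free_scale c (f * g)"
  by (simp add: free_scale_def mult.assoc)

lemma free_scale_mult_right: "f * free_scale c g = free_scale c (f * g)"
  unfolding free_scale_def by (metis cst_central mult.assoc)

lemma free_scale_add: "free_scale c (f + g) = free_scale c f + free_scale c g"
  by (simp add: free_scale_def algebra_simps)

lemma vector_space_free_scale: "vector_space (free_scale :: complex \<Rightarrow> _ \<Rightarrow> ('l word \<Rightarrow>\<^sub>0 complex))"
proof
  fix a b :: complex and x y :: "'l word \<Rightarrow>\<^sub>0 complex"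
  show "free_scale a (free_scale b x) = free_scale (a * b) x"
    by (simp add: free_scale_def mult.assoc[symmetric] mult_single)
qed (simp_all add: free_scale_def algebra_simps single_add)

lemma free_alg_add: "f \<in> free_alg L \<Longrightarrow> g \<in> free_alg L \<Longrightarrow> f + g \<in> free_alg L"
  using keys_add[of f g] by (auto simp: free_alg_def)

lemma free_alg_mult: "f \<in> free_alg L \<Longrightarrow> g \<in> free_alg L \<Longrightarrow> f * g \<in> free_alg L"
  using keys_mult[of f g] by (fastforce simp: free_alg_def plus_word_def)

lemma free_alg_cst: "cst c \<in> free_alg L"
  by (auto simp: free_alg_def zero_word_def)

lemma free_alg_1: "1 \<in> free_alg L"
  using free_alg_cst[of 1] by simp

lemma free_alg_gen: "x \<in> L \<Longrightarrow> free_gen x \<in> free_alg L"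
  by (auto simp: free_alg_def free_gen_def)

lemma free_alg_scale: "f \<in> free_alg L \<Longrightarrow> free_scale c f \<in> free_alg L"
  by (simp add: free_scale_def free_alg_mult free_alg_cst)

lemma free_alg_diff: "f \<in> free_alg L \<Longrightarrow> g \<in> free_alg L \<Longrightarrow> f - g \<in> free_alg L"
  using keys_diff[of f g] by (auto simp: free_alg_def)

definition left_ideal :: "'a::ring_1 set \<Rightarrow> bool" where
  "left_ideal K \<longleftrightarrow> 0 \<in> K \<and> (\<forall>f\<in>K. \<forall>g\<in>K. f + g \<in> K) \<and> (\<forall>f\<in>K. \<forall>g. g * f \<in> K)"

definition left_ideal_hull :: "'a::ring_1 set \<Rightarrow> 'a set" where
  "left_ideal_hull T = \<Inter>{K. left_ideal K \<and> T \<subseteq> K}"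

lemma left_idealD:
  assumes "left_ideal K"
  shows "0 \<in> K" "f \<in> K \<Longrightarrow> g \<in> K \<Longrightarrow> f + g \<in> K" "f \<in> K \<Longrightarrow> h * f \<in> K"
    "f \<in> K \<Longrightarrow> - f \<in> K" "f \<in> K \<Longrightarrow> g \<in> K \<Longrightarrow> f - g \<in> K"
proof -
  show *: "0 \<in> K" "f \<in> K \<Longrightarrow> g \<in> K \<Longrightarrow> f + g \<in> K" "f \<in> K \<Longrightarrow> h * f \<in> K" for f g h
    using assms by (auto simp: left_ideal_def)
  show **: "f \<in> K \<Longrightarrow> - f \<in> K" for f using *(3)[of f "-1"] by simp
  show "f \<in> K \<Longrightarrow> g \<in> K \<Longrightarrow> f - g \<in> K" using *(2)[of f "-g"] **[of g] by simp
qed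

lemma left_ideal_hull: "left_ideal (left_ideal_hull T)"
  by (auto simp: left_ideal_hull_def left_ideal_def)

lemma left_ideal_hull_superset: "T \<subseteq> left_ideal_hull T"
  by (auto simp: left_ideal_hull_def)

lemma left_ideal_hull_minimal: "left_ideal K \<Longrightarrow> T \<subseteq> K \<Longrightarrow> left_ideal_hull T \<subseteq> K"
  by (auto simp: left_ideal_hull_def)

text \<open>Constants and letters generate the free algebra, so the closure properties recorded in
  \<open>gmod_submodule\<close> already give stability under all left multiplications.\<close>

lemma left_ideal_freeI:
  fixes K :: "('l word \<Rightarrow>\<^sub>0 complex) set"
  assumes "0 \<in> K" and add: "\<And>f g. f \<in> K \<Longrightarrow> g \<in> K \<Longrightarrow> f + g \<in> K"
    and sc: "\<And>c f. f \<in> K \<Longrightarrow> free_scale c f \<in> K"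
    and gen: "\<And>x f. f \<in> K \<Longrightarrow> free_gen x * f \<in> K"
  shows "left_ideal K"
proof -
  have "g * f \<in> K" if "f \<in> K" for f g
    by (induction g rule: free_algebra_induct)
      (use that in \<open>auto simp: distrib_right mult.assoc add gen sc[unfolded free_scale_def]\<close>)
  then show ?thesis using assms by (auto simp: left_ideal_def)
qed

lemma left_ideal_scale: "left_ideal K \<Longrightarrow> f \<in> K \<Longrightarrow> free_scale c f \<in> K"
  by (simp add: free_scale_def left_idealD)


section \<open>Presentations of graded modules\<close>

text \<open>All modules below are quotients of the free algebra on \<open>\<gg>[t]\<close> by a left ideal. Working
  with the left ideal avoids the iterated cosets of the definitions.\<close>

definition presents ::
    "('l, 'm) gmod \<Rightarrow> (('l word \<Rightarrow>\<^sub>0 complex) \<Rightarrow> 'm) \<Rightarrow> ('l word \<Rightarrow>\<^sub>0 complex) set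
      \<Rightarrow> (nat \<Rightarrow> ('l word \<Rightarrow>\<^sub>0 complex) set) \<Rightarrow> bool" where
  "presents M p K G \<longleftrightarrow> left_ideal K \<and> carr M = range p \<and> (\<forall>f g. p f = p g \<longleftrightarrow> f - g \<in> K) \<and>
     (\<forall>f g. madd M (p f) (p g) = p (f + g)) \<and> (\<forall>c f. msmult M c (p f) = p (free_scale c f)) \<and>
     (\<forall>x f. mact M x (p f) = p (free_gen x * f)) \<and> (\<forall>n. mgrade M n = p ` G n)"

lemma presentsD:
  assumes "presents M p K G"
  shows "left_ideal K" "carr M = range p" "p f = p g \<longleftrightarrow> f - g \<in> K"
    "madd M (p f) (p g) = p (f + g)" "msmult M c (p f) = p (free_scale c f)"
    "mact M x (p f) = p (free_gen x * f)" "mgrade M n = p ` G n"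
  using assms by (auto simp: presents_def)

text \<open>Equal kernels make the passage from \<open>p a\<close> to \<open>q a\<close> independent
  of the representative \<open>a\<close> and injective; the common \<open>G\<close> makes it carry
  homogeneous components to each other.\<close>

lemma presents_graded_isomorphic:
  assumes M: "presents M p K G" and M': "presents M' q K G"
  shows "graded_isomorphic M M'"
proof -
  define f where "f m = q (SOME a. p a = m)" for m
  have f: "f (p a) = q a" for a
  proof -
    have "p (SOME b. p b = p a) = p a" by (rule someI) simp
    then show ?thesis by (simp add: f_def presentsD(3)[OF M] presentsD(3)[OF M'])
  qed
  show ?thesis unfolding graded_isomorphic_def
  proof (intro exI[of _ f] conjI)
    show "bij_betw f (carr M) (carr M')"
      by (auto simp: bij_betw_def inj_on_def presentsD(2)[OF M] presentsD(2)[OF M'] f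
          presentsD(3)[OF M] presentsD(3)[OF M'] image_image)
  qed (auto simp: presentsD[OF M] presentsD[OF M'] f image_image)
qed

lemma gmod_submoduleD:
  assumes "gmod_submodule M S"
  shows "S \<subseteq> carr M" "S \<noteq> {}" "a \<in> S \<Longrightarrow> b \<in> S \<Longrightarrow> madd M a b \<in> S"
    "a \<in> S \<Longrightarrow> msmult M c a \<in> S" "a \<in> S \<Longrightarrow> mact M x a \<in> S"
  using assms unfolding gmod_submodule_def by simp_all

lemma presents_submodule_vimage:
  assumes M: "presents M p K G" and S: "gmod_submodule M S"
  shows "left_ideal (p -` S)" "K \<subseteq> p -` S" "p ` (p -` S) = S"
proof -
  note S = gmod_submoduleD[OF S]
  show S': "p ` (p -` S) = S"
    using S(1) unfolding presentsD(2)[OF M] by blast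
  obtain a where a: "p a \<in> S" using S(2) S' by blast
  \<comment> \<open>A submodule is only required to be nonempty; scaling one of its elements by 0
    provides the zero vector.\<close>
  from S(4)[OF a, of 0] have z: "p 0 \<in> S"
    by (simp add: presentsD(5)[OF M] free_scale_def)
  show "left_ideal (p -` S)"
  proof (rule left_ideal_freeI)
    fix f g c x assume f: "f \<in> p -` S"
    show "free_scale c f \<in> p -` S" "free_gen x * f \<in> p -` S"
      using S(4,5) f by (simp_all flip: presentsD(5,6)[OF M])
    assume "g \<in> p -` S"
    then show "f + g \<in> p -` S"
      using S(3) f by (simp flip: presentsD(4)[OF M])
  qed (use z in simp)
  have "p a = p 0" if "a \<in> K" for a using that presentsD(3)[OF M] by simp
  then show "K \<subseteq> p -` S" using z by auto
qed

text \<open>Pulled back along \<open>p\<close>, the cosets of \<open>S\<close> are residue classes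
  modulo the preimage of \<open>S\<close>, a left ideal. Successive quotients thus remain quotients
  of the same free algebra with the same grading.\<close>

lemma presents_quot:
  fixes M :: "('l, 'm) gmod"
  assumes M: "presents M p K G" and S: "gmod_submodule M S"
  shows "presents (gmod_quot M S) (gmod_coset M S \<circ> p) (p -` S) G"
proof -
  note V = presents_submodule_vimage[OF M S]
  note I = left_idealD[OF V(1)]
  have coset: "gmod_coset M S (p f) = p ` {g. g - f \<in> p -` S}" for f
  proof -
    have "{g. g - f \<in> p -` S} = (\<lambda>k. f + k) ` (p -` S)"
      by (auto simp: image_iff add.commute intro!: bexI[where x = "x - f" for x])
    moreover have "gmod_coset M S (p f) = (\<lambda>k. p (f + k)) ` (p -` S)"
      unfolding gmod_coset_def
      by (subst V(3)[symmetric]) (simp only: image_image presentsD(4)[OF M])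
    ultimately show ?thesis by (simp add: image_image)
  qed
  have mem: "p g \<in> p ` {g. g - f \<in> p -` S} \<longleftrightarrow> g - f \<in> p -` S" for f g
  proof
    assume "p g \<in> p ` {g. g - f \<in> p -` S}"
    then obtain h where h: "p g = p h" "h - f \<in> p -` S" by auto
    then have "g - h \<in> p -` S" using V(2) presentsD(3)[OF M] by auto
    from I(2)[OF this h(2)] show "g - f \<in> p -` S" by simp
  qed auto
  have eq: "gmod_coset M S (p f) = gmod_coset M S (p g) \<longleftrightarrow> f - g \<in> p -` S" for f g
  proof
    assume "gmod_coset M S (p f) = gmod_coset M S (p g)"
    moreover have "p f \<in> gmod_coset M S (p f)" unfolding coset using I(1) by auto
    ultimately have "p f \<in> gmod_coset M S (p g)" by simp
    then show "f - g \<in> p -` S" unfolding coset mem .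
  next
    assume fg: "f - g \<in> p -` S"
    have "h - f \<in> p -` S \<longleftrightarrow> h - g \<in> p -` S" for h
      using I(2)[OF _ fg, of "h - f"] I(5)[OF _ fg, of "h - g"] by auto
    then show "gmod_coset M S (p f) = gmod_coset M S (p g)" by (simp add: coset)
  qed
  \<comment> \<open>The operations of \<open>gmod_quot\<close> are unions over representatives; such
    a union collapses to a single term once the term is constant on the coset.\<close>
  have un: "(\<Union>a\<in>gmod_coset M S (p f). X a) = X (p f)"
    if "\<And>g. g - f \<in> p -` S \<Longrightarrow> X (p g) = X (p f)" for f and X :: "'m \<Rightarrow> 'm set"
  proof -
    have "X a = X (p f)" if "a \<in> gmod_coset M S (p f)" for a
      using that \<open>\<And>g. g - f \<in> p -` S \<Longrightarrow> X (p g) = X (p f)\<close> unfolding coset by blast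
    moreover have "p f \<in> gmod_coset M S (p f)" unfolding mem coset using I(1) by simp
    ultimately show ?thesis by blast
  qed
  show ?thesis unfolding presents_def
  proof (intro conjI allI)
    fix f g c x n
    show "carr (gmod_quot M S) = range (gmod_coset M S \<circ> p)"
      by (simp add: gmod_quot_def presentsD[OF M] image_comp)
    show "(gmod_coset M S \<circ> p) f = (gmod_coset M S \<circ> p) g \<longleftrightarrow> f - g \<in> p -` S"
      by (simp add: eq)
    have "(\<Union>b\<in>gmod_coset M S (p g). gmod_coset M S (madd M (p f') b)) = gmod_coset M S (p (f' + g))" for f'
      by (subst un) (simp_all add: presentsD[OF M] eq)
    moreover have "(\<Union>a\<in>gmod_coset M S (p f). \<Union>b\<in>gmod_coset M S (p g). gmod_coset M S (madd M a b))
        = (\<Union>b\<in>gmod_coset M S (p g). gmod_coset M S (madd M (p f) b))"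
      by (rule un) (simp add: eq calculation)
    ultimately show "madd (gmod_quot M S) ((gmod_coset M S \<circ> p) f) ((gmod_coset M S \<circ> p) g)
        = (gmod_coset M S \<circ> p) (f + g)"
      by (simp add: gmod_quot_def)
    have "(\<Union>a\<in>gmod_coset M S (p f). gmod_coset M S (msmult M c a)) = gmod_coset M S (msmult M c (p f))"
    proof (rule un)
      fix g assume "g - f \<in> p -` S"
      then have "free_scale c (g - f) \<in> p -` S" by (rule left_ideal_scale[OF V(1)])
      moreover have "free_scale c (g - f) = free_scale c g - free_scale c f"
        by (simp add: free_scale_def algebra_simps)
      ultimately show "gmod_coset M S (msmult M c (p g)) = gmod_coset M S (msmult M c (p f))"
        by (simp add: presentsD[OF M] eq)
    qed
    then show "msmult (gmod_quot M S) c ((gmod_coset M S \<circ> p) f) = (gmod_coset M S \<circ> p) (free_scale c f)"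
      by (simp add: gmod_quot_def presentsD[OF M])
    have "(\<Union>a\<in>gmod_coset M S (p f). gmod_coset M S (mact M x a)) = gmod_coset M S (mact M x (p f))"
    proof (rule un)
      fix g assume "g - f \<in> p -` S"
      then have "free_gen x * (g - f) \<in> p -` S" by (rule I(3))
      then show "gmod_coset M S (mact M x (p g)) = gmod_coset M S (mact M x (p f))"
        by (simp add: presentsD[OF M] eq algebra_simps)
    qed
    then show "mact (gmod_quot M S) x ((gmod_coset M S \<circ> p) f) = (gmod_coset M S \<circ> p) (free_gen x * f)"
      by (simp add: gmod_quot_def presentsD[OF M])
    show "mgrade (gmod_quot M S) n = (gmod_coset M S \<circ> p) ` G n"
      by (simp add: gmod_quot_def presentsD[OF M] image_comp)
  qed (rule V(1))
qed

lemma presents_generated: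
  assumes M: "presents M p K G"
  shows "gmod_submodule M (gmod_generated M (p ` T))"
    and "p -` gmod_generated M (p ` T) = left_ideal_hull (K \<union> T)"
proof -
  have img: "gmod_submodule M (p ` Q)" if "left_ideal Q" for Q
    unfolding gmod_submodule_def
  proof (intro conjI ballI allI)
    show "p ` Q \<subseteq> carr M" "p ` Q \<noteq> {}"
      using left_idealD(1)[OF that] presentsD(2)[OF M] by auto
    fix a b c x
    assume "a \<in> p ` Q"
    then obtain f where f: "a = p f" "f \<in> Q" by blast
    show "msmult M c a \<in> p ` Q" "mact M x a \<in> p ` Q"
      using left_ideal_scale[OF that f(2)] left_idealD(3)[OF that f(2)]
      by (simp_all add: f(1) presentsD(5,6)[OF M])
    assume "b \<in> p ` Q"
    then obtain g where g: "b = p g" "g \<in> Q" by blast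
    show "madd M a b \<in> p ` Q"
      using left_idealD(2)[OF that f(2) g(2)] by (simp add: f(1) g(1) presentsD(4)[OF M])
  qed
  \<comment> \<open>A left ideal containing the kernel \<open>K\<close> is a full preimage, so left
    ideals above \<open>K\<close> correspond to submodules.\<close>
  have sat: "p -` (p ` Q) = Q" if "left_ideal Q" "K \<subseteq> Q" for Q
  proof -
    have "g \<in> Q" if "p g = p f" "f \<in> Q" for f g
    proof -
      have "g - f \<in> Q" using that \<open>K \<subseteq> Q\<close> presentsD(3)[OF M] by auto
      from left_idealD(2)[OF \<open>left_ideal Q\<close> this \<open>f \<in> Q\<close>] show ?thesis by simp
    qed
    then show ?thesis by fastforce
  qed
  let ?S = "gmod_generated M (p ` T)" and ?Q = "left_ideal_hull (K \<union> T)"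
  have Q: "left_ideal ?Q" "K \<subseteq> ?Q" "T \<subseteq> ?Q"
    using left_ideal_hull left_ideal_hull_superset[of "K \<union> T"] by auto
  have "?S = p ` ?Q"
  proof
    show "?S \<subseteq> p ` ?Q"
      unfolding gmod_generated_def by (rule Inter_lower) (use img[OF Q(1)] Q(3) in auto)
    show "p ` ?Q \<subseteq> ?S"
    proof -
      have "p ` ?Q \<subseteq> S" if S: "gmod_submodule M S" "p ` T \<subseteq> S" for S
      proof -
        note V = presents_submodule_vimage[OF M S(1)]
        have "?Q \<subseteq> p -` S" using V S(2) by (intro left_ideal_hull_minimal) auto
        then show ?thesis by auto
      qed
      then show ?thesis by (auto simp: gmod_generated_def)
    qed
  qed
  then show "gmod_submodule M ?S" "p -` ?S = ?Q"
    using img[OF Q(1)] sat[OF Q(1,2)] by simp_all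
qed

lemma presents_quot_generated:
  assumes "presents M p K G"
  shows "presents (gmod_quot M (gmod_generated M (p ` T)))
           (gmod_coset M (gmod_generated M (p ` T)) \<circ> p) (left_ideal_hull (K \<union> T)) G"
  using presents_quot[OF assms presents_generated(1)[OF assms]]
  by (simp add: presents_generated(2)[OF assms])

section \<open>Representations of \<open>sl\<^sub>2\<close>\<close>

text \<open>A chain of weight spaces of a module over \<open>sl\<^sub>2\<close>, taken modulo a subspace \<open>K\<close>:
  on \<open>V j\<close> the element \<open>h\<close> acts by \<open>c + 2 j\<close>, and \<open>E\<close>, \<open>F\<close> act locally nilpotently.\<close>

locale sl2_chain = vector_space scale for scale :: "complex \<Rightarrow> 'v::ab_group_add \<Rightarrow> 'v" +
  fixes K :: "'v set" and E F :: "'v \<Rightarrow> 'v" and V :: "int \<Rightarrow> 'v set" and c :: complex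
  assumes subspace_K: "subspace K"
    and E_add: "E (u + v) = E u + E v" and E_scale: "E (scale a u) = scale a (E u)"
    and F_add: "F (u + v) = F u + F v" and F_scale: "F (scale a u) = scale a (F u)"
    and E_K: "u \<in> K \<Longrightarrow> E u \<in> K" and F_K: "u \<in> K \<Longrightarrow> F u \<in> K"
    and E_V: "u \<in> V j \<Longrightarrow> E u \<in> V (j + 1)" and F_V: "u \<in> V j \<Longrightarrow> F u \<in> V (j - 1)"
    and comm: "u \<in> V j \<Longrightarrow> E (F u) - F (E u) - scale (c + of_int (2 * j)) u \<in> K"
    and nil_E: "u \<in> V j \<Longrightarrow> \<exists>k. (E ^^ k) u \<in> K"
    and nil_F: "u \<in> V j \<Longrightarrow> \<exists>k. (F ^^ k) u \<in> K"
begin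

lemma F_diff: "F (u - v) = F u - F v"
  by (metis F_add add_diff_cancel diff_add_cancel)

text \<open>Exchanging \<open>E\<close> and \<open>F\<close> reverses the chain and negates the
  weights, so an argument for nonnegative weights also serves nonpositive ones.\<close>

lemma flip: "sl2_chain scale K F E (\<lambda>j. V (- j)) (- c)"
proof unfold_locales
  fix u j assume u: "u \<in> V (- j)"
  have "- (E (F u) - F (E u) - scale (c + of_int (2 * (- j))) u) \<in> K"
    using comm[OF u] subspace_K subspace_neg by blast
  moreover have "- scale (c + of_int (2 * (- j))) u = scale (- c + of_int (2 * j)) u"
    by (simp flip: scale_minus_left)
  ultimately show "F (E u) - E (F u) - scale (- c + of_int (2 * j)) u \<in> K"
    by (simp add: algebra_simps)
  show "F u \<in> V (- (j + 1))" using F_V[OF u] by simp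
  show "E u \<in> V (- (j - 1))" using E_V[OF u] by (simp add: add.commute)
  show "\<exists>k. (F ^^ k) u \<in> K" "\<exists>k. (E ^^ k) u \<in> K" using nil_E[OF u] nil_F[OF u] by auto
qed (use E_add E_scale F_add F_scale E_K F_K subspace_K in auto)

lemma F_pow_V:
  assumes "u \<in> V j"
  shows "(F ^^ i) u \<in> V (j - int i)"
proof (induction i)
  case (Suc i)
  have "j - int i - 1 = j - int (Suc i)" by simp
  then show ?case using F_V[OF Suc] by (metis comp_apply funpow.simps(2))
qed (use assms in simp)

lemma E_pow_V:
  assumes "u \<in> V j"
  shows "(E ^^ i) u \<in> V (j + int i)"
proof (induction i)
  case (Suc i)
  have "j + int i + 1 = j + int (Suc i)" by simp
  then show ?case using E_V[OF Suc] by (metis comp_apply funpow.simps(2))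
qed (use assms in simp)

lemma E_F_pow:
  assumes u: "u \<in> V j" "E u \<in> K" and a: "a = c + of_int (2 * j)"
  shows "E ((F ^^ Suc i) u) - scale (of_nat (Suc i) * (a - of_nat i)) ((F ^^ i) u) \<in> K"
proof (induction i)
  case 0
  have "F (E u) \<in> K" using u F_K by blast
  from subspace_add[OF subspace_K comm[OF u(1)] this] show ?case by (simp add: a)
next
  case (Suc i)
  define x where "x = (F ^^ Suc i) u"
  have x: "x \<in> V (j - int (Suc i))" using F_pow_V[OF u(1), of "Suc i"] by (simp only: x_def)
  have "F (E x) - scale (of_nat (Suc i) * (a - of_nat i)) x \<in> K"
    using F_K[OF Suc] by (simp add: F_diff F_scale x_def)
  from subspace_add[OF subspace_K comm[OF x] this]
  have "E (F x) - (scale (c + of_int (2 * (j - int (Suc i)))) x + scale (of_nat (Suc i) * (a - of_nat i)) x) \<in> K"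
    by (simp add: algebra_simps)
  also have "scale (c + of_int (2 * (j - int (Suc i)))) x + scale (of_nat (Suc i) * (a - of_nat i)) x
      = scale (of_nat (Suc (Suc i)) * (a - of_nat (Suc i))) x"
    by (simp add: a algebra_simps flip: scale_left_distrib)
  finally show ?case by (simp add: x_def)
qed

text \<open>At the first power of \<open>F\<close> that falls into \<open>K\<close>, applying
  \<open>E\<close> gives back a multiple of the preceding vector, which is outside \<open>K\<close>;
  so the scalar vanishes, and this ties the weight to the length of the string.\<close>

lemma primitive_weight:
  assumes u: "u \<in> V j" "E u \<in> K" "u \<notin> K"
  obtains n where "c + of_int (2 * j) = of_nat n" "(F ^^ Suc n) u \<in> K"
    "\<And>i. i \<le> n \<Longrightarrow> (F ^^ i) u \<notin> K"
proof -
  define q where "q = (LEAST q. (F ^^ q) u \<in> K)"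
  have q: "(F ^^ q) u \<in> K" unfolding q_def using nil_F[OF u(1)] by (rule LeastI_ex)
  have least: "(F ^^ i) u \<notin> K" if "i < q" for i
    using that not_less_Least unfolding q_def by blast
  have "q \<noteq> 0" using q u(3) by (metis funpow_0)
  then obtain n where n: "q = Suc n" by (metis not0_implies_Suc)
  define b where "b = of_nat (Suc n) * (c + of_int (2 * j) - of_nat n)"
  have "E ((F ^^ Suc n) u) \<in> K" using q n E_K by simp
  from subspace_diff[OF subspace_K this E_F_pow[OF u(1,2) refl, of n]]
  have b: "scale b ((F ^^ n) u) \<in> K" by (simp add: b_def)
  have "b = 0"
  proof (rule ccontr)
    assume "b \<noteq> 0"
    with subspace_scale[OF subspace_K b, of "inverse b"] have "(F ^^ n) u \<in> K" by simp
    with least[of n] n show False by simp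
  qed
  then have "c + of_int (2 * j) = of_nat n" unfolding b_def by (simp add: of_nat_neq_0 del: of_nat_Suc)
  with q least n that show ?thesis by (auto simp: less_Suc_eq_le)
qed

text \<open>\<open>E\<close> is applied as often as possible, \<open>p\<close> times; the resulting
  primitive vector has weight n = m + 2 p. Descending n - p steps reaches weight - m and stays
  within the string. The condition m \<ge> 0 ensures p \<le> n; the other sign is left to the
  flipped chain.\<close>

lemma string_aux:
  assumes u: "u \<in> V 0" "u \<notin> K"
  shows "\<exists>m::int. c = of_int m \<and> (m \<ge> 0 \<longrightarrow> (\<exists>v\<in>V (- m). v \<notin> K))"
proof -
  define q where "q = (LEAST q. (E ^^ q) u \<in> K)"
  have q: "(E ^^ q) u \<in> K" unfolding q_def using nil_E[OF u(1)] by (rule LeastI_ex)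
  have least: "(E ^^ i) u \<notin> K" if "i < q" for i
    using that not_less_Least unfolding q_def by blast
  have "q \<noteq> 0" using q u(2) by (metis funpow_0)
  then obtain p where p: "q = Suc p" by (metis not0_implies_Suc)
  define v where "v = (E ^^ p) u"
  have v: "v \<in> V (int p)" "E v \<in> K" "v \<notin> K"
    using E_pow_V[OF u(1), of p] q least p by (auto simp: v_def)
  from primitive_weight[OF this] obtain n where
    n: "c + of_int (2 * int p) = of_nat n" "\<And>i. i \<le> n \<Longrightarrow> (F ^^ i) v \<notin> K" by blast
  define m where "m = int n - 2 * int p"
  have "c = of_int m" using n(1) by (simp add: m_def algebra_simps)
  moreover have "\<exists>v\<in>V (- m). v \<notin> K" if "m \<ge> 0"
  proof
    have "p \<le> n" using that by (simp add: m_def)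
    then have "int p - int (n - p) = - m" by (simp add: m_def)
    then show "(F ^^ (n - p)) v \<in> V (- m)" using F_pow_V[OF v(1), of "n - p"] by simp
    show "(F ^^ (n - p)) v \<notin> K" by (rule n(2)) simp
  qed
  ultimately show ?thesis by blast
qed

lemma reflection:
  assumes u: "u \<in> V 0" "u \<notin> K"
  obtains m :: int where "c = of_int m" "\<exists>v\<in>V (- m). v \<notin> K"
proof -
  obtain m where m: "c = of_int m" "m \<ge> 0 \<Longrightarrow> \<exists>v\<in>V (- m). v \<notin> K"
    using string_aux[OF u] by blast
  obtain m' where m': "- c = of_int m'" "m' \<ge> 0 \<Longrightarrow> \<exists>v\<in>V (- (- m')). v \<notin> K"
    using sl2_chain.string_aux[OF flip, of u] u by fastforce
  have "m' = - m" using m(1) m'(1) by (metis of_int_eq_iff of_int_minus)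
  with m m' that show ?thesis by (cases "m \<ge> 0") auto
qed

end

section \<open>Root systems\<close>

locale chevalley_data =
  fixes H :: "'g::complex_lie_algebra set"
    and D :: "('g \<Rightarrow> complex) set"
    and e :: "('g \<Rightarrow> complex) \<Rightarrow> 'g"
  assumes fin_dim: "fin_dim_lie_algebra TYPE('g)"
    and cartan: "cartan_subalgebra H"
    and simple_roots: "simple_root_system H D"
    and chevalley: "chevalley_basis H D e"
begin

abbreviation "Rt \<equiv> roots H"
abbreviation "Rp \<equiv> pos_roots H D"

lemma subspace_H: "lie_vs.subspace H"
  using cartan by (simp add: cartan_subalgebra_def lie_subalgebra_def)

lemma finite_D: "finite D" and D_roots: "D \<subseteq> Rt"
  using simple_roots by (auto simp: simple_root_system_def)

lemma D_indep: "(\<And>h. (\<Sum>\<beta>\<in>D. k \<beta> * \<beta> h) = (0::complex)) \<Longrightarrow> \<beta> \<in> D \<Longrightarrow> k \<beta> = 0"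
  using simple_roots unfolding simple_root_system_def by blast

lemma e_nonzero: "\<alpha> \<in> Rt \<Longrightarrow> e \<alpha> \<noteq> 0"
  using chevalley lie_vs.dependent_zero unfolding chevalley_basis_def
  by (metis UnI1 image_eqI)

lemma pos_rootD:
  assumes "\<alpha> \<in> Rp"
  shows "\<alpha> \<in> Rt" "e \<alpha> \<in> root_space H \<alpha>" "e (- \<alpha>) \<in> root_space H (- \<alpha>)"
    "lie (coroot e \<alpha>) (e \<alpha>) = cscale 2 (e \<alpha>)"
    "lie (coroot e \<alpha>) (e (- \<alpha>)) = cscale (- 2) (e (- \<alpha>))"
    "\<alpha> \<in> nonneg_comb D"
  using chevalley assms by (auto simp: chevalley_basis_def pos_roots_def)

lemma root_dual: "\<alpha> \<in> Rt \<Longrightarrow> \<alpha> \<in> dual_space H"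
  by (simp add: roots_def)

lemma dual_uminus: "\<alpha> \<in> dual_space H \<Longrightarrow> - \<alpha> \<in> dual_space H"
  by (simp add: dual_space_def)

lemma dual_add: "\<alpha> \<in> dual_space H \<Longrightarrow> \<beta> \<in> dual_space H \<Longrightarrow> \<alpha> + \<beta> \<in> dual_space H"
  by (simp add: dual_space_def algebra_simps)

text \<open>If \<open>e (- \<alpha>)\<close> were zero, \<open>coroot e \<alpha>\<close> would
  vanish, against its eigenvalue 2 on \<open>e \<alpha>\<close>.\<close>

lemma neg_pos_root:
  assumes "\<alpha> \<in> Rp"
  shows "- \<alpha> \<in> Rt"
proof -
  have "e (- \<alpha>) \<noteq> 0"
  proof
    assume "e (- \<alpha>) = 0"
    then have "cscale 2 (e \<alpha>) = 0" using pos_rootD(4)[OF assms] by (simp add: coroot_def)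
    then show False using e_nonzero[OF pos_rootD(1)[OF assms]] by simp
  qed
  then show ?thesis
    using pos_rootD[OF assms] dual_uminus by (auto simp: roots_def)
qed

lemma root_cases: "\<alpha> \<in> Rt \<Longrightarrow> \<alpha> \<in> Rp \<or> - \<alpha> \<in> nonneg_comb D"
  using simple_roots by (auto simp: simple_root_system_def pos_roots_def)

lemma D_pos: "D \<subseteq> Rp"
proof
  fix \<alpha> assume \<alpha>: "\<alpha> \<in> D"
  have "(\<Sum>\<beta>\<in>D. of_nat (if \<beta> = \<alpha> then 1 else 0) * \<beta> h) = (\<Sum>\<beta>\<in>D. if \<beta> = \<alpha> then \<alpha> h else 0)" for h
    by (intro sum.cong) auto
  then have "\<alpha> = (\<lambda>h. \<Sum>\<beta>\<in>D. of_nat (if \<beta> = \<alpha> then 1 else 0) * \<beta> h)"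
    using \<alpha> finite_D by simp
  then show "\<alpha> \<in> Rp" using \<alpha> D_roots by (auto simp: pos_roots_def nonneg_comb_def)
qed

lemma finite_Rt: "finite Rt"
proof -
  obtain B :: "'g set" where "finite B" "lie_vs.span B = UNIV"
    using fin_dim by (auto simp: fin_dim_lie_algebra_def)
  then have "finite (e ` Rt \<union> coroot e ` D)"
    using lie_vs.independent_span_bound[of B "e ` Rt \<union> coroot e ` D"] chevalley
    by (simp add: chevalley_basis_def)
  then show ?thesis
    using chevalley finite_image_iff[of e Rt] by (simp add: chevalley_basis_def)
qed

section \<open>Root strings and reflections\<close>

lemma subspace_root_space: "lie_vs.subspace (root_space H \<theta>)"
  by (auto simp: lie_vs.subspace_def root_space_def lie_add_right cscale_add_right
      lie_cscale_right cscale_cscale mult.commute)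

lemma lie_derivation: "lie x (lie y z) = lie (lie x y) z + lie y (lie x (z :: 'g))"
proof -
  have "lie y (lie z x) + lie y (lie x z) = 0"
    using lie_swap[of z x] by (simp flip: lie_add_right)
  then have "lie y (lie z x) = - lie y (lie x z)" by (simp add: eq_neg_iff_add_eq_0)
  with lie_jacobi[of x y z] lie_swap[of z "lie x y"]
  have "lie x (lie y z) - (lie (lie x y) z + lie y (lie x z)) = 0" by (simp add: algebra_simps)
  then show ?thesis by simp
qed

lemma lie_root_space:
  assumes "x \<in> root_space H \<theta>" "y \<in> root_space H \<eta>"
  shows "lie x y \<in> root_space H (\<theta> + \<eta>)"
  using assms by (auto simp: root_space_def lie_derivation lie_cscale_left lie_cscale_right
      cscale_add_left)

lemma coroot_root_space:
  assumes "\<alpha> \<in> Rp"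
  shows "coroot e \<alpha> \<in> root_space H 0"
  using lie_root_space[OF pos_rootD(2,3)[OF assms]] by (simp add: coroot_def)

text \<open>The coroot has weight 0, so it commutes with \<open>H\<close>, and a Cartan subalgebra
  contains its normalizer.\<close>

lemma coroot_H:
  assumes "\<alpha> \<in> Rp"
  shows "coroot e \<alpha> \<in> H"
proof -
  have "lie (coroot e \<alpha>) h = 0" if "h \<in> H" for h
    using coroot_root_space[OF assms] that lie_swap[of "coroot e \<alpha>" h]
    by (simp add: root_space_def)
  moreover have "0 \<in> H" using subspace_H lie_vs.subspace_0 by blast
  ultimately show ?thesis using cartan unfolding cartan_subalgebra_def by metis
qed

lemma root_coroot:
  assumes "\<alpha> \<in> Rp"
  shows "\<alpha> (coroot e \<alpha>) = 2"
proof -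
  have "cscale (\<alpha> (coroot e \<alpha>)) (e \<alpha>) = cscale 2 (e \<alpha>)"
    using pos_rootD(2,4)[OF assms] coroot_H[OF assms] by (simp add: root_space_def)
  then show ?thesis using e_nonzero[OF pos_rootD(1)[OF assms]] by simp
qed

lemma root_space_trivial:
  "\<theta> \<in> dual_space H \<Longrightarrow> \<theta> \<noteq> 0 \<Longrightarrow> \<theta> \<notin> Rt \<Longrightarrow> root_space H \<theta> = {0}"
  by (auto simp: roots_def)

lemma dual_affine:
  "\<theta> \<in> dual_space H \<Longrightarrow> \<alpha> \<in> dual_space H \<Longrightarrow> (\<lambda>h. \<theta> h + c * \<alpha> h) \<in> dual_space H"
  by (simp add: dual_space_def algebra_simps)

lemma root_string_finite:
  assumes "\<theta> \<in> dual_space H" "\<alpha> \<in> Rt"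
  obtains k :: nat where "root_space H (\<lambda>h. \<theta> h + of_nat k * \<alpha> h) = {0}"
proof -
  let ?f = "\<lambda>k::nat. \<lambda>h. \<theta> h + of_nat k * \<alpha> h"
  obtain h where h: "\<alpha> h \<noteq> 0" using assms(2) by (auto simp: roots_def fun_eq_iff)
  have "inj ?f"
  proof
    fix k l :: nat assume "?f k = ?f l"
    from fun_cong[OF this, of h] h show "k = l" by simp
  qed
  then have "infinite (range ?f)" by (simp add: finite_image_iff)
  then obtain k where "?f k \<notin> insert 0 Rt"
    using finite_Rt finite_subset[of "range ?f" "insert 0 Rt"] by auto
  with root_space_trivial[OF dual_affine[OF assms(1) root_dual[OF assms(2)]]] that
  show ?thesis by blast
qed

lemma ad_nilpotent:
  assumes "\<theta> \<in> dual_space H" "\<alpha> \<in> Rt" "x \<in> root_space H \<alpha>" "u \<in> root_space H \<theta>"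
  obtains k where "(lie x ^^ k) u = 0"
proof -
  have *: "(lie x ^^ k) u \<in> root_space H (\<lambda>h. \<theta> h + of_nat k * \<alpha> h)" for k
  proof (induction k)
    case (Suc k)
    have "\<alpha> + (\<lambda>h. \<theta> h + of_nat k * \<alpha> h) = (\<lambda>h. \<theta> h + of_nat (Suc k) * \<alpha> h)"
      by (simp add: fun_eq_iff algebra_simps)
    then show ?case using lie_root_space[OF assms(3) Suc] by simp
  qed (use assms(4) in simp)
  from root_string_finite[OF assms(1,2)] * that show ?thesis by blast
qed

definition reflect :: "('g \<Rightarrow> complex) \<Rightarrow> ('g \<Rightarrow> complex) \<Rightarrow> ('g \<Rightarrow> complex)" where
  "reflect \<alpha> \<theta> = (\<lambda>h. \<theta> h - \<theta> (coroot e \<alpha>) * \<alpha> h)"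

lemma reflect_reflect: "\<alpha> \<in> Rp \<Longrightarrow> reflect \<alpha> (reflect \<alpha> \<theta>) = \<theta>"
  by (simp add: reflect_def fun_eq_iff root_coroot algebra_simps)

lemma reflect_uminus: "reflect \<alpha> (- \<theta>) = - reflect \<alpha> \<theta>"
  by (simp add: reflect_def fun_eq_iff)

text \<open>The root spaces along the line \<beta> + j \<alpha> form a chain, with \<open>K\<close>
  equal to \<open>{0}\<close>, for the copy of sl_2 attached to \<alpha>; \<open>reflection\<close>
  supplies the integer and a nonzero vector at the mirrored place.\<close>

lemma reflect_root:
  assumes \<alpha>: "\<alpha> \<in> Rp" and \<beta>: "\<beta> \<in> Rt"
  shows "\<beta> (coroot e \<alpha>) \<in> \<int>" "reflect \<alpha> \<beta> \<in> Rt"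
proof -
  define V where "V j = root_space H (\<lambda>h. \<beta> h + of_int j * \<alpha> h)" for j :: int
  have d: "\<alpha> \<in> dual_space H" "\<beta> \<in> dual_space H"
    using pos_rootD(1)[OF \<alpha>] \<beta> root_dual by auto
  note r = pos_rootD(2,3)[OF \<alpha>]
  interpret sl2_chain cscale "{0}" "lie (e \<alpha>)" "lie (e (- \<alpha>))" V "\<beta> (coroot e \<alpha>)"
  proof unfold_locales
    fix u j assume u: "u \<in> V j"
    have "\<alpha> + (\<lambda>h. \<beta> h + of_int j * \<alpha> h) = (\<lambda>h. \<beta> h + of_int (j + 1) * \<alpha> h)"
      "- \<alpha> + (\<lambda>h. \<beta> h + of_int j * \<alpha> h) = (\<lambda>h. \<beta> h + of_int (j - 1) * \<alpha> h)"
      by (simp_all add: fun_eq_iff algebra_simps)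
    note eq = this[symmetric]
    show "lie (e \<alpha>) u \<in> V (j + 1)"
      unfolding V_def eq(1) by (rule lie_root_space[OF r(1) u[unfolded V_def]])
    show "lie (e (- \<alpha>)) u \<in> V (j - 1)"
      unfolding V_def eq(2) by (rule lie_root_space[OF r(2) u[unfolded V_def]])
    have "lie (coroot e \<alpha>) u = cscale (\<beta> (coroot e \<alpha>) + of_int (2 * j)) u"
      using u coroot_H[OF \<alpha>] by (simp add: V_def root_space_def root_coroot[OF \<alpha>] mult.commute)
    then show "lie (e \<alpha>) (lie (e (- \<alpha>)) u) - lie (e (- \<alpha>)) (lie (e \<alpha>) u)
        - cscale (\<beta> (coroot e \<alpha>) + of_int (2 * j)) u \<in> {0}"
      by (simp add: coroot_def lie_derivation[of "e \<alpha>" "e (- \<alpha>)" u])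
    obtain k where "(lie (e \<alpha>) ^^ k) u = 0"
      using ad_nilpotent[OF dual_affine[OF d(2,1)] pos_rootD(1)[OF \<alpha>] r(1) u[unfolded V_def]] .
    then show "\<exists>k. (lie (e \<alpha>) ^^ k) u \<in> {0}" by auto
    obtain k where "(lie (e (- \<alpha>)) ^^ k) u = 0"
      using ad_nilpotent[OF dual_affine[OF d(2,1)] neg_pos_root[OF \<alpha>] r(2) u[unfolded V_def]] .
    then show "\<exists>k. (lie (e (- \<alpha>)) ^^ k) u \<in> {0}" by auto
  qed (auto simp: lie_add_right lie_cscale_right lie_vs.subspace_0)
  obtain u where u: "u \<in> V 0" "u \<notin> {0}"
    using \<beta> subspace_root_space[of \<beta>] lie_vs.subspace_0 by (fastforce simp: V_def roots_def)
  obtain m :: int where m: "\<beta> (coroot e \<alpha>) = of_int m" "\<exists>v\<in>V (- m). v \<notin> {0}"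
    using reflection[OF u] .
  show "\<beta> (coroot e \<alpha>) \<in> \<int>" using m(1) by simp
  have "reflect \<alpha> \<beta> = (\<lambda>h. \<beta> h + of_int (- m) * \<alpha> h)"
    by (simp add: reflect_def m(1))
  note r = this
  have "reflect \<alpha> \<beta> \<in> dual_space H" unfolding r by (rule dual_affine[OF d(2,1)])
  moreover have "root_space H (reflect \<alpha> \<beta>) \<noteq> {0}"
    using m(2) unfolding r V_def by blast
  moreover have "reflect \<alpha> \<beta> \<noteq> 0"
  proof
    assume "reflect \<alpha> \<beta> = 0"
    then have "\<beta> = reflect \<alpha> 0" using reflect_reflect[OF \<alpha>, of \<beta>] by simp
    then have "\<beta> = 0" by (simp add: reflect_def fun_eq_iff)
    then show False using \<beta> by (simp add: roots_def)
  qed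
  ultimately show "reflect \<alpha> \<beta> \<in> Rt" by (simp add: roots_def)
qed

lemma bij_reflect: "\<alpha> \<in> Rp \<Longrightarrow> bij_betw (reflect \<alpha>) Rt Rt"
  by (rule bij_betw_byWitness[where f' = "reflect \<alpha>"]) (auto simp: reflect_reflect reflect_root)

section \<open>Spanning of the Cartan subalgebra by simple coroots, and negatives of roots\<close>

lemma weight_vectors_independent:
  assumes "finite \<Gamma>" "\<And>\<gamma>. \<gamma> \<in> \<Gamma> \<Longrightarrow> \<gamma> \<in> dual_space H"
    "\<And>\<gamma>. \<gamma> \<in> \<Gamma> \<Longrightarrow> v \<gamma> \<in> root_space H \<gamma>" "(\<Sum>\<gamma>\<in>\<Gamma>. v \<gamma>) = 0" "\<gamma> \<in> \<Gamma>"
  shows "v \<gamma> = 0"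
  using assms
proof (induction \<Gamma> arbitrary: v \<gamma> rule: finite_induct)
  case (insert \<delta> \<Gamma>)
  have 0: "v \<gamma> = 0" if \<gamma>: "\<gamma> \<in> \<Gamma>" for \<gamma>
  proof -
    have "\<gamma> \<noteq> \<delta>" using \<gamma> insert.hyps by blast
    then obtain h where h: "\<gamma> h \<noteq> \<delta> h" by (auto simp: fun_eq_iff)
    have "h \<in> H"
    proof (rule ccontr)
      assume "h \<notin> H"
      then have "\<gamma> h = 0" "\<delta> h = 0" using insert.prems(1) \<gamma> by (auto simp: dual_space_def)
      then show False using h by simp
    qed
    have l: "lie h (v \<gamma>) = cscale (\<gamma> h) (v \<gamma>)" if "\<gamma> \<in> insert \<delta> \<Gamma>" for \<gamma>
      using insert.prems(2)[OF that] \<open>h \<in> H\<close> by (simp add: root_space_def)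
    \<comment> \<open>Subtracting \<delta>(h) times the relation from its image under ad
      \<open>h\<close> removes the \<delta>-term and leaves \<gamma> with a nonzero factor.\<close>
    have "(\<Sum>\<gamma>\<in>insert \<delta> \<Gamma>. cscale (\<gamma> h) (v \<gamma>)) = lie h (\<Sum>\<gamma>\<in>insert \<delta> \<Gamma>. v \<gamma>)"
      unfolding lie_sum_right by (intro sum.cong) (simp_all add: l)
    also have "\<dots> = 0" by (simp only: insert.prems(3) lie_zero_right)
    finally have "(\<Sum>\<gamma>\<in>insert \<delta> \<Gamma>. cscale (\<gamma> h) (v \<gamma>)) = 0" .
    moreover have "(\<Sum>\<gamma>\<in>insert \<delta> \<Gamma>. cscale (\<delta> h) (v \<gamma>)) = 0"
      by (simp only: insert.prems(3) cscale_zero flip: lie_vs.scale_sum_right)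
    ultimately have "(\<Sum>\<gamma>\<in>insert \<delta> \<Gamma>. cscale (\<gamma> h) (v \<gamma>) - cscale (\<delta> h) (v \<gamma>)) = 0"
      by (simp only: sum_subtractf diff_self)
    then have "(\<Sum>\<gamma>\<in>\<Gamma>. cscale (\<gamma> h - \<delta> h) (v \<gamma>)) = 0"
      using insert.hyps by (simp add: lie_vs.scale_left_diff_distrib)
    moreover have "cscale (\<gamma> h - \<delta> h) (v \<gamma>) \<in> root_space H \<gamma>" if "\<gamma> \<in> \<Gamma>" for \<gamma>
      using insert.prems(2) that subspace_root_space lie_vs.subspace_scale by blast
    ultimately have "cscale (\<gamma> h - \<delta> h) (v \<gamma>) = 0"
      using insert.IH[of "\<lambda>\<gamma>. cscale (\<gamma> h - \<delta> h) (v \<gamma>)" \<gamma>] insert.prems(1) \<gamma> by blast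
    then show ?thesis using h by simp
  qed
  then have "v \<delta> = 0" using insert.prems(3) insert.hyps by simp
  with 0 insert.prems(4) show ?case by auto
qed simp

text \<open>For a root that is neither positive nor the negative of a positive root,
  \<open>e \<gamma>\<close> is not known to lie in the root space. Hence genuine root vectors
  \<open>x \<gamma>\<close> are chosen: together with the simple coroots they are independent and as
  numerous as the Chevalley basis, so they span. Nilpotency of \<open>H\<close> then removes the
  root components of every element of \<open>H\<close>.\<close>

lemma H_coroots: "H \<subseteq> lie_vs.span (coroot e ` D)"
proof
  fix h assume h: "h \<in> H"
  have "\<exists>x. x \<in> root_space H \<gamma> \<and> x \<noteq> 0" if "\<gamma> \<in> Rt" for \<gamma>
    using that subspace_root_space[of \<gamma>] lie_vs.subspace_0 by (fastforce simp: roots_def)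
  then obtain x where x: "\<And>\<gamma>. \<gamma> \<in> Rt \<Longrightarrow> x \<gamma> \<in> root_space H \<gamma>" "\<And>\<gamma>. \<gamma> \<in> Rt \<Longrightarrow> x \<gamma> \<noteq> 0"
    by metis
  have root_nz: "0 \<notin> Rt" by (simp add: roots_def)
  have D0: "k \<in> root_space H 0" if "k \<in> lie_vs.span (coroot e ` D)" for k
  proof -
    have "coroot e ` D \<subseteq> root_space H 0" using coroot_root_space D_pos by blast
    then show ?thesis using lie_vs.span_minimal[OF _ subspace_root_space] that by blast
  qed
  have indep: "(\<forall>\<gamma>\<in>Rt. v \<gamma> = 0) \<and> k = 0"
    if v: "\<And>\<gamma>. \<gamma> \<in> Rt \<Longrightarrow> v \<gamma> \<in> root_space H \<gamma>" and k: "k \<in> root_space H 0"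
      and z: "(\<Sum>\<gamma>\<in>Rt. v \<gamma>) + k = 0" for v k
  proof -
    \<comment> \<open>The vector \<open>k\<close> of weight 0 is filed under the functional 0, which
      is not a root, so that the independence of weight vectors covers it.\<close>
    define v' where "v' = v(0 := k)"
    have "(\<Sum>\<gamma>\<in>Rt. v' \<gamma>) = (\<Sum>\<gamma>\<in>Rt. v \<gamma>)"
      using root_nz by (intro sum.cong) (auto simp: v'_def)
    then have "(\<Sum>\<gamma>\<in>insert 0 Rt. v' \<gamma>) = 0"
      using z root_nz finite_Rt by (simp add: v'_def add.commute)
    moreover have "\<gamma> \<in> dual_space H" "v' \<gamma> \<in> root_space H \<gamma>" if "\<gamma> \<in> insert 0 Rt" for \<gamma>
      using that root_dual v k by (auto simp: v'_def dual_space_def)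
    ultimately have "v' \<gamma> = 0" if "\<gamma> \<in> insert 0 Rt" for \<gamma>
      using weight_vectors_independent[of "insert 0 Rt" v'] finite_Rt that by blast
    then show ?thesis using root_nz by (metis fun_upd_apply insertI1 insertI2 v'_def)
  qed
  have inj_x: "inj_on x Rt"
  proof
    fix \<gamma> \<delta> assume g: "\<gamma> \<in> Rt" "\<delta> \<in> Rt" "x \<gamma> = x \<delta>"
    show "\<gamma> = \<delta>"
    proof (rule ccontr)
      assume ne: "\<gamma> \<noteq> \<delta>"
      define v where "v \<eta> = (if \<eta> = \<gamma> then x \<gamma> else if \<eta> = \<delta> then - x \<delta> else 0)" for \<eta>
      have "(\<Sum>\<eta>\<in>Rt. v \<eta>) = (\<Sum>\<eta>\<in>{\<gamma>, \<delta>}. v \<eta>)"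
        using g finite_Rt by (intro sum.mono_neutral_right) (auto simp: v_def)
      also have "\<dots> = 0" using ne g by (simp add: v_def)
      finally have "(\<Sum>\<eta>\<in>Rt. v \<eta>) + 0 = 0" by simp
      moreover have "v \<eta> \<in> root_space H \<eta>" if "\<eta> \<in> Rt" for \<eta>
        using x(1) that lie_vs.subspace_neg[OF subspace_root_space[of \<eta>]]
          lie_vs.subspace_0[OF subspace_root_space[of \<eta>]]
        by (auto simp: v_def)
      ultimately have "v \<gamma> = 0"
        using indep[of v 0] g lie_vs.subspace_0[OF subspace_root_space] by blast
      then show False using x(2) g by (simp add: v_def)
    qed
  qed
  have disj: "x ` Rt \<inter> coroot e ` D = {}"
  proof (rule ccontr)
    assume "x ` Rt \<inter> coroot e ` D \<noteq> {}"
    then obtain \<gamma> where g: "\<gamma> \<in> Rt" "x \<gamma> \<in> coroot e ` D" by auto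
    have "x \<gamma> \<in> root_space H 0" by (rule D0[OF lie_vs.span_base[OF g(2)]])
    then have "cscale (\<gamma> h) (x \<gamma>) = 0" if "h \<in> H" for h
    proof -
      have "lie h (x \<gamma>) = cscale (\<gamma> h) (x \<gamma>)"
        using x(1)[OF g(1)] that unfolding root_space_def by blast
      moreover have "lie h (x \<gamma>) = 0"
        using \<open>x \<gamma> \<in> root_space H 0\<close> that by (simp add: root_space_def)
      ultimately show ?thesis by simp
    qed
    then have "\<gamma> h = 0" if "h \<in> H" for h using x(2)[OF g(1)] that by simp
    moreover have "\<gamma> h = 0" if "h \<notin> H" for h
      using root_dual[OF g(1)] that by (simp add: dual_space_def)
    ultimately have "\<gamma> = 0" by (auto simp: fun_eq_iff)
    with g(1) root_nz show False by simp
  qed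
  define X where "X = x ` Rt \<union> coroot e ` D"
  have finX: "finite X" using finite_Rt finite_D by (simp add: X_def)
  have ind_coroot: "lie_vs.independent (coroot e ` D)"
    using chevalley lie_vs.independent_mono[of "e ` Rt \<union> coroot e ` D"]
    by (auto simp: chevalley_basis_def)
  have "lie_vs.independent X"
  proof
    assume "lie_vs.dependent X"
    then obtain u where u: "\<exists>v\<in>X. u v \<noteq> 0" "(\<Sum>v\<in>X. cscale (u v) v) = 0"
      using lie_vs.dependent_finite[OF finX] by auto
    define k where "k = (\<Sum>v\<in>coroot e ` D. cscale (u v) v)"
    have "(\<Sum>v\<in>X. cscale (u v) v) = (\<Sum>v\<in>x ` Rt. cscale (u v) v) + k"
      unfolding X_def k_def by (rule sum.union_disjoint) (use finite_Rt finite_D disj in auto)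
    also have "(\<Sum>v\<in>x ` Rt. cscale (u v) v) = (\<Sum>\<gamma>\<in>Rt. cscale (u (x \<gamma>)) (x \<gamma>))"
      using inj_x by (simp add: sum.reindex)
    finally have "(\<Sum>\<gamma>\<in>Rt. cscale (u (x \<gamma>)) (x \<gamma>)) + k = 0" using u(2) by simp
    moreover have "k \<in> root_space H 0"
      unfolding k_def by (intro D0 lie_vs.span_sum lie_vs.span_scale lie_vs.span_base)
    moreover have "cscale (u (x \<gamma>)) (x \<gamma>) \<in> root_space H \<gamma>" if "\<gamma> \<in> Rt" for \<gamma>
      using x(1)[OF that] subspace_root_space lie_vs.subspace_scale by blast
    ultimately have z: "\<forall>\<gamma>\<in>Rt. cscale (u (x \<gamma>)) (x \<gamma>) = 0" "k = 0"
      using indep[of "\<lambda>\<gamma>. cscale (u (x \<gamma>)) (x \<gamma>)" k] by blast+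
    have "u v = 0" if "v \<in> coroot e ` D" for v
      using lie_vs.dependent_finite[of "coroot e ` D"] finite_D ind_coroot z(2) that
      unfolding k_def by blast
    moreover have "u (x \<gamma>) = 0" if "\<gamma> \<in> Rt" for \<gamma> using z(1) x(2) that by auto
    ultimately show False using u(1) unfolding X_def by blast
  qed
  moreover have "card X = card (e ` Rt \<union> coroot e ` D)"
  proof -
    have "card X = card Rt + card (coroot e ` D)"
      unfolding X_def using disj finite_Rt finite_D inj_x by (simp add: card_Un_disjoint card_image)
    also have "\<dots> = card (e ` Rt \<union> coroot e ` D)"
      using chevalley finite_Rt finite_D unfolding chevalley_basis_def
      by (simp add: card_Un_disjoint card_image)
    finally show ?thesis .
  qed
  ultimately have "lie_vs.span X = UNIV"
  proof -
    have "y \<in> lie_vs.span X" for y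
    proof (rule ccontr)
      assume y: "y \<notin> lie_vs.span X"
      then have "lie_vs.independent (insert y X)"
        using \<open>lie_vs.independent X\<close> by (simp add: lie_vs.independent_insertI)
      moreover have "finite (e ` Rt \<union> coroot e ` D)" using finite_Rt finite_D by simp
      ultimately have "card (insert y X) \<le> card (e ` Rt \<union> coroot e ` D)"
        using lie_vs.independent_span_bound[of "e ` Rt \<union> coroot e ` D" "insert y X"] chevalley
        by (simp add: chevalley_basis_def)
      moreover have "y \<notin> X" using y lie_vs.span_base by blast
      ultimately show False using finX \<open>card X = _\<close> by simp
    qed
    then show ?thesis by blast
  qed
  then obtain y k where yk: "h = y + k" "y \<in> lie_vs.span (x ` Rt)" "k \<in> lie_vs.span (coroot e ` D)"
    using lie_vs.span_Un[of "x ` Rt" "coroot e ` D"] by (auto simp: X_def) blast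
  from yk(2) obtain u where "y = (\<Sum>v\<in>x ` Rt. cscale (u v) v)"
    using lie_vs.span_finite[of "x ` Rt"] finite_Rt by auto
  then have y: "y = (\<Sum>\<gamma>\<in>Rt. cscale (u (x \<gamma>)) (x \<gamma>))"
    using inj_x by (simp add: sum.reindex)
  obtain n where n: "lower_central H n = {0}"
    using cartan by (auto simp: cartan_subalgebra_def)
  have "cscale (u (x \<gamma>)) (x \<gamma>) = 0" if g: "\<gamma> \<in> Rt" for \<gamma>
  proof -
    obtain h' where h': "\<gamma> h' \<noteq> 0" using g by (auto simp: roots_def fun_eq_iff)
    then have "h' \<in> H" using root_dual[OF g] by (auto simp: dual_space_def)
    have "(lie h' ^^ m) h \<in> lower_central H m" for m
      by (induction m) (use h \<open>h' \<in> H\<close> in \<open>auto intro: lie_vs.span_base\<close>)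
    from this[of n] have "(lie h' ^^ Suc n) h = 0" by (simp add: n)
    \<comment> \<open>One application of ad \<open>h'\<close> kills the coroot part
      \<open>k\<close>, which is why the formula starts at exponent Suc m.\<close>
    moreover have "(lie h' ^^ Suc m) h = (\<Sum>\<gamma>\<in>Rt. cscale (u (x \<gamma>) * \<gamma> h' ^ Suc m) (x \<gamma>))" for m
    proof (induction m)
      case 0
      have "lie h' k = 0" using D0[OF yk(3)] \<open>h' \<in> H\<close> by (simp add: root_space_def)
      moreover have "lie h' (x \<gamma>) = cscale (\<gamma> h') (x \<gamma>)" if "\<gamma> \<in> Rt" for \<gamma>
        using x(1)[OF that] \<open>h' \<in> H\<close> by (simp add: root_space_def)
      ultimately show ?case
        by (simp add: yk(1) y lie_add_right lie_sum_right lie_cscale_right cscale_cscale)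
    next
      case (Suc m)
      have "lie h' (x \<gamma>) = cscale (\<gamma> h') (x \<gamma>)" if "\<gamma> \<in> Rt" for \<gamma>
        using x(1)[OF that] \<open>h' \<in> H\<close> by (simp add: root_space_def)
      then have "lie h' (\<Sum>\<gamma>\<in>Rt. cscale (u (x \<gamma>) * \<gamma> h' ^ Suc m) (x \<gamma>))
          = (\<Sum>\<gamma>\<in>Rt. cscale (u (x \<gamma>) * \<gamma> h' ^ Suc (Suc m)) (x \<gamma>))"
        by (simp add: lie_sum_right lie_cscale_right cscale_cscale mult_ac)
      then show ?case by (simp only: Suc funpow.simps(2)[of "Suc m"] comp_apply)
    qed
    ultimately have "(\<Sum>\<gamma>\<in>Rt. cscale (u (x \<gamma>) * \<gamma> h' ^ Suc n) (x \<gamma>)) + 0 = 0" by simp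
    moreover have "cscale (u (x \<gamma>) * \<gamma> h' ^ Suc n) (x \<gamma>) \<in> root_space H \<gamma>" if "\<gamma> \<in> Rt" for \<gamma>
      using x(1)[OF that] subspace_root_space lie_vs.subspace_scale by blast
    ultimately have "cscale (u (x \<gamma>) * \<gamma> h' ^ Suc n) (x \<gamma>) = 0"
      using indep[of "\<lambda>\<gamma>. cscale (u (x \<gamma>) * \<gamma> h' ^ Suc n) (x \<gamma>)" 0] g lie_vs.subspace_0[OF subspace_root_space] by blast
    then show ?thesis using h' by auto
  qed
  then have "y = 0" unfolding y by (intro sum.neutral) blast
  then show "h \<in> lie_vs.span (coroot e ` D)" using yk by simp
qed

text \<open>The sum \<open>\<delta>\<close> of the roots whose negative is not a root is fixed by the simple
  reflections, so it vanishes on all simple coroots and hence on \<open>H\<close>; but these roots are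
  negative.\<close>

lemma root_uminus:
  assumes "\<alpha> \<in> Rt"
  shows "- \<alpha> \<in> Rt"
proof (rule ccontr)
  assume neg: "- \<alpha> \<notin> Rt"
  define M where "M = {\<gamma> \<in> Rt. - \<gamma> \<notin> Rt}"
  have M: "finite M" "\<alpha> \<in> M" using finite_Rt assms neg by (auto simp: M_def)
  define \<delta> where "\<delta> h = (\<Sum>\<gamma>\<in>M. \<gamma> h)" for h
  have "\<delta> (coroot e i) = 0" if "i \<in> D" for i
  proof -
    have i: "i \<in> Rp" using that D_pos by blast
    have "reflect i \<gamma> \<in> M" if "\<gamma> \<in> M" for \<gamma>
    proof -
      have "- reflect i \<gamma> \<notin> Rt"
      proof
        assume "- reflect i \<gamma> \<in> Rt"
        then have "reflect i (- reflect i \<gamma>) \<in> Rt" by (rule reflect_root(2)[OF i])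
        then show False using that by (simp add: reflect_uminus reflect_reflect[OF i] M_def)
      qed
      then show ?thesis using that reflect_root(2)[OF i] by (simp add: M_def)
    qed
    then have "bij_betw (reflect i) M M"
      by (intro bij_betw_byWitness[where f' = "reflect i"]) (auto simp: reflect_reflect[OF i])
    then have "\<delta> (coroot e i) = (\<Sum>\<gamma>\<in>M. reflect i \<gamma> (coroot e i))"
      unfolding \<delta>_def by (rule sum.reindex_bij_betw[symmetric])
    also have "\<dots> = - \<delta> (coroot e i)"
      by (simp add: reflect_def root_coroot[OF i] \<delta>_def flip: sum_negf)
    finally show ?thesis by simp
  qed
  moreover have "\<delta> \<in> dual_space H"
  proof -
    have "\<gamma> \<in> dual_space H" if "\<gamma> \<in> M" for \<gamma> using that root_dual by (simp add: M_def)
    then show ?thesis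
      by (auto simp: \<delta>_def dual_space_def sum_distrib_left simp flip: sum.distrib
          intro!: sum.cong sum.neutral)
  qed
  ultimately have \<delta>_H: "\<delta> h = 0" if "h \<in> H" for h
  proof -
    have "h \<in> lie_vs.span (coroot e ` D)" using that H_coroots by blast
    \<comment> \<open>Membership in \<open>H\<close> is carried through the induction because
      \<delta> is known to be linear only on \<open>H\<close>.\<close>
    then have "h \<in> H \<and> \<delta> h = 0"
    proof (induction rule: lie_vs.span_induct_alt)
      case base
      have "\<delta> (cscale 0 h) = 0 * \<delta> h"
        using \<open>\<delta> \<in> dual_space H\<close> that unfolding dual_space_def by blast
      then show ?case using lie_vs.subspace_0[OF subspace_H] by simp
    next
      case (step c b y)
      then obtain i where i: "i \<in> D" "b = coroot e i" by auto
      have b: "b \<in> H" using i coroot_H D_pos by blast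
      then have cb: "cscale c b \<in> H" using lie_vs.subspace_scale[OF subspace_H] by blast
      have "\<delta> (cscale c b) = c * \<delta> b" "\<delta> (cscale c b + y) = \<delta> (cscale c b) + \<delta> y"
        using \<open>\<delta> \<in> dual_space H\<close> b cb step.IH unfolding dual_space_def by blast+
      moreover have "cscale c b + y \<in> H" using cb step.IH lie_vs.subspace_add[OF subspace_H] by blast
      ultimately show ?case
        using i \<open>\<And>i. i \<in> D \<Longrightarrow> \<delta> (coroot e i) = 0\<close> step.IH by simp
    qed
    then show ?thesis by blast
  qed
  have \<delta>_0: "\<delta> h = 0" for h
    using \<delta>_H \<open>\<delta> \<in> dual_space H\<close> by (cases "h \<in> H") (auto simp: dual_space_def)
  have "\<exists>c::_ \<Rightarrow> nat. - \<gamma> = (\<lambda>h. \<Sum>\<beta>\<in>D. of_nat (c \<beta>) * \<beta> h)" if "\<gamma> \<in> M" for \<gamma>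
  proof -
    have "- \<gamma> \<in> nonneg_comb D"
      using that root_cases[of \<gamma>] neg_pos_root[of \<gamma>] by (auto simp: M_def)
    then show ?thesis by (simp add: nonneg_comb_def)
  qed
  then obtain c :: "_ \<Rightarrow> _ \<Rightarrow> nat"
    where c: "\<And>\<gamma>. \<gamma> \<in> M \<Longrightarrow> - \<gamma> = (\<lambda>h. \<Sum>\<beta>\<in>D. of_nat (c \<gamma> \<beta>) * \<beta> h)" by metis
  have "(\<Sum>\<beta>\<in>D. of_nat (\<Sum>\<gamma>\<in>M. c \<gamma> \<beta>) * \<beta> h) = 0" for h
  proof -
    have "(\<Sum>\<beta>\<in>D. of_nat (\<Sum>\<gamma>\<in>M. c \<gamma> \<beta>) * \<beta> h) = (\<Sum>\<gamma>\<in>M. \<Sum>\<beta>\<in>D. of_nat (c \<gamma> \<beta>) * \<beta> h)"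
      by (subst sum.swap) (simp add: sum_distrib_right)
    also have "\<dots> = (\<Sum>\<gamma>\<in>M. - \<gamma> h)"
      using c by (intro sum.cong) (auto simp: fun_eq_iff)
    finally show ?thesis using \<delta>_0[of h] by (simp add: \<delta>_def sum_negf)
  qed
  then have "of_nat (\<Sum>\<gamma>\<in>M. c \<gamma> \<beta>) = (0::complex)" if "\<beta> \<in> D" for \<beta>
    by (rule D_indep[OF _ that])
  \<comment> \<open>A vanishing sum of natural numbers has only zero summands, so the single root
    \<alpha> already has all coefficients 0.\<close>
  then have "c \<alpha> \<beta> = 0" if "\<beta> \<in> D" for \<beta>
    using M that by (simp only: of_nat_eq_0_iff sum_eq_0_iff)
  then have "- \<alpha> = (\<lambda>h. 0)" unfolding c[OF M(2)] by simp
  then have "\<alpha> = 0" by (simp add: fun_eq_iff)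
  then show False using assms by (simp add: roots_def)
qed

lemma neg_root_pos:
  assumes "\<alpha> \<in> Rt" "\<alpha> \<notin> Rp"
  shows "- \<alpha> \<in> Rp"
  using root_cases[OF assms(1)] root_uminus[OF assms(1)] assms(2) by (auto simp: pos_roots_def)

lemma e_root_space: "\<alpha> \<in> Rt \<Longrightarrow> e \<alpha> \<in> root_space H \<alpha>"
  using pos_rootD(2)[of \<alpha>] pos_rootD(3)[of "- \<alpha>"] neg_root_pos[of \<alpha>] by (cases "\<alpha> \<in> Rp") auto

section \<open>Invariant form and descent on positive roots\<close>

text \<open>On \<open>H\<close>, this is the Killing form with every root counted once instead of
  with the dimension of its root space.\<close>

definition trace_form :: "'g \<Rightarrow> 'g \<Rightarrow> complex" where
  "trace_form h h' = (\<Sum>\<beta>\<in>Rt. \<beta> h * \<beta> h')"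

lemma trace_form_commute: "trace_form h h' = trace_form h' h"
  by (simp add: trace_form_def mult.commute)

text \<open>The form is invariant under the reflection in \<open>\<alpha>\<close>, which permutes the roots and
  negates \<open>h\<^sub>\<alpha>\<close>.\<close>

lemma trace_form_coroot:
  assumes \<alpha>: "\<alpha> \<in> Rp" and h: "h \<in> H"
  shows "2 * trace_form (coroot e \<alpha>) h = \<alpha> h * trace_form (coroot e \<alpha>) (coroot e \<alpha>)"
proof -
  have r: "reflect \<alpha> \<beta> h' = \<beta> h' - \<alpha> h' * \<beta> (coroot e \<alpha>)" for \<beta> h'
    by (simp add: reflect_def)
  have "trace_form (coroot e \<alpha>) h = (\<Sum>\<beta>\<in>Rt. reflect \<alpha> \<beta> (coroot e \<alpha>) * reflect \<alpha> \<beta> h)"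
    unfolding trace_form_def by (rule sum.reindex_bij_betw[OF bij_reflect[OF \<alpha>], symmetric])
  also have "\<dots> = (\<Sum>\<beta>\<in>Rt. \<alpha> h * (\<beta> (coroot e \<alpha>) * \<beta> (coroot e \<alpha>)) - \<beta> (coroot e \<alpha>) * \<beta> h)"
    by (intro sum.cong) (simp_all add: r root_coroot[OF \<alpha>] algebra_simps)
  also have "\<dots> = \<alpha> h * trace_form (coroot e \<alpha>) (coroot e \<alpha>) - trace_form (coroot e \<alpha>) h"
    by (simp add: trace_form_def sum_subtractf sum_distrib_left)
  finally show ?thesis by simp
qed

text \<open>All \<beta>(h_\<alpha>) are integers, and \<beta> = \<alpha> contributes 4 to the sum of
  their squares.\<close>

lemma trace_form_pos:
  assumes \<alpha>: "\<alpha> \<in> Rp"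
  obtains n :: int where "trace_form (coroot e \<alpha>) (coroot e \<alpha>) = of_int n" "n > 0"
proof -
  have "\<forall>\<beta>\<in>Rt. \<exists>m::int. \<beta> (coroot e \<alpha>) = of_int m"
    using reflect_root(1)[OF \<alpha>] by (auto elim: Ints_cases)
  then obtain m :: "_ \<Rightarrow> int" where m: "\<And>\<beta>. \<beta> \<in> Rt \<Longrightarrow> \<beta> (coroot e \<alpha>) = of_int (m \<beta>)" by metis
  have "trace_form (coroot e \<alpha>) (coroot e \<alpha>) = of_int (\<Sum>\<beta>\<in>Rt. m \<beta> * m \<beta>)"
    by (simp add: trace_form_def m)
  moreover have "m \<alpha> = 2" using m[OF pos_rootD(1)[OF \<alpha>]] root_coroot[OF \<alpha>]
    by (metis of_int_eq_iff of_int_numeral)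
  then have "0 < (\<Sum>\<beta>\<in>Rt. m \<beta> * m \<beta>)"
    using finite_Rt pos_rootD(1)[OF \<alpha>] by (intro sum_pos2[of _ \<alpha>]) auto
  ultimately show ?thesis using that by blast
qed

text \<open>Since \<alpha>(h_\<alpha>) = 2 is positive, some product of \<open>c i\<close> with
  i(h_\<alpha>) is positive. The form exchanges the two roots: \<alpha>(h_i) (h_\<alpha>,
  h_\<alpha>) = i(h_\<alpha>) (h_i, h_i), so \<alpha>(h_i) has the sign of i(h_\<alpha>).\<close>

lemma exists_simple_pos:
  assumes \<alpha>: "\<alpha> \<in> Rp" and c: "\<alpha> = (\<lambda>h. \<Sum>\<beta>\<in>D. of_nat (c \<beta> :: nat) * \<beta> h)"
  obtains i and m :: int where "i \<in> D" "\<alpha> (coroot e i) = of_int m" "m > 0" "c i > 0"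
proof -
  have D: "i \<in> Rp" if "i \<in> D" for i using that D_pos by blast
  have "\<forall>i\<in>D. \<exists>m::int. i (coroot e \<alpha>) = of_int m"
    using reflect_root(1)[OF \<alpha>] D_roots by (auto elim!: Ints_cases)
  then obtain k :: "_ \<Rightarrow> int" where k: "\<And>i. i \<in> D \<Longrightarrow> i (coroot e \<alpha>) = of_int (k i)" by metis
  have "of_int (\<Sum>\<beta>\<in>D. int (c \<beta>) * k \<beta>) = \<alpha> (coroot e \<alpha>)"
    by (subst c) (simp add: k)
  then have "(\<Sum>\<beta>\<in>D. int (c \<beta>) * k \<beta>) = 2"
    unfolding root_coroot[OF \<alpha>] by (metis of_int_eq_iff of_int_numeral)
  then have "\<not> (\<forall>\<beta>\<in>D. int (c \<beta>) * k \<beta> \<le> 0)"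
    using sum_nonpos[of D "\<lambda>\<beta>. int (c \<beta>) * k \<beta>"] by fastforce
  then obtain i where i: "i \<in> D" "int (c i) * k i > 0" by (auto simp: not_le)
  then have ci: "c i > 0" "k i > 0" by (auto simp: zero_less_mult_iff)
  obtain m where m: "\<alpha> (coroot e i) = of_int m"
    using reflect_root(1)[OF D[OF i(1)] pos_rootD(1)[OF \<alpha>]] by (auto elim: Ints_cases)
  obtain a where a: "trace_form (coroot e \<alpha>) (coroot e \<alpha>) = of_int a" "a > 0"
    using trace_form_pos[OF \<alpha>] .
  obtain b where b: "trace_form (coroot e i) (coroot e i) = of_int b" "b > 0"
    using trace_form_pos[OF D[OF i(1)]] .
  have "\<alpha> (coroot e i) * of_int a = i (coroot e \<alpha>) * of_int b"
    using trace_form_coroot[OF \<alpha> coroot_H[OF D[OF i(1)]]]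
      trace_form_coroot[OF D[OF i(1)] coroot_H[OF \<alpha>]] a b
      trace_form_commute[of "coroot e \<alpha>" "coroot e i"] by simp
  then have "of_int (m * a) = (of_int (k i * b) :: complex)" by (simp add: m k[OF i(1)])
  then have "m * a = k i * b" by (simp only: of_int_eq_iff)
  then have "m > 0" using a(2) b(2) ci(2) by (metis mult_pos_pos zero_less_mult_pos2)
  with that i(1) m ci(1) show ?thesis by blast
qed

text \<open>Descent on the height. Reflecting in a simple i with \<alpha>(h_i) > 0 changes only the
  i-th coefficient and decreases it; if another simple root occurs in \<alpha>, its unchanged
  positive coefficient keeps the reflected root positive. Otherwise \<alpha> is a multiple of i, the
  base case.\<close>

lemma pos_root_induct [consumes 1, case_names multiple reflect]:
  assumes "\<alpha> \<in> Rp"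
    and multiple: "\<And>i c. i \<in> D \<Longrightarrow> c > 0 \<Longrightarrow> P (\<lambda>h. of_nat c * i h)"
    and reflect: "\<And>\<alpha> i. \<alpha> \<in> Rp \<Longrightarrow> i \<in> D \<Longrightarrow> reflect i \<alpha> \<in> Rp \<Longrightarrow> P (reflect i \<alpha>) \<Longrightarrow> P \<alpha>"
  shows "P \<alpha>"
proof -
  obtain c :: "_ \<Rightarrow> nat" where "\<alpha> = (\<lambda>h. \<Sum>\<beta>\<in>D. of_nat (c \<beta>) * \<beta> h)"
    using pos_rootD(6)[OF assms(1)] by (auto simp: nonneg_comb_def)
  with assms(1) show ?thesis
  proof (induction "\<Sum>\<beta>\<in>D. c \<beta>" arbitrary: \<alpha> c rule: less_induct)
    case less
    obtain i m where i: "i \<in> D" "\<alpha> (coroot e i) = of_int m" "m > 0" "c i > 0"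
      using exists_simple_pos[OF less.prems] .
    have iR: "i \<in> Rp" using i(1) D_pos by blast
    show ?case
    proof (cases "\<exists>j\<in>D. j \<noteq> i \<and> c j > 0")
      case False
      have "(\<Sum>\<beta>\<in>D. of_nat (c \<beta>) * \<beta> h) = (\<Sum>\<beta>\<in>{i}. of_nat (c \<beta>) * \<beta> h)" for h
        using False i(1) finite_D by (intro sum.mono_neutral_right) auto
      then have "\<alpha> = (\<lambda>h. of_nat (c i) * i h)" using less.prems(2) by simp
      then show ?thesis using multiple[OF i(1,4)] by simp
    next
      case True
      then obtain j where j: "j \<in> D" "j \<noteq> i" "c j > 0" by blast
      have r: "reflect i \<alpha> \<in> Rt" by (rule reflect_root(2)[OF iR pos_rootD(1)[OF less.prems(1)]])
      define k where "k \<beta> = (of_nat (c \<beta>) - (if \<beta> = i then of_int m else 0) :: complex)" for \<beta>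
      have reflect_k: "reflect i \<alpha> h = (\<Sum>\<beta>\<in>D. k \<beta> * \<beta> h)" for h
      proof -
        have "(\<Sum>\<beta>\<in>D. k \<beta> * \<beta> h)
            = (\<Sum>\<beta>\<in>D. of_nat (c \<beta>) * \<beta> h) - (\<Sum>\<beta>\<in>D. if \<beta> = i then of_int m * i h else 0)"
          unfolding sum_subtractf[symmetric] k_def by (intro sum.cong) (auto simp: algebra_simps)
        then show ?thesis
          using i(1) finite_D fun_cong[OF less.prems(2), of h] by (simp add: reflect_def i(2))
      qed
      have rp: "reflect i \<alpha> \<in> Rp"
      proof (rule ccontr)
        assume "reflect i \<alpha> \<notin> Rp"
        then obtain d :: "_ \<Rightarrow> nat" where "- reflect i \<alpha> = (\<lambda>h. \<Sum>\<beta>\<in>D. of_nat (d \<beta>) * \<beta> h)"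
          using root_cases[OF r] by (auto simp: nonneg_comb_def)
        then have "(\<Sum>\<beta>\<in>D. of_nat (d \<beta>) * \<beta> h) = - reflect i \<alpha> h" for h by (simp add: fun_eq_iff)
        then have "(\<Sum>\<beta>\<in>D. (k \<beta> + of_nat (d \<beta>)) * \<beta> h) = 0" for h
          by (simp add: distrib_right sum.distrib flip: reflect_k)
        from D_indep[OF this j(1)] have "of_nat (c j + d j) = (0::complex)"
          using j(2) by (simp add: k_def)
        then show False using j(3) by (simp only: of_nat_eq_0_iff)
      qed
      then obtain d :: "_ \<Rightarrow> nat" where d: "reflect i \<alpha> = (\<lambda>h. \<Sum>\<beta>\<in>D. of_nat (d \<beta>) * \<beta> h)"
        by (auto simp: pos_roots_def nonneg_comb_def)
      have kd: "k \<beta> - of_nat (d \<beta>) = 0" if "\<beta> \<in> D" for \<beta>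
      proof (rule D_indep[OF _ that])
        show "(\<Sum>\<beta>\<in>D. (k \<beta> - of_nat (d \<beta>)) * \<beta> h) = 0" for h
          using fun_cong[OF d, of h] by (simp add: left_diff_distrib sum_subtractf reflect_k)
      qed
      then have "of_int (int (d \<beta>)) = (of_int (int (c \<beta>) - (if \<beta> = i then m else 0)) :: complex)"
        if "\<beta> \<in> D" for \<beta>
        using kd[OF that] by (auto simp: k_def split: if_splits)
      then have dc: "int (d \<beta>) = int (c \<beta>) - (if \<beta> = i then m else 0)" if "\<beta> \<in> D" for \<beta>
        using that by (simp only: of_int_eq_iff)
      have "(\<Sum>\<beta>\<in>D. d \<beta>) < (\<Sum>\<beta>\<in>D. c \<beta>)"
      proof (rule sum_strict_mono_ex1[OF finite_D])
        show "\<forall>\<beta>\<in>D. d \<beta> \<le> c \<beta>"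
        proof
          fix \<beta> assume "\<beta> \<in> D"
          from dc[OF this] show "d \<beta> \<le> c \<beta>" using i(3) by (auto split: if_splits)
        qed
        show "\<exists>\<beta>\<in>D. d \<beta> < c \<beta>" using dc[OF i(1)] i(1,3) by (intro bexI[of _ i]) auto
      qed
      from less.hyps[OF this rp d] show ?thesis by (rule reflect[OF less.prems(1) i(1) rp])
    qed
  qed
qed

end

section \<open>Left ideals defining highest weight modules\<close>

lemma trunc_infinity [simp]: "trunc \<infinity> p = p"
  by (simp add: trunc_def)

lemma trunc_current_infinity [simp]: "trunc_current \<infinity> = UNIV"
  by (simp add: trunc_current_def surj_def)

lemma trunc_lie_infinity [simp]: "trunc_lie \<infinity> = lie"
  by (simp add: trunc_lie_def fun_eq_iff)

lemma funpow_mult_left: "((\<lambda>f. x * f) ^^ k) g = x ^ k * (g :: 'a::monoid_mult)"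
  by (induction k) (simp_all add: mult.assoc)

locale env_left_ideal =
  fixes K :: "('g::complex_lie_algebra poly word \<Rightarrow>\<^sub>0 complex) set"
  assumes left_ideal_K: "left_ideal K" and env_K: "current_ideal \<infinity> \<subseteq> K"
begin

lemmas K_zero = left_idealD(1)[OF left_ideal_K]
  and K_add = left_idealD(2)[OF left_ideal_K]
  and K_mult = left_idealD(3)[OF left_ideal_K]
  and K_uminus = left_idealD(4)[OF left_ideal_K]
  and K_diff = left_idealD(5)[OF left_ideal_K]
  and K_scale = left_ideal_scale[OF left_ideal_K]

lemma K_cong: "f - g \<in> K \<Longrightarrow> g \<in> K \<longleftrightarrow> f \<in> K"
  using K_add[of "f - g" g] K_diff[of f "f - g"] by auto

text \<open>\<open>K\<close> is only a left ideal, but it contains the two-sided ideal generated by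
  the enveloping relations, so these may be followed by any tail \<open>f\<close>. All later
  commutations rest on this.\<close>

lemma env_K_mult:
  assumes "r \<in> env_relations UNIV lie"
  shows "r * f \<in> K"
proof -
  have "1 * r * f \<in> current_ideal \<infinity>"
    using assms by (intro env_ideal.gen) auto
  then show ?thesis using env_K by auto
qed

lemma gen_add: "free_gen (x + y) * f - (free_gen x * f + free_gen y * f) \<in> K"
proof -
  have "free_gen (x + y) - free_gen x - free_gen y \<in> env_relations UNIV lie"
    by (auto simp: env_relations_def)
  from env_K_mult[OF this, of f] show ?thesis by (simp add: algebra_simps)
qed

lemma gen_scale: "free_gen (cscale c x) * f - free_scale c (free_gen x * f) \<in> K"
proof -
  have "free_gen (cscale c x) - free_scale c (free_gen x) \<in> env_relations UNIV lie"
    by (auto simp: env_relations_def)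
  from env_K_mult[OF this, of f] show ?thesis by (simp add: left_diff_distrib free_scale_mult_left)
qed

lemma gen_lie:
  "free_gen x * (free_gen y * f) - (free_gen y * (free_gen x * f) + free_gen (lie x y) * f) \<in> K"
proof -
  have "free_gen x * free_gen y - free_gen y * free_gen x - free_gen (lie x y) \<in> env_relations UNIV lie"
    by (auto simp: env_relations_def)
  from env_K_mult[OF this, of f] show ?thesis by (simp add: algebra_simps)
qed

lemma gen_zero: "free_gen 0 * f \<in> K"
  using gen_scale[of 0 0 f] by (simp add: free_scale_def)

lemma gen_span:
  assumes "x \<in> lie_vs.span T" "\<And>y. y \<in> T \<Longrightarrow> free_gen y * f \<in> K"
  shows "free_gen x * f \<in> K"
  using assms(1)
proof (induction rule: lie_vs.span_induct_alt)
  case base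
  show ?case by (rule gen_zero)
next
  case (step c x y)
  have "free_gen (cscale c x) * f \<in> K"
    using K_cong[OF gen_scale[of c x f]] K_scale[OF assms(2)[OF step(1)]] by blast
  then show ?case
    using K_cong[OF gen_add[of "cscale c x" y f]] K_add step.IH by blast
qed

end

lemma monom_cscale: "monom (cscale c x) r = cscale c (monom x r)"
  by (simp add: poly_eq_iff coeff_cscale_poly)

text \<open>The quotient by such a \<open>K\<close> is an arbitrary quotient of the untruncated Weyl
  module, with 1 as highest weight vector. The kernels of both modules under comparison are
  instances.\<close>

locale weyl_ideal = chevalley_data H D e + env_left_ideal K
  for H :: "'g::complex_lie_algebra set" and D e and K :: "('g poly word \<Rightarrow>\<^sub>0 complex) set" +
  fixes lam :: "'g \<Rightarrow> complex"
  assumes lam: "lam \<in> dominant_weights H D e"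
    and K_n_plus: "x \<in> n_plus H D \<Longrightarrow> free_gen (monom x r) \<in> K"
    and K_H: "h \<in> H \<Longrightarrow> free_gen (monom h r) - cst (if r = 0 then lam h else 0) \<in> K"
    and K_simple: "\<alpha> \<in> D \<Longrightarrow> of_nat m = lam (coroot e \<alpha>) \<Longrightarrow> free_gen (monom (e (- \<alpha>)) 0) ^ (m + 1) \<in> K"
begin

lemma lam_dual: "lam \<in> dual_space H"
  using lam by (simp add: dominant_weights_def)

lemma e_n_plus: "\<alpha> \<in> Rp \<Longrightarrow> e \<alpha> \<in> n_plus H D"
  unfolding n_plus_def by (rule lie_vs.span_base) (use pos_rootD(2) in blast)

lemma K_H_pos: "h \<in> H \<Longrightarrow> r > 0 \<Longrightarrow> free_gen (monom h r) \<in> K"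
  using K_H[of h r] by simp

subsection \<open>The current algebra of \<open>sl\<^sub>2\<close>\<close>

definition xm :: "('g \<Rightarrow> complex) \<Rightarrow> nat \<Rightarrow> ('g poly word \<Rightarrow>\<^sub>0 complex)" where
  "xm \<alpha> a = free_gen (monom (e (- \<alpha>)) a)"

text \<open>\<open>comb \<alpha> m d c f\<close>: modulo \<open>K\<close>, \<open>f\<close> is a combination, with sum of coefficients
  \<open>c\<close>, of products of \<open>m\<close> factors \<open>x\<^sub>\<alpha>\<^sup>- \<otimes> t\<^sup>a\<close> of total degree \<open>d\<close>.
  Keeping only the sum of the coefficients replaces Garland's formula.\<close>

inductive comb :: "('g \<Rightarrow> complex) \<Rightarrow> nat \<Rightarrow> nat \<Rightarrow> complex \<Rightarrow> ('g poly word \<Rightarrow>\<^sub>0 complex) \<Rightarrow> bool"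
  for \<alpha> where
  zero: "f \<in> K \<Longrightarrow> comb \<alpha> m d 0 f"
| mono: "comb \<alpha> (length as) (sum_list as) 1 (prod_list (map (xm \<alpha>) as))"
| add: "comb \<alpha> m d c f \<Longrightarrow> comb \<alpha> m d c' g \<Longrightarrow> comb \<alpha> m d (c + c') (f + g)"
| scale: "comb \<alpha> m d c f \<Longrightarrow> comb \<alpha> m d (b * c) (free_scale b f)"

lemma comb_cong:
  assumes "comb \<alpha> m d c f" "g - f \<in> K"
  shows "comb \<alpha> m d c g"
  using comb.add[OF assms(1) comb.zero[OF assms(2)]] by simp

lemma comb_mult:
  assumes "comb \<alpha> m d c f"
  shows "comb \<alpha> (Suc m) (a + d) c (xm \<alpha> a * f)"
  using assms
proof induction
  case (zero f m d)
  then show ?case by (intro comb.zero K_mult)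
next
  case (mono as)
  show ?case using comb.mono[of \<alpha> "a # as"] by simp
next
  case (add m d c f c' g)
  then show ?case by (simp add: distrib_left comb.add)
next
  case (scale m d c f b)
  then show ?case by (simp add: free_scale_mult_right comb.scale)
qed

text \<open>Moving the coroot to the right, each factor contributes one commutator: - 2 times the
  monomial with the degree of that factor raised by \<open>b\<close>. What reaches the generator
  vanishes because \<open>b > 0\<close>.\<close>

lemma coroot_mono:
  assumes \<alpha>: "\<alpha> \<in> Rp" and b: "b > 0"
  shows "comb \<alpha> (length as) (b + sum_list as) (- 2 * of_nat (length as))
    (free_gen (monom (coroot e \<alpha>) b) * prod_list (map (xm \<alpha>) as))"
proof (induction as)
  case Nil
  then show ?case using comb.zero[OF K_H_pos[OF coroot_H[OF \<alpha>] b]] by simp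
next
  case (Cons a as)
  define M where "M = prod_list (map (xm \<alpha>) as)"
  have br: "lie (monom (coroot e \<alpha>) b) (monom (e (- \<alpha>)) a) = cscale (- 2) (monom (e (- \<alpha>)) (a + b))"
    by (simp only: lie_poly_monom pos_rootD(5)[OF \<alpha>] monom_cscale add.commute)
  have "comb \<alpha> (length (a # as)) (b + sum_list (a # as)) (- 2 * of_nat (length as) + (- 2) * 1)
    (xm \<alpha> a * (free_gen (monom (coroot e \<alpha>) b) * M) +
     free_scale (- 2) (xm \<alpha> (a + b) * M))"
  proof (rule comb.add)
    show "comb \<alpha> (length (a # as)) (b + sum_list (a # as)) (- 2 * of_nat (length as))
        (xm \<alpha> a * (free_gen (monom (coroot e \<alpha>) b) * M))"
      using comb_mult[OF Cons, of a] by (simp add: M_def add_ac)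
    have "sum_list ((a + b) # as) = b + sum_list (a # as)" by simp
    with comb.scale[OF comb.mono[of \<alpha> "(a + b) # as"], of "- 2"]
    show "comb \<alpha> (length (a # as)) (b + sum_list (a # as)) (- 2 * 1)
        (free_scale (- 2) (xm \<alpha> (a + b) * M))"
      by (simp add: M_def add_ac)
  qed
  moreover have "free_gen (monom (coroot e \<alpha>) b) * (xm \<alpha> a * M) -
    (xm \<alpha> a * (free_gen (monom (coroot e \<alpha>) b) * M) +
     free_scale (- 2) (xm \<alpha> (a + b) * M)) \<in> K"
    using K_add[OF gen_lie[of "monom (coroot e \<alpha>) b" "monom (e (- \<alpha>)) a" M]
        gen_scale[of "- 2" "monom (e (- \<alpha>)) (a + b)" M]]
    unfolding br xm_def[symmetric] by (simp add: diff_diff_eq)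
  ultimately show ?case
    using comb_cong by (simp add: M_def algebra_simps)
qed

text \<open>The bracket of the raising vector with a factor of degree a is the coroot in degree a +
  1 > 0, which meets the factors to its right. Summing the constants of \<open>coroot_mono\<close>
  gives - 2 (0 + 1 + ... + (m - 1)) = - m (m - 1) for m factors.\<close>

lemma e_mono:
  assumes \<alpha>: "\<alpha> \<in> Rp"
  shows "comb \<alpha> (length as - 1) (Suc (sum_list as)) (- of_nat (length as * (length as - 1)))
    (free_gen (monom (e \<alpha>) 1) * prod_list (map (xm \<alpha>) as))"
proof (induction as)
  case Nil
  then show ?case using comb.zero[OF K_n_plus[OF e_n_plus[OF \<alpha>]], of \<alpha> 0 1 1] by simp
next
  case (Cons a as)
  define M where "M = prod_list (map (xm \<alpha>) as)"
  have br: "lie (monom (e \<alpha>) 1) (monom (e (- \<alpha>)) a) = monom (coroot e \<alpha>) (Suc a)"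
    by (simp add: lie_poly_monom coroot_def)
  have 1: "comb \<alpha> (length as) (Suc (a + sum_list as)) (- of_nat (length as * (length as - 1)))
    (xm \<alpha> a * (free_gen (monom (e \<alpha>) 1) * M))"
  \<comment> \<open>For empty \<open>as\<close> the truncated difference
    \<open>length as - 1\<close> makes the count of \<open>comb_mult\<close> off by one; there the
    term lies in \<open>K\<close> outright.\<close>
  proof (cases as)
    case Nil
    have "free_gen (monom (e \<alpha>) 1) * M \<in> K"
      using K_n_plus[OF e_n_plus[OF \<alpha>]] by (simp add: M_def Nil)
    then show ?thesis using comb.zero[OF K_mult] Nil by simp
  next
    case (Cons b bs)
    then show ?thesis using comb_mult[OF Cons.IH, of a] by (simp add: M_def)
  qed
  have 2: "comb \<alpha> (length as) (Suc (a + sum_list as)) (- 2 * of_nat (length as))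
    (free_gen (monom (coroot e \<alpha>) (Suc a)) * M)"
    using coroot_mono[OF \<alpha>, of "Suc a" as] by (simp add: M_def)
  have c: "- of_nat (length as * (length as - 1)) + - 2 * of_nat (length as)
      = - (of_nat (length (a # as) * (length (a # as) - 1)) :: complex)"
    by (cases as) (simp_all add: algebra_simps)
  from comb.add[OF 1 2] gen_lie[of "monom (e \<alpha>) 1" "monom (e (- \<alpha>)) a" M]
  show ?case unfolding c br xm_def[symmetric] using comb_cong by (simp add: M_def)
qed

lemma e_comb:
  assumes \<alpha>: "\<alpha> \<in> Rp" and "comb \<alpha> m d c f"
  shows "comb \<alpha> (m - 1) (Suc d) (- of_nat (m * (m - 1)) * c) (free_gen (monom (e \<alpha>) 1) * f)"
  using assms(2)
proof induction
  case (zero f m d)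
  then show ?case using comb.zero[OF K_mult] by simp
next
  case (mono as)
  then show ?case using e_mono[OF \<alpha>] by simp
next
  case (add m d c f c' g)
  then show ?case using comb.add[OF add.IH] by (simp add: distrib_left algebra_simps)
next
  case (scale m d c f b)
  then show ?case using comb.scale[OF scale.IH, of b] by (simp add: free_scale_mult_right algebra_simps)
qed

text \<open>Each raising step on m factors multiplies the constant by - m (m - 1), with m running
  from s + r down to r + 1. Since r > 0, always m \<ge> 2 and no factor vanishes.\<close>

lemma comb_e_pow:
  assumes \<alpha>: "\<alpha> \<in> Rp" and r: "r > 0"
  obtains c where "c \<noteq> 0"
    "comb \<alpha> r s c (free_gen (monom (e \<alpha>) 1) ^ s * xm \<alpha> 0 ^ (s + r))"
proof -
  have "\<exists>c. c \<noteq> 0 \<and> comb \<alpha> r s c (free_gen (monom (e \<alpha>) 1) ^ s * xm \<alpha> 0 ^ (s + r))"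
    using r
  proof (induction s arbitrary: r)
    case 0
    have "comb \<alpha> r 0 1 (xm \<alpha> 0 ^ r)"
      using comb.mono[of \<alpha> "replicate r 0"] by (simp add: prod_list_replicate sum_list_replicate)
    then show ?case by (intro exI[of _ 1]) simp
  next
    case (Suc s)
    then obtain c where c: "c \<noteq> 0"
      "comb \<alpha> (Suc r) s c (free_gen (monom (e \<alpha>) 1) ^ s * xm \<alpha> 0 ^ (s + Suc r))"
      by blast
    from e_comb[OF \<alpha> c(2)] have "comb \<alpha> r (Suc s) (- of_nat (Suc r * r) * c)
        (free_gen (monom (e \<alpha>) 1) ^ Suc s * xm \<alpha> 0 ^ (Suc s + r))"
      by (simp add: mult.assoc)
    moreover have "- of_nat (Suc r * r) * c \<noteq> 0" using c(1) Suc.prems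
      by (simp only: mult_eq_0_iff neg_equal_0_iff_equal of_nat_eq_0_iff) simp
    ultimately show ?case by blast
  qed
  then show ?thesis using that by blast
qed

text \<open>Pigeonhole on the degrees. One factor of large degree suffices wherever it stands: what
  follows is absorbed into \<open>g\<close>, what precedes is a left multiplication.\<close>

lemma K_comb:
  assumes "comb \<alpha> m d c f" "d > m * (n - 1)"
    and trunc: "\<And>a g. a \<ge> n \<Longrightarrow> xm \<alpha> a * g \<in> K"
  shows "f \<in> K"
  using assms(1,2)
proof induction
  case (mono as)
  have "\<exists>a\<in>set as. a \<ge> n"
  proof (rule ccontr)
    assume "\<not> (\<exists>a\<in>set as. a \<ge> n)"
    then have "a \<le> n - 1" if "a \<in> set as" for a using that by fastforce
    then have "sum_list as \<le> length as * (n - 1)"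
      by (induction as) (auto simp: add_mono)
    with mono show False by simp
  qed
  then show ?case
  proof (induction as)
    case (Cons a as)
    then show ?case by (cases "a \<ge> n") (auto intro: trunc K_mult)
  qed simp
qed (auto intro: K_add K_scale)

text \<open>There is only one monomial with a single factor of degree d, so the sum of coefficients
  is its coefficient.\<close>

lemma comb_one:
  assumes "comb \<alpha> m d c f" "m = 1"
  shows "f - free_scale c (xm \<alpha> d) \<in> K"
  using assms
proof induction
  case (mono as)
  then obtain a where "as = [a]" by (auto simp: length_Suc_conv)
  then show ?case using K_zero by (simp add: free_scale_def)
next
  case (add m d c f c' g)
  have *: "free_scale (c + c') x = free_scale c x + free_scale c' x" for x :: "'g poly word \<Rightarrow>\<^sub>0 complex"
    by (simp add: free_scale_def single_add distrib_right)
  have "(f - free_scale c (xm \<alpha> d)) + (g - free_scale c' (xm \<alpha> d)) \<in> K"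
    using K_add add by blast
  then show ?case unfolding * by (simp add: algebra_simps)
next
  case (scale m d c f b)
  have *: "free_scale (b * c) x = free_scale b (free_scale c x)" for x :: "'g poly word \<Rightarrow>\<^sub>0 complex"
    by (simp add: free_scale_def mult.assoc[symmetric] mult_single)
  have "free_scale b (f - free_scale c (xm \<alpha> d)) \<in> K"
    by (rule K_scale[OF scale.IH[OF scale.prems]])
  then show ?case unfolding * by (simp add: free_scale_def right_diff_distrib)
qed (simp add: free_scale_def)

lemma K_f_of_cv:
  assumes \<alpha>: "\<alpha> \<in> Rp"
    and K: "free_gen (monom (e \<alpha>) 1) ^ s * xm \<alpha> 0 ^ (s + 1) \<in> K"
  shows "xm \<alpha> s \<in> K"
proof -
  obtain c where c: "c \<noteq> 0"
    "comb \<alpha> 1 s c (free_gen (monom (e \<alpha>) 1) ^ s * xm \<alpha> 0 ^ (s + 1))"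
    using comb_e_pow[OF \<alpha>, of 1 s] by auto
  have "free_scale c (xm \<alpha> s) \<in> K"
    using K_diff[OF K comb_one[OF c(2) refl]] by simp
  from K_scale[OF this, of "inverse c"] show ?thesis
    using c(1) by (simp add: free_scale_def mult.assoc[symmetric] mult_single)
qed

subsection \<open>Weights and integrability\<close>

abbreviation const_gen :: "'g \<Rightarrow> ('g poly word \<Rightarrow>\<^sub>0 complex)" where
  "const_gen x \<equiv> free_gen (monom x 0)"

lemma const_gen_lie:
  "const_gen x * (const_gen y * f) - (const_gen y * (const_gen x * f) + const_gen (lie x y) * f) \<in> K"
  using gen_lie[of "monom x 0" "monom y 0" f] by (simp add: lie_poly_monom)

lemma const_gen_scale: "const_gen (cscale c x) * f - free_scale c (const_gen x * f) \<in> K"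
  unfolding monom_cscale by (rule gen_scale)

text \<open>\<open>wt \<theta> f\<close>: modulo \<open>K\<close>, \<open>f\<close> lies in the span of the monomials of weight \<open>\<theta>\<close> in the
  negative root vectors of \<open>\<gg>\<close>, applied to the highest weight vector.\<close>

inductive wt :: "('g \<Rightarrow> complex) \<Rightarrow> ('g poly word \<Rightarrow>\<^sub>0 complex) \<Rightarrow> bool" where
  one: "wt lam 1"
| lower: "wt \<theta> f \<Longrightarrow> \<beta> \<in> Rp \<Longrightarrow> wt (\<theta> - \<beta>) (const_gen (e (- \<beta>)) * f)"
| zero: "f \<in> K \<Longrightarrow> \<theta> \<in> dual_space H \<Longrightarrow> wt \<theta> f"
| add: "wt \<theta> f \<Longrightarrow> wt \<theta> g \<Longrightarrow> wt \<theta> (f + g)"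
| scale: "wt \<theta> f \<Longrightarrow> wt \<theta> (free_scale c f)"

lemma dual_diff: "\<alpha> \<in> dual_space H \<Longrightarrow> \<beta> \<in> dual_space H \<Longrightarrow> \<alpha> - \<beta> \<in> dual_space H"
  by (simp add: dual_space_def algebra_simps)

lemma wt_dual: "wt \<theta> f \<Longrightarrow> \<theta> \<in> dual_space H"
  by (induction rule: wt.induct) (blast intro: lam_dual dual_diff root_dual pos_rootD(1))+

lemma wt_cong:
  assumes "wt \<theta> f" "g - f \<in> K"
  shows "wt \<theta> g"
  using wt.add[OF assms(1) wt.zero[OF assms(2) wt_dual[OF assms(1)]]] by simp

lemma wt_H:
  assumes "wt \<theta> f" "h \<in> H"
  shows "const_gen h * f - free_scale (\<theta> h) f \<in> K"
  using assms(1)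
proof induction
  case one
  then show ?case using K_H[OF assms(2), of 0] by (simp add: free_scale_def)
next
  case (lower \<theta> f \<beta>)
  let ?x = "e (- \<beta>)"
  have br: "lie h ?x = cscale (- \<beta> h) ?x"
    using pos_rootD(3)[OF lower(2)] assms(2) by (simp add: root_space_def)
  have 1: "const_gen h * (const_gen ?x * f) - (const_gen ?x * (const_gen h * f) + const_gen (lie h ?x) * f) \<in> K"
    by (rule const_gen_lie)
  have 2: "const_gen (lie h ?x) * f - free_scale (- \<beta> h) (const_gen ?x * f) \<in> K"
    unfolding br by (rule const_gen_scale)
  have 3: "const_gen ?x * (const_gen h * f) - free_scale (\<theta> h) (const_gen ?x * f) \<in> K"
    using K_mult[OF lower.IH, of "const_gen ?x"] by (simp add: right_diff_distrib free_scale_mult_right)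
  have "free_scale ((\<theta> - \<beta>) h) g = free_scale (\<theta> h) g + free_scale (- \<beta> h) g" for g :: "'g poly word \<Rightarrow>\<^sub>0 complex"
    by (simp add: free_scale_def single_diff single_uminus algebra_simps)
  then show ?case using K_add[OF K_add[OF 1 2] 3] by (simp add: algebra_simps)
next
  case (zero f \<theta>)
  then show ?case by (intro K_diff K_mult K_scale)
next
  case (add \<theta> f g)
  have "(const_gen h * f - free_scale (\<theta> h) f) + (const_gen h * g - free_scale (\<theta> h) g) \<in> K"
    using K_add add by blast
  then show ?case by (simp add: free_scale_add algebra_simps)
next
  case (scale \<theta> f c)
  have "free_scale (\<theta> h) (free_scale c f) = free_scale c (free_scale (\<theta> h) f)"
    by (simp add: free_scale_def mult.assoc[symmetric] mult_single mult.commute[of "\<theta> h"])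
  moreover have "free_scale c (const_gen h * f - free_scale (\<theta> h) f) \<in> K"
    by (rule K_scale[OF scale.IH])
  ultimately show ?case
    by (simp add: free_scale_mult_right) (simp add: free_scale_def right_diff_distrib)
qed

lemma lie_opposite:
  assumes "\<gamma> \<in> Rt" "\<beta> \<in> Rt" "\<gamma> \<noteq> - \<beta>"
  shows "lie (e \<gamma>) (e \<beta>) = 0 \<or> (\<gamma> + \<beta> \<in> Rt \<and> (\<exists>c. lie (e \<gamma>) (e \<beta>) = cscale c (e (\<gamma> + \<beta>))))"
proof (cases "\<gamma> + \<beta> \<in> Rt")
  case True
  then show ?thesis using chevalley assms unfolding chevalley_basis_def by blast
next
  case False
  have "\<gamma> + \<beta> \<noteq> 0" using assms(3) by (simp add: eq_neg_iff_add_eq_0)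
  then have "root_space H (\<gamma> + \<beta>) = {0}"
    using False assms by (intro root_space_trivial dual_add root_dual)
  then show ?thesis using lie_root_space[OF e_root_space[OF assms(1)] e_root_space[OF assms(2)]] by auto
qed

text \<open>Commuting \<open>e \<gamma>\<close> past a lowering vector leaves a coroot acting by a
  scalar, zero, or a multiple of another root vector. If that vector is again raising, the induction
  hypothesis is needed for its root; hence the generalization over \<gamma>.\<close>

lemma wt_raise:
  assumes "wt \<theta> f" "\<gamma> \<in> Rp"
  shows "wt (\<theta> + \<gamma>) (const_gen (e \<gamma>) * f)"
  using assms
proof (induction arbitrary: \<gamma>)
  case one
  have "const_gen (e \<gamma>) * 1 \<in> K" using K_n_plus[OF e_n_plus[OF one]] by simp
  then show ?case
    using one by (intro wt.zero dual_add lam_dual root_dual pos_rootD(1))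
next
  case (lower \<theta> f \<beta>)
  let ?x = "e (- \<beta>)"
  have 1: "wt (\<theta> - \<beta> + \<gamma>) (const_gen ?x * (const_gen (e \<gamma>) * f))"
    using wt.lower[OF lower.IH[OF lower.prems] lower.hyps(2)] by (simp only: diff_add_eq)
  have 2: "wt (\<theta> - \<beta> + \<gamma>) (const_gen (lie (e \<gamma>) ?x) * f)"
  proof (cases "\<gamma> = \<beta>")
    case True
    have "const_gen (coroot e \<gamma>) * f - free_scale (\<theta> (coroot e \<gamma>)) f \<in> K"
      by (rule wt_H[OF lower.hyps(1) coroot_H[OF lower.prems]])
    from wt_cong[OF wt.scale[OF lower.hyps(1)] this] show ?thesis
      by (simp add: True coroot_def)
  next
    case False
    have g: "\<gamma> \<in> Rt" "- \<beta> \<in> Rt"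
      using pos_rootD(1)[OF lower.prems] neg_pos_root[OF lower.hyps(2)] by auto
    consider "lie (e \<gamma>) ?x = 0"
      | c where "\<gamma> - \<beta> \<in> Rt" "lie (e \<gamma>) ?x = cscale c (e (\<gamma> - \<beta>))"
      using lie_opposite[OF g] False by auto
    then show ?thesis
    proof cases
      case 1
      have "\<theta> - \<beta> + \<gamma> \<in> dual_space H"
        by (rule dual_add[OF dual_diff[OF wt_dual[OF lower.hyps(1)]
              root_dual[OF pos_rootD(1)[OF lower.hyps(2)]]] root_dual[OF g(1)]])
      then show ?thesis using 1 gen_zero[of f] by (simp add: wt.zero)
    next
      case 2
      have "wt (\<theta> - \<beta> + \<gamma>) (const_gen (e (\<gamma> - \<beta>)) * f)"
      proof (cases "\<gamma> - \<beta> \<in> Rp")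
        case True
        then show ?thesis using lower.IH[OF True] by (simp only: add_diff_eq diff_add_eq)
      next
        case False
        then have "- (\<gamma> - \<beta>) \<in> Rp" by (rule neg_root_pos[OF 2(1)])
        from wt.lower[OF lower.hyps(1) this] show ?thesis
          by (simp only: diff_minus_eq_add minus_minus add_diff_eq diff_add_eq)
      qed
      from wt_cong[OF wt.scale[OF this] const_gen_scale[of c]] show ?thesis
        by (simp add: 2(2))
    qed
  qed
  from wt_cong[OF wt.add[OF 1 2] const_gen_lie] show ?case .
next
  case (zero f \<theta>)
  then show ?case by (blast intro: wt.zero K_mult dual_add root_dual pos_rootD(1))
next
  case (add \<theta> f g)
  then show ?case by (simp add: distrib_left wt.add)
next
  case (scale \<theta> f c)
  then show ?case by (simp add: free_scale_mult_right wt.scale)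
qed

lemma wt_bound:
  assumes "wt \<theta> f" "f \<notin> K"
  shows "\<exists>c::_ \<Rightarrow> nat. \<theta> = (\<lambda>h. lam h - (\<Sum>\<beta>\<in>D. of_nat (c \<beta>) * \<beta> h))"
  using assms
proof induction
  case one
  show ?case by (rule exI[of _ "\<lambda>_. 0"]) simp
next
  case (lower \<theta> f \<beta>)
  obtain d :: "_ \<Rightarrow> nat" where d: "\<beta> = (\<lambda>h. \<Sum>\<beta>\<in>D. of_nat (d \<beta>) * \<beta> h)"
    using pos_rootD(6)[OF lower(2)] by (auto simp: nonneg_comb_def)
  have "f \<notin> K" using lower.prems K_mult by blast
  then obtain c :: "_ \<Rightarrow> nat" where c: "\<theta> = (\<lambda>h. lam h - (\<Sum>\<beta>\<in>D. of_nat (c \<beta>) * \<beta> h))"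
    using lower.IH by blast
  have "(\<theta> - \<beta>) h = lam h - (\<Sum>\<beta>\<in>D. of_nat (c \<beta> + d \<beta>) * \<beta> h)" for h
    using fun_cong[OF d, of h] fun_cong[OF c, of h] by (simp add: distrib_right sum.distrib)
  then show ?case by (intro exI[of _ "\<lambda>\<beta>. c \<beta> + d \<beta>"]) (simp add: fun_eq_iff)
qed (auto intro: K_add K_scale)

lemma weight_coeff:
  assumes "(\<lambda>h. lam h - (\<Sum>\<beta>\<in>D. of_nat (c \<beta> :: nat) * \<beta> h) + (\<Sum>\<beta>\<in>D. a \<beta> * \<beta> h))
      = (\<lambda>h. lam h - (\<Sum>\<beta>\<in>D. of_nat (c' \<beta> :: nat) * \<beta> h))" "i \<in> D"
  shows "a i = of_nat (c i) - of_nat (c' i)"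
proof -
  have "(\<Sum>\<beta>\<in>D. (a \<beta> - of_nat (c \<beta>) + of_nat (c' \<beta>)) * \<beta> h) = 0" for h
    using fun_cong[OF assms(1), of h]
    by (simp add: distrib_right left_diff_distrib sum.distrib sum_subtractf algebra_simps)
  from D_indep[OF this assms(2)] show ?thesis by (simp add: algebra_simps)
qed

section \<open>Local nilpotency of raising and simple lowering vectors\<close>

lemma raise_nilpotent:
  assumes f: "wt \<theta> f" and \<gamma>: "\<gamma> \<in> Rp"
  shows "\<exists>k. const_gen (e \<gamma>) ^ k * f \<in> K"
proof (rule ccontr)
  assume "\<nexists>k. const_gen (e \<gamma>) ^ k * f \<in> K"
  then have ne: "const_gen (e \<gamma>) ^ k * f \<notin> K" for k by blast
  obtain c :: "_ \<Rightarrow> nat" where c: "\<theta> = (\<lambda>h. lam h - (\<Sum>\<beta>\<in>D. of_nat (c \<beta>) * \<beta> h))"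
    using wt_bound[OF f] ne[of 0] by auto
  obtain a :: "_ \<Rightarrow> nat" where a: "\<gamma> = (\<lambda>h. \<Sum>\<beta>\<in>D. of_nat (a \<beta>) * \<beta> h)"
    using pos_rootD(6)[OF \<gamma>] by (auto simp: nonneg_comb_def)
  have "\<exists>i\<in>D. a i \<noteq> 0"
  proof (rule ccontr)
    assume "\<not> (\<exists>i\<in>D. a i \<noteq> 0)"
    then have "\<gamma> h = 0" for h using fun_cong[OF a, of h] by simp
    then show False using pos_rootD(1)[OF \<gamma>] by (auto simp: roots_def fun_eq_iff)
  qed
  then obtain i where i: "i \<in> D" "a i > 0" by auto
  \<comment> \<open>One more than the coefficient of \<open>i\<close> in \<lambda> - \<theta>: after
    \<open>k\<close> raisings this coefficient would be negative.\<close>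
  define k where "k = Suc (c i)"
  have "wt (\<lambda>h. \<theta> h + of_nat k * \<gamma> h) (const_gen (e \<gamma>) ^ k * f)" for k
  proof (induction k)
    case (Suc k)
    have "(\<lambda>h. \<theta> h + of_nat k * \<gamma> h) + \<gamma> = (\<lambda>h. \<theta> h + of_nat (Suc k) * \<gamma> h)"
      by (simp add: fun_eq_iff algebra_simps)
    with wt_raise[OF Suc \<gamma>] show ?case by (simp add: mult.assoc)
  qed (simp add: f)
  from wt_bound[OF this[of k] ne[of k]] obtain c' :: "_ \<Rightarrow> nat"
    where c': "(\<lambda>h. \<theta> h + of_nat k * \<gamma> h) = (\<lambda>h. lam h - (\<Sum>\<beta>\<in>D. of_nat (c' \<beta>) * \<beta> h))" by blast
  have "of_nat k * \<gamma> h = (\<Sum>\<beta>\<in>D. (of_nat (k * a \<beta>)) * \<beta> h)" for h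
    using fun_cong[OF a, of h] by (simp add: sum_distrib_left mult.assoc)
  then have "(\<lambda>h. lam h - (\<Sum>\<beta>\<in>D. of_nat (c \<beta>) * \<beta> h) + (\<Sum>\<beta>\<in>D. of_nat (k * a \<beta>) * \<beta> h))
      = (\<lambda>h. lam h - (\<Sum>\<beta>\<in>D. of_nat (c' \<beta>) * \<beta> h))"
    using c' c by metis
  from weight_coeff[OF this i(1)] have "of_nat (k * a i + c' i) = (of_nat (c i) :: complex)" by simp
  then have "k * a i + c' i = c i" by (simp only: of_nat_eq_iff)
  moreover have "k * a i \<ge> k" using i(2) by simp
  ultimately show False by (simp add: k_def)
qed

text \<open>Leibniz: moving a + b copies of \<open>y\<close> past \<open>x\<close> gives terms in
  which i of them act on \<open>x\<close> by ad and j on \<open>f\<close>, where i + j = a + b, so i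
  \<ge> a or j \<ge> b. The induction moves one \<open>y\<close> at a time and avoids binomial
  coefficients.\<close>

lemma lower_nilpotent_step:
  assumes "(lie y ^^ a) x = 0" "const_gen y ^ b * f \<in> K"
  shows "const_gen y ^ (a + b) * (const_gen x * f) \<in> K"
  using assms
proof (induction "a + b" arbitrary: a b x f)
  case 0
  then show ?case using K_mult[of f "const_gen x"] by simp
next
  case (Suc n)
  show ?case
  proof (cases "a = 0 \<or> b = 0")
    case True
    then have "const_gen x * f \<in> K"
      using Suc.prems gen_zero[of f] K_mult[of f "const_gen x"] by auto
    then show ?thesis by (rule K_mult)
  next
    case False
    then obtain a' b' where ab: "a = Suc a'" "b = Suc b'" by (metis not0_implies_Suc)
    have "(lie y ^^ a') (lie y x) = 0" using Suc.prems(1) by (simp add: ab funpow_swap1)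
    then have "const_gen y ^ (a' + b) * (const_gen (lie y x) * f) \<in> K"
      using Suc.hyps(2) Suc.prems(2) ab by (intro Suc.hyps(1)) auto
    moreover have "const_gen y ^ b' * (const_gen y * f) \<in> K"
      using Suc.prems(2) by (simp add: ab power_Suc2 mult.assoc del: power_Suc)
    then have "const_gen y ^ (a + b') * (const_gen x * (const_gen y * f)) \<in> K"
      using Suc.hyps(2) Suc.prems(1) ab by (intro Suc.hyps(1)) auto
    moreover have "a + b' = n" "a' + b = n" using Suc.hyps(2) ab by auto
    ultimately have "const_gen y ^ n * (const_gen x * (const_gen y * f) + const_gen (lie y x) * f) \<in> K"
      using K_add by (simp add: distrib_left)
    moreover have "const_gen y ^ n * (const_gen y * (const_gen x * f))
        - const_gen y ^ n * (const_gen x * (const_gen y * f) + const_gen (lie y x) * f) \<in> K"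
      using K_mult[OF const_gen_lie[of y x f], of "const_gen y ^ n"] by (simp only: right_diff_distrib)
    ultimately have "const_gen y ^ n * (const_gen y * (const_gen x * f)) \<in> K"
      using K_cong by blast
    then show ?thesis
      using Suc.hyps(2) by (simp add: power_Suc2 mult.assoc del: power_Suc flip: Suc.hyps(2))
  qed
qed

lemma nilpotent_mono: "x ^ k * f \<in> K \<Longrightarrow> k \<le> l \<Longrightarrow> x ^ l * f \<in> K"
  using K_mult[of "x ^ k * f" "x ^ (l - k)"] by (simp add: mult.assoc[symmetric] flip: power_add)

lemma simple_lower_nilpotent:
  assumes "wt \<theta> f" and i: "i \<in> D"
  shows "\<exists>k. const_gen (e (- i)) ^ k * f \<in> K"
  using assms(1)
proof induction
  case one
  obtain m where "of_nat m = lam (coroot e i)"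
    using lam i by (auto simp: dominant_weights_def elim!: Nats_cases)
  from K_simple[OF i this] show ?case by (intro exI[of _ "m + 1"]) (simp only: mult_1_right)
next
  case (lower \<theta> f \<beta>)
  then obtain b where b: "const_gen (e (- i)) ^ b * f \<in> K" by blast
  have i': "i \<in> Rp" using i D_pos by blast
  obtain a where "(lie (e (- i)) ^^ a) (e (- \<beta>)) = 0"
    using ad_nilpotent[OF dual_uminus[OF root_dual[OF pos_rootD(1)[OF lower(2)]]]
        neg_pos_root[OF i'] pos_rootD(3)[OF i'] pos_rootD(3)[OF lower(2)]] .
  from lower_nilpotent_step[OF this b] show ?case by blast
next
  case (zero f \<theta>)
  then show ?case by (intro exI[of _ 0]) simp
next
  case (add \<theta> f g)
  then obtain k l where "const_gen (e (- i)) ^ k * f \<in> K" "const_gen (e (- i)) ^ l * g \<in> K" by blast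
  then have "const_gen (e (- i)) ^ (max k l) * f \<in> K" "const_gen (e (- i)) ^ (max k l) * g \<in> K"
    by (auto elim: nilpotent_mono)
  from K_add[OF this] show ?case
    by (intro exI[of _ "max k l"]) (simp only: distrib_left)
next
  case (scale \<theta> f c)
  then obtain k where "const_gen (e (- i)) ^ k * f \<in> K" by blast
  from K_scale[OF this] show ?case
    by (intro exI[of _ k]) (simp only: free_scale_mult_right)
qed

text \<open>Nilpotency of the lowering vector is a hypothesis because the chain serves twice: for
  simple roots, to reflect weights, and, once this has given nilpotency for all positive roots, to
  find the exact exponent.\<close>

lemma wt_chain:
  assumes \<alpha>: "\<alpha> \<in> Rp" and \<theta>: "\<theta> \<in> dual_space H"
    and nil: "\<And>\<theta> f. wt \<theta> f \<Longrightarrow> \<exists>k. const_gen (e (- \<alpha>)) ^ k * f \<in> K"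
  shows "sl2_chain free_scale K ((*) (const_gen (e \<alpha>))) ((*) (const_gen (e (- \<alpha>))))
    (\<lambda>j. {f. wt (\<lambda>h. \<theta> h + of_int j * \<alpha> h) f}) (\<theta> (coroot e \<alpha>))"
proof -
  interpret vector_space "free_scale :: complex \<Rightarrow> _ \<Rightarrow> ('g poly word \<Rightarrow>\<^sub>0 complex)"
    by (rule vector_space_free_scale)
  show ?thesis
  proof unfold_locales
    show "subspace K" using K_zero K_add K_scale by (simp add: subspace_def)
    fix f j assume "f \<in> {f. wt (\<lambda>h. \<theta> h + of_int j * \<alpha> h) f}"
    then have f: "wt (\<lambda>h. \<theta> h + of_int j * \<alpha> h) f" by simp
    have "(\<lambda>h. \<theta> h + of_int j * \<alpha> h) + \<alpha> = (\<lambda>h. \<theta> h + of_int (j + 1) * \<alpha> h)"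
      "(\<lambda>h. \<theta> h + of_int j * \<alpha> h) - \<alpha> = (\<lambda>h. \<theta> h + of_int (j - 1) * \<alpha> h)"
      by (simp_all add: fun_eq_iff algebra_simps)
    note eq = this
    show "const_gen (e \<alpha>) * f \<in> {f. wt (\<lambda>h. \<theta> h + of_int (j + 1) * \<alpha> h) f}"
      using wt_raise[OF f \<alpha>] unfolding eq by (rule CollectI)
    show "const_gen (e (- \<alpha>)) * f \<in> {f. wt (\<lambda>h. \<theta> h + of_int (j - 1) * \<alpha> h) f}"
      using wt.lower[OF f \<alpha>] unfolding eq by (rule CollectI)
    have "\<theta> (coroot e \<alpha>) + of_int j * \<alpha> (coroot e \<alpha>) = \<theta> (coroot e \<alpha>) + of_int (2 * j)"
      by (simp add: root_coroot[OF \<alpha>])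
    with wt_H[OF f coroot_H[OF \<alpha>]]
    have "const_gen (coroot e \<alpha>) * f - free_scale (\<theta> (coroot e \<alpha>) + of_int (2 * j)) f \<in> K"
      by simp
    from K_add[OF const_gen_lie[of "e \<alpha>" "e (- \<alpha>)" f, folded coroot_def] this]
    show "const_gen (e \<alpha>) * (const_gen (e (- \<alpha>)) * f) - const_gen (e (- \<alpha>)) * (const_gen (e \<alpha>) * f)
        - free_scale (\<theta> (coroot e \<alpha>) + of_int (2 * j)) f \<in> K"
      by (simp add: algebra_simps)
    show "\<exists>k. ((*) (const_gen (e \<alpha>)) ^^ k) f \<in> K"
      using raise_nilpotent[OF f \<alpha>] by (simp add: funpow_mult_left)
    show "\<exists>k. ((*) (const_gen (e (- \<alpha>))) ^^ k) f \<in> K"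
      using nil[OF f] by (simp add: funpow_mult_left)
  qed (simp_all add: distrib_left free_scale_mult_right K_mult)
qed

section \<open>Stability of weights under reflections, and integrability\<close>

lemma weight_reflect:
  assumes f: "wt \<theta> f" "f \<notin> K" and i: "i \<in> D"
  obtains m :: int and g where "\<theta> (coroot e i) = of_int m" "wt (reflect i \<theta>) g" "g \<notin> K"
proof -
  have i': "i \<in> Rp" using i D_pos by blast
  interpret sl2_chain free_scale K "(*) (const_gen (e i))" "(*) (const_gen (e (- i)))"
    "\<lambda>j. {f. wt (\<lambda>h. \<theta> h + of_int j * i h) f}" "\<theta> (coroot e i)"
    by (rule wt_chain[OF i' wt_dual[OF f(1)] simple_lower_nilpotent[OF _ i]])
  have "f \<in> {f. wt (\<lambda>h. \<theta> h + of_int 0 * i h) f}" using f(1) by simp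
  from reflection[OF this f(2)] obtain m g where
    m: "\<theta> (coroot e i) = of_int m" "wt (\<lambda>h. \<theta> h + of_int (- m) * i h) g" "g \<notin> K" by blast
  moreover have "reflect i \<theta> = (\<lambda>h. \<theta> h + of_int (- m) * i h)"
    by (simp add: reflect_def m(1))
  ultimately show ?thesis using that by metis
qed

text \<open>The weights are stable under the simple reflections and bounded by \<open>\<lambda>\<close>; conjugating
  \<open>\<alpha>\<close> down to a multiple of a simple root shows that the \<open>\<alpha>\<close>-string is finite.\<close>

lemma weight_string_finite:
  assumes "\<alpha> \<in> Rp"
  shows "\<exists>k::nat. \<forall>j\<ge>k. \<forall>f. wt (\<lambda>h. \<theta> h - of_nat j * \<alpha> h) f \<longrightarrow> f \<in> K"
  using assms
proof (induction arbitrary: \<theta> rule: pos_root_induct)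
  case (multiple i c)
  show ?case
  proof (rule ccontr)
    assume "\<not> ?thesis"
    then have ex: "\<exists>j\<ge>k. \<exists>f. wt (\<lambda>h. \<theta> h - of_nat j * (of_nat c * i h)) f \<and> f \<notin> K" for k by blast
    \<comment> \<open>\<theta> itself may fail to be a weight. This first nonzero weight of the
      string is the reference point: it gives an integer value on the coroot and an initial
      coefficient of \<open>i\<close>.\<close>
    obtain j\<^sub>0 f\<^sub>0 where 0: "wt (\<lambda>h. \<theta> h - of_nat j\<^sub>0 * (of_nat c * i h)) f\<^sub>0" "f\<^sub>0 \<notin> K"
      using ex[of 0] by blast
    have i': "i \<in> Rp" using multiple(1) D_pos by blast
    obtain d\<^sub>0 :: "_ \<Rightarrow> nat"
      where d\<^sub>0: "(\<lambda>h. \<theta> h - of_nat j\<^sub>0 * (of_nat c * i h)) = (\<lambda>h. lam h - (\<Sum>\<beta>\<in>D. of_nat (d\<^sub>0 \<beta>) * \<beta> h))"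
      using wt_bound[OF 0] by blast
    obtain m\<^sub>0 :: int where m\<^sub>0: "\<theta> (coroot e i) - of_nat j\<^sub>0 * (of_nat c * i (coroot e i)) = of_int m\<^sub>0"
      using weight_reflect[OF 0 multiple(1)] by blast
    \<comment> \<open>Chosen to refute the bound on \<open>j\<close> obtained below from the fact
      that the i-th coefficient of the reflected weight does not exceed that of \<lambda>.\<close>
    define k where "k = nat (int (d\<^sub>0 i) + m\<^sub>0 + int (j\<^sub>0 * c)) + 1"
    obtain j f where j: "j \<ge> k" "wt (\<lambda>h. \<theta> h - of_nat j * (of_nat c * i h)) f" "f \<notin> K"
      using ex[of k] by blast
    obtain g where g: "wt (reflect i (\<lambda>h. \<theta> h - of_nat j * (of_nat c * i h))) g" "g \<notin> K"
      using weight_reflect[OF j(2,3) multiple(1)] by blast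
    obtain d :: "_ \<Rightarrow> nat"
      where d: "reflect i (\<lambda>h. \<theta> h - of_nat j * (of_nat c * i h)) = (\<lambda>h. lam h - (\<Sum>\<beta>\<in>D. of_nat (d \<beta>) * \<beta> h))"
      using wt_bound[OF g] by blast
    \<comment> \<open>The reflected weight minus the reference weight, as a multiple of
      \<open>i\<close>: reflecting turns - j c into j c - \<theta>(h_i), where \<theta>(h_i) =
      \<open>m\<^sub>0 + 2 * j\<^sub>0 * c\<close>.\<close>
    define b where "b = int (j * c) - m\<^sub>0 - int (j\<^sub>0 * c)"
    have "reflect i (\<lambda>h. \<theta> h - of_nat j * (of_nat c * i h))
        = (\<lambda>h. (\<theta> h - of_nat j\<^sub>0 * (of_nat c * i h)) + of_int b * i h)"
    proof
      fix h
      have "\<theta> (coroot e i) = of_int m\<^sub>0 + 2 * of_nat j\<^sub>0 * of_nat c"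
        using m\<^sub>0 by (simp add: root_coroot[OF i'] algebra_simps)
      then show "reflect i (\<lambda>h. \<theta> h - of_nat j * (of_nat c * i h)) h
          = (\<theta> h - of_nat j\<^sub>0 * (of_nat c * i h)) + of_int b * i h"
        by (simp add: reflect_def root_coroot[OF i'] b_def algebra_simps)
    qed
    also have "\<dots> = (\<lambda>h. lam h - (\<Sum>\<beta>\<in>D. of_nat (d\<^sub>0 \<beta>) * \<beta> h)
        + (\<Sum>\<beta>\<in>D. (if \<beta> = i then of_int b else 0) * \<beta> h))"
    proof
      fix h
      have "(\<Sum>\<beta>\<in>D. (if \<beta> = i then of_int b else 0) * \<beta> h) = (\<Sum>\<beta>\<in>D. if \<beta> = i then of_int b * i h else 0)"
        by (intro sum.cong) auto
      also have "\<dots> = of_int b * i h" using multiple(1) finite_D by simp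
      finally show "(\<theta> h - of_nat j\<^sub>0 * (of_nat c * i h)) + of_int b * i h
        = lam h - (\<Sum>\<beta>\<in>D. of_nat (d\<^sub>0 \<beta>) * \<beta> h) + (\<Sum>\<beta>\<in>D. (if \<beta> = i then of_int b else 0) * \<beta> h)"
        using fun_cong[OF d\<^sub>0, of h] by simp
    qed
    finally have "(\<lambda>h. lam h - (\<Sum>\<beta>\<in>D. of_nat (d\<^sub>0 \<beta>) * \<beta> h) + (\<Sum>\<beta>\<in>D. (if \<beta> = i then of_int b else 0) * \<beta> h))
        = (\<lambda>h. lam h - (\<Sum>\<beta>\<in>D. of_nat (d \<beta>) * \<beta> h))"
      using d by metis
    from weight_coeff[OF this multiple(1)] have "(of_int b :: complex) = of_int (int (d\<^sub>0 i) - int (d i))"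
      by simp
    then have "b = int (d\<^sub>0 i) - int (d i)" by (simp only: of_int_eq_iff)
    then have "int (j * c) \<le> int (d\<^sub>0 i) + m\<^sub>0 + int (j\<^sub>0 * c)" by (simp add: b_def)
    moreover have "j \<le> j * c" using multiple(2) by simp
    ultimately have "int j \<le> int (d\<^sub>0 i) + m\<^sub>0 + int (j\<^sub>0 * c)" by linarith
    then show False using j(1) by (simp add: k_def)
  qed
next
  case (reflect \<alpha> i)
  \<comment> \<open>The reflection carries the \<alpha>-string through \<theta> to the string of
    \<open>reflect i \<alpha>\<close> through \<open>reflect i \<theta>\<close>; hence the induction
    over all \<theta>.\<close>
  obtain k where k: "\<And>j f. j \<ge> k \<Longrightarrow> wt (\<lambda>h. reflect i \<theta> h - of_nat j * reflect i \<alpha> h) f \<Longrightarrow> f \<in> K"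
    using reflect.IH[of "reflect i \<theta>"] by blast
  have "f \<in> K" if j: "j \<ge> k" and f: "wt (\<lambda>h. \<theta> h - of_nat j * \<alpha> h) f" for j f
  proof (rule ccontr)
    assume "f \<notin> K"
    from weight_reflect[OF f this reflect.hyps(2)]
    obtain g where g: "wt (reflect i (\<lambda>h. \<theta> h - of_nat j * \<alpha> h)) g" "g \<notin> K" by blast
    have "reflect i (\<lambda>h. \<theta> h - of_nat j * \<alpha> h) = (\<lambda>h. reflect i \<theta> h - of_nat j * reflect i \<alpha> h)"
      by (simp add: reflect_def fun_eq_iff algebra_simps)
    with k[OF j] g show False by simp
  qed
  then show ?case by blast
qed

lemma lower_nilpotent:
  assumes f: "wt \<theta> f" and \<alpha>: "\<alpha> \<in> Rp"
  shows "\<exists>k. const_gen (e (- \<alpha>)) ^ k * f \<in> K"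
proof -
  obtain k :: nat where k: "\<And>f. wt (\<lambda>h. \<theta> h - of_nat k * \<alpha> h) f \<Longrightarrow> f \<in> K"
    using weight_string_finite[OF \<alpha>, of \<theta>] by blast
  have "wt (\<lambda>h. \<theta> h - of_nat k * \<alpha> h) (const_gen (e (- \<alpha>)) ^ k * f)" for k
  proof (induction k)
    case (Suc k)
    have "(\<lambda>h. \<theta> h - of_nat k * \<alpha> h) - \<alpha> = (\<lambda>h. \<theta> h - of_nat (Suc k) * \<alpha> h)"
      by (simp add: fun_eq_iff algebra_simps)
    note eq = this
    show ?case using wt.lower[OF Suc \<alpha>] unfolding eq by (simp only: power_Suc mult.assoc)
  qed (simp add: f)
  then show ?thesis using k by blast
qed

text \<open>Dominance gives integrality only on simple coroots. Here both the natural number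
  \<lambda>(h_\<alpha>) and the exponent come from 1 being a primitive vector, for which it must
  survive in the quotient.\<close>

lemma K_root_power:
  assumes \<alpha>: "\<alpha> \<in> Rp" and ne: "1 \<notin> K"
  obtains n where "lam (coroot e \<alpha>) = of_nat n" "xm \<alpha> 0 ^ Suc n \<in> K"
proof -
  interpret sl2_chain free_scale K "(*) (const_gen (e \<alpha>))" "(*) (const_gen (e (- \<alpha>)))"
    "\<lambda>j. {f. wt (\<lambda>h. lam h + of_int j * \<alpha> h) f}" "lam (coroot e \<alpha>)"
    by (rule wt_chain[OF \<alpha> lam_dual lower_nilpotent[OF _ \<alpha>]])
  have 1: "1 \<in> {f. wt (\<lambda>h. lam h + of_int 0 * \<alpha> h) f}" using wt.one by simp
  have 2: "const_gen (e \<alpha>) * 1 \<in> K" using K_n_plus[OF e_n_plus[OF \<alpha>]] by simp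
  obtain n where n: "lam (coroot e \<alpha>) + of_int (2 * 0) = of_nat n"
    "((*) (const_gen (e (- \<alpha>))) ^^ Suc n) 1 \<in> K"
    using primitive_weight[OF 1 2 ne] .
  then show ?thesis using that by (simp add: funpow_mult_left xm_def)
qed

end

section \<open>Truncation\<close>

definition word_map :: "('l \<Rightarrow> 'k) \<Rightarrow> ('l word \<Rightarrow>\<^sub>0 complex) \<Rightarrow> ('k word \<Rightarrow>\<^sub>0 complex)" where
  "word_map h f = (\<Sum>w\<in>Poly_Mapping.keys f. Poly_Mapping.single (map_word h w) (Poly_Mapping.lookup f w))"

lemma word_map_superset:
  assumes "finite S" "Poly_Mapping.keys f \<subseteq> S"
  shows "word_map h f = (\<Sum>w\<in>S. Poly_Mapping.single (map_word h w) (Poly_Mapping.lookup f w))"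
  unfolding word_map_def using assms by (intro sum.mono_neutral_left) (auto simp: in_keys_iff)

lemma word_map_single: "word_map h (Poly_Mapping.single w c) = Poly_Mapping.single (map_word h w) c"
  by (subst word_map_superset[of "{w}"]) auto

lemma word_map_add: "word_map h (f + g) = word_map h f + word_map h g"
proof -
  let ?S = "Poly_Mapping.keys f \<union> Poly_Mapping.keys g"
  have "word_map h k = (\<Sum>w\<in>?S. Poly_Mapping.single (map_word h w) (Poly_Mapping.lookup k w))"
    if "k \<in> {f, g, f + g}" for k
    using that keys_add[of f g] by (intro word_map_superset) auto
  then show ?thesis by (simp add: lookup_add single_add sum.distrib)
qed

lemma word_map_cst: "word_map h (cst c) = cst c"
  by (simp add: word_map_single zero_word_def)

lemma word_map_single_mult:
  fixes f :: "'l word \<Rightarrow>\<^sub>0 complex"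
  shows "word_map h (Poly_Mapping.single v c * f) = Poly_Mapping.single (map_word h v) c * word_map h f"
proof -
  have m: "map_word h (v + w) = map_word h v + map_word h w" for v w :: "'l word"
    by (cases v; cases w) (simp add: plus_word_def)
  have "f \<in> free_alg UNIV" by simp
  then show ?thesis
  proof (induction rule: free_alg_induct)
    case zero
    then show ?case by (simp add: word_map_def)
  next
    case (single w d)
    then show ?case by (simp add: mult_single word_map_single m)
  next
    case (add f g)
    then show ?case by (simp add: distrib_left word_map_add)
  qed
qed

lemma word_map_mult: "word_map h (f * g) = word_map h f * word_map h g"
proof -
  have "f \<in> free_alg UNIV" by simp
  then show ?thesis
    by (induction rule: free_alg_induct)
      (simp_all add: word_map_single_mult word_map_single distrib_right word_map_add, simp add: word_map_def)
qed

lemma word_map_gen: "word_map h (free_gen x) = free_gen (h x)"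
  by (simp add: free_gen_def word_map_single)

lemma word_map_zero [simp]: "word_map h 0 = 0"
  by (simp add: word_map_def)

lemma word_map_one [simp]: "word_map h 1 = 1"
  using word_map_cst[of h 1] by simp

lemma word_map_diff: "word_map h (f - g) = word_map h f - word_map h g"
  by (metis add_diff_cancel diff_add_cancel word_map_add)

lemma word_map_scale: "word_map h (free_scale c f) = free_scale c (word_map h f)"
  by (simp add: free_scale_def word_map_mult word_map_cst)

lemma word_map_range: "word_map h f \<in> free_alg (range h)"
  by (induction f rule: free_algebra_induct)
    (auto simp: word_map_cst word_map_mult word_map_gen word_map_add
      intro: free_alg_cst free_alg_mult free_alg_add free_alg_gen)

lemma word_map_ident:
  assumes "\<And>x. x \<in> L \<Longrightarrow> h x = x" "f \<in> free_alg L"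
  shows "word_map h f = f"
  using assms(2)
proof (induction rule: free_alg_induct)
  case (single w c)
  have "map_word h w = map_word (\<lambda>x. x) w"
    using single assms(1) by (intro word.map_cong) (cases w; auto)+
  then show ?case by (simp add: word_map_single word.map_ident)
qed (simp_all add: word_map_add)

lemma keys_word_map: "Poly_Mapping.keys (word_map h f) \<subseteq> map_word h ` Poly_Mapping.keys f"
  unfolding word_map_def
  by (rule order.trans[OF keys_sum]) (auto split: if_splits)

section \<open>Truncated polynomials and their bracket\<close>

lemma coeff_trunc: "coeff (trunc N p) k = (if enat k < N then coeff p k else 0)"
  by (cases N) (simp_all add: trunc_def coeff_poly_cutoff)

lemma trunc_add: "trunc N (p + q) = trunc N p + trunc N (q :: 'g::complex_lie_algebra poly)"
  by (simp add: poly_eq_iff coeff_trunc)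

lemma trunc_cscale: "trunc N (cscale c p) = cscale c (trunc N (p :: 'g::complex_lie_algebra poly))"
  by (simp add: poly_eq_iff coeff_trunc coeff_cscale_poly)

lemma trunc_zero [simp]: "trunc N 0 = 0"
  by (simp add: poly_eq_iff coeff_trunc)

lemma trunc_trunc [simp]: "trunc N (trunc N p) = trunc N p"
  by (simp add: poly_eq_iff coeff_trunc)

lemma trunc_diff: "trunc N (p - q) = trunc N p - trunc N (q :: 'g::complex_lie_algebra poly)"
  by (simp add: poly_eq_iff coeff_trunc)

lemma trunc_sum: "trunc N (\<Sum>i\<in>A. f i) = (\<Sum>i\<in>A. trunc N (f i :: 'g::complex_lie_algebra poly))"
  by (induction A rule: infinite_finite_induct) (simp_all add: trunc_add)

lemma trunc_monom: "trunc N (monom x r) = monom (if enat r < N then x else 0) r"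
  by (auto simp: poly_eq_iff coeff_trunc)

lemma trunc_current_iff: "p \<in> trunc_current N \<longleftrightarrow> trunc N p = p"
  unfolding trunc_current_def by (auto intro: range_eqI[OF sym])

text \<open>Degrees add under the bracket, so the polynomials killed by truncation form an ideal,
  the kernel of the projection.\<close>

lemma trunc_lie_eq_0:
  assumes "trunc N (p :: 'g::complex_lie_algebra poly) = 0"
  shows "trunc N (lie p q) = 0" "trunc N (lie q p) = 0"
proof -
  have "coeff p i = 0" if "enat i < N" for i
    using assms that coeff_trunc[of N p i] by simp
  moreover have "enat (i + j) < N \<Longrightarrow> enat i < N" for i j
    by (metis enat_ord_simps(1) le_add1 le_less_trans)
  ultimately have "trunc N (monom (lie (coeff p i) (coeff q j)) (i + j)) = 0" for i j
    by (auto simp: trunc_monom)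
  then show *: "trunc N (lie p q) = 0"
    by (simp add: lie_poly_def trunc_sum)
  have "lie q p = cscale (- 1) (lie p q)"
    by (subst lie_swap) (simp only: lie_vs.scale_minus_left lie_vs.scale_one)
  then show "trunc N (lie q p) = 0" by (simp only: trunc_cscale * cscale_zero)
qed

lemma trunc_lie_trunc:
  "trunc N (lie (trunc N p) (trunc N q)) = trunc N (lie p (q :: 'g::complex_lie_algebra poly))"
proof -
  have "lie p q = lie (trunc N p) q + lie (p - trunc N p) q"
    using lie_add_left[of "trunc N p" "p - trunc N p" q] by simp
  moreover have "lie (trunc N p) q = lie (trunc N p) (trunc N q) + lie (trunc N p) (q - trunc N q)"
    using lie_add_right[of "trunc N p" "trunc N q" "q - trunc N q"] by simp
  ultimately show ?thesis by (simp add: trunc_add trunc_lie_eq_0 trunc_diff)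
qed

abbreviation "free_trunc N \<equiv> word_map (trunc N)"

lemma env_relationsI:
  "x \<in> L \<Longrightarrow> y \<in> L \<Longrightarrow> free_gen (x + y) - free_gen x - free_gen y \<in> env_relations L br"
  "x \<in> L \<Longrightarrow> free_gen (cscale c x) - free_scale c (free_gen x) \<in> env_relations L br"
  "x \<in> L \<Longrightarrow> y \<in> L \<Longrightarrow>
    free_gen x * free_gen y - free_gen y * free_gen x - free_gen (br x y) \<in> env_relations L br"
  unfolding env_relations_def by blast+

lemma env_relations_cases [consumes 1, case_names add scale lie]:
  assumes "r \<in> env_relations L br"
  obtains x y where "r = free_gen (x + y) - free_gen x - free_gen y" "x \<in> L" "y \<in> L"
  | c x where "r = free_gen (cscale c x) - free_scale c (free_gen x)" "x \<in> L"
  | x y where "r = free_gen x * free_gen y - free_gen y * free_gen x - free_gen (br x y)" "x \<in> L" "y \<in> L"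
  using assms unfolding env_relations_def by blast

lemma env_ideal_mult_left:
  assumes "f \<in> env_ideal L br" "g \<in> free_alg L"
  shows "g * f \<in> env_ideal L br"
  using assms(1)
proof induction
  case (gen r u v)
  then show ?case
    using env_ideal.gen[OF gen(1) free_alg_mult[OF assms(2) gen(2)] gen(3)] by (simp add: mult.assoc)
qed (auto simp: distrib_left intro: env_ideal.intros)

lemma current_relations_free_alg:
  assumes "r \<in> env_relations (trunc_current N) (trunc_lie N)"
  shows "r \<in> free_alg (trunc_current N)"
  using assms unfolding env_relations_def
  by (auto simp: trunc_current_iff trunc_add trunc_cscale trunc_lie_def
      intro!: free_alg_diff free_alg_gen free_alg_scale free_alg_mult)

lemma current_ideal_free_alg: "f \<in> current_ideal N \<Longrightarrow> f \<in> free_alg (trunc_current N)"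
  by (induction rule: env_ideal.induct)
    (auto intro: free_alg_add free_alg_mult current_relations_free_alg free_alg_cst[of 0, simplified])

section \<open>Presentations of the enveloping algebras and the Weyl modules\<close>

lemma submodule_current_ideal:
  "gmod_submodule (free_current N) (current_ideal N :: ('g::complex_lie_algebra poly word \<Rightarrow>\<^sub>0 complex) set)"
  unfolding gmod_submodule_def
proof (intro conjI ballI allI)
  fix f g :: "'g poly word \<Rightarrow>\<^sub>0 complex" and c and x :: "'g poly"
  assume f: "f \<in> current_ideal N"
  have "trunc N x \<in> trunc_current N" by (simp add: trunc_current_iff)
  then show "mact (free_current N) x f \<in> current_ideal N"
    using env_ideal_mult_left[OF f free_alg_gen] by (simp add: free_current_def)
  show "msmult (free_current N) c f \<in> current_ideal N"
    using env_ideal_mult_left[OF f free_alg_cst] by (simp add: free_current_def free_scale_def)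
  assume "g \<in> current_ideal N"
  then show "madd (free_current N) f g \<in> current_ideal N"
    using f by (simp add: free_current_def env_ideal.add)
qed (use env_ideal.zero[of "trunc_current N" "trunc_lie N"] current_ideal_free_alg in \<open>auto simp: free_current_def\<close>)

text \<open>Taking letters from all of g[t] and truncating them in the presentation map gives every
  \<open>N\<close> the same free algebra and the same grading; the kernel alone distinguishes the
  presentations.\<close>

lemma presents_free_current:
  "presents (free_current N) (free_trunc N) {f. free_trunc N f = 0} (mgrade (free_current \<infinity>))"
  unfolding presents_def
proof (intro conjI allI)
  show "left_ideal {f. free_trunc N f = (0 :: 'a poly word \<Rightarrow>\<^sub>0 complex)}"
    by (simp add: left_ideal_def word_map_add word_map_mult)
  have id: "free_trunc N f = f" if "f \<in> free_alg (trunc_current N)" for f :: "'a poly word \<Rightarrow>\<^sub>0 complex"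
    using that by (intro word_map_ident) (auto simp: trunc_current_iff)
  have rg: "free_trunc N f \<in> free_alg (trunc_current N)" for f :: "'a poly word \<Rightarrow>\<^sub>0 complex"
    using word_map_range[of "trunc N" f] by (simp add: trunc_current_def)
  show "carr (free_current N) = range (free_trunc N :: ('a poly word \<Rightarrow>\<^sub>0 complex) \<Rightarrow> _)"
    unfolding free_current_def using id rg by (auto intro: rangeI[of _ "f" for f] simp: image_iff) metis
  fix n
  show "mgrade (free_current N) n = free_trunc N ` (mgrade (free_current \<infinity>) n :: ('a poly word \<Rightarrow>\<^sub>0 complex) set)"
  proof (intro equalityI subsetI)
    fix f :: "'a poly word \<Rightarrow>\<^sub>0 complex" assume f: "f \<in> mgrade (free_current N) n"
    then have "f \<in> mgrade (free_current \<infinity>) n" by (simp add: free_current_def)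
    moreover have "f = free_trunc N f" using f id[of f] by (simp add: free_current_def)
    ultimately show "f \<in> free_trunc N ` mgrade (free_current \<infinity>) n" by blast
  next
    fix f :: "'a poly word \<Rightarrow>\<^sub>0 complex" assume "f \<in> free_trunc N ` mgrade (free_current \<infinity>) n"
    then obtain g where g: "f = free_trunc N g" "g \<in> mgrade (free_current \<infinity>) n" by blast
    have "\<exists>l :: ('a \<times> nat) list. letters w = map (\<lambda>(x, r). monom x r) l \<and> sum_list (map snd l) = n"
      if w: "w \<in> Poly_Mapping.keys f" for w
    proof -
      obtain v where v: "v \<in> Poly_Mapping.keys g" "w = map_word (trunc N) v"
        using w keys_word_map[of "trunc N" g] unfolding g(1) by blast
      obtain l :: "('a \<times> nat) list"
        where l: "letters v = map (\<lambda>(x, r). monom x r) l" "sum_list (map snd l) = n"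
        using g(2) v(1) by (auto simp: free_current_def)
      \<comment> \<open>A letter that is cut off is recorded as a zero monomial with its old
        exponent, so the degree of the word does not change.\<close>
      let ?l = "map (\<lambda>(x, r). (if enat r < N then x else 0, r)) l"
      have "letters w = map (trunc N) (letters v)" by (simp add: v(2) word.map_sel)
      also have "\<dots> = map (\<lambda>(x, r). monom x r) ?l"
        by (auto simp: l(1) trunc_monom)
      finally have 1: "letters w = map (\<lambda>(x, r). monom x r) ?l" .
      have "map snd ?l = map snd l" by auto
      then have 2: "sum_list (map snd ?l) = n" by (simp only: l(2))
      show ?thesis by (rule exI[of _ ?l], rule conjI[OF 1 2])
    qed
    then show "f \<in> mgrade (free_current N) n" using rg[of g] g(1) by (simp add: free_current_def)
  qed
qed (simp_all add: free_current_def word_map_add word_map_mult word_map_gen word_map_scale word_map_diff)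

lemma presents_env_current:
  "presents (env_current N) (gmod_coset (free_current N) (current_ideal N) \<circ> free_trunc N)
     {f. free_trunc N f \<in> current_ideal N} (mgrade (free_current \<infinity>))"
  using presents_quot[OF presents_free_current submodule_current_ideal]
  by (simp add: env_current_def vimage_def)

lemma presents_mact_pow:
  assumes "presents M p K G"
  shows "(mact M x ^^ k) (p f) = p (free_gen x ^ k * f)"
  by (induction k) (simp_all add: presentsD(6)[OF assms] mult.assoc)

text \<open>Lifts of \<open>weyl_relations\<close> to the free algebra on g[t]; \<open>N\<close>
  enters only through the presentation map.\<close>

definition weyl_generators ::
    "'g::complex_lie_algebra set \<Rightarrow> ('g \<Rightarrow> complex) set \<Rightarrow> (('g \<Rightarrow> complex) \<Rightarrow> 'g)
      \<Rightarrow> ('g \<Rightarrow> complex) \<Rightarrow> ('g poly word \<Rightarrow>\<^sub>0 complex) set" where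
  "weyl_generators H D e lam =
     {free_gen (monom x r) | x r. x \<in> n_plus H D} \<union>
     {free_gen (monom h r) - cst (if r = 0 then lam h else 0) | h r. h \<in> H} \<union>
     {free_gen (monom (e (- \<alpha>)) 0) ^ (m + 1) | \<alpha> m. \<alpha> \<in> D \<and> of_nat m = lam (coroot e \<alpha>)}"

definition weyl_kernel ::
    "'g::complex_lie_algebra set \<Rightarrow> ('g \<Rightarrow> complex) set \<Rightarrow> (('g \<Rightarrow> complex) \<Rightarrow> 'g) \<Rightarrow> enat
      \<Rightarrow> ('g \<Rightarrow> complex) \<Rightarrow> ('g poly word \<Rightarrow>\<^sub>0 complex) set" where
  "weyl_kernel H D e N lam =
     left_ideal_hull ({f. free_trunc N f \<in> current_ideal N} \<union> weyl_generators H D e lam)"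

lemma weyl_generatorsI:
  "x \<in> n_plus H D \<Longrightarrow> free_gen (monom x r) \<in> weyl_generators H D e lam"
  "h \<in> H \<Longrightarrow> free_gen (monom h r) - cst (if r = 0 then lam h else 0) \<in> weyl_generators H D e lam"
  "\<alpha> \<in> D \<Longrightarrow> of_nat m = lam (coroot e \<alpha>) \<Longrightarrow>
    free_gen (monom (e (- \<alpha>)) 0) ^ (m + 1) \<in> weyl_generators H D e lam"
  unfolding weyl_generators_def by blast+

lemma weyl_kernel:
  "left_ideal (weyl_kernel H D e N lam)"
  "{f. free_trunc N f \<in> current_ideal N} \<subseteq> weyl_kernel H D e N lam"
  "weyl_generators H D e lam \<subseteq> weyl_kernel H D e N lam"
  using left_ideal_hull
    left_ideal_hull_superset[of "{f. free_trunc N f \<in> current_ideal N} \<union> weyl_generators H D e lam"]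
  unfolding weyl_kernel_def by simp_all

lemma presents_weyl_module:
  obtains p where "presents (weyl_module H D e N lam) p (weyl_kernel H D e N lam) (mgrade (free_current \<infinity>))"
proof -
  define p where "p = gmod_coset (free_current N) (current_ideal N) \<circ> (free_trunc N :: ('a poly word \<Rightarrow>\<^sub>0 complex) \<Rightarrow> _)"
  have p: "presents (env_current N) p {f. free_trunc N f \<in> current_ideal N} (mgrade (free_current \<infinity>))"
    unfolding p_def by (rule presents_env_current)
  have one: "env_one N = p 1" by (simp add: env_one_def p_def)
  have "weyl_relations H D e N lam = p ` weyl_generators H D e lam"
  proof -
    have a: "mact (env_current N) x (p 1) = p (free_gen x)" for x
      by (simp add: presentsD(6)[OF p])
    have b: "madd (env_current N) (p (free_gen x)) (msmult (env_current N) (- c) (p 1)) = p (free_gen x - cst c)" for x c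
      by (simp add: presentsD(4,5)[OF p] free_scale_def single_uminus)
    have c: "(mact (env_current N) x ^^ k) (p 1) = p (free_gen x ^ k)" for x k
      by (simp add: presents_mact_pow[OF p])
    show ?thesis
      unfolding weyl_relations_def weyl_generators_def Let_def one image_Un a b c by blast
  qed
  with presents_quot_generated[OF p, of "weyl_generators H D e lam"] that show ?thesis
    by (simp add: weyl_module_def weyl_kernel_def)
qed

text \<open>Write n = M q + p. If k \<ge> M, already r k \<ge> r M. If k < M and r \<ge> q + 1,
  replacing the first k parts, each at most q + 1, by r does not decrease the sum n. If k < M and r
  \<le> q, the remaining M - k parts are at least q \<ge> r, so the bound is at least r M. For
  infinite \<open>N\<close> all parts are 1 and the bound is at least n.\<close>

lemma sum_list_drop_even_partition:
  assumes "k > 0" "r > 0" "N \<noteq> 0" "s + r > r * k + sum_list (drop k (even_partition N n))"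
  shows "s + r > n \<or> (\<exists>M. N = enat M \<and> s > r * (M - 1))"
proof (cases N)
  case infinity
  have "k \<le> r * k" using assms(2) by simp
  then have "n \<le> r * k + (n - k)" by linarith
  then show ?thesis using assms(4) infinity by (simp add: even_partition_def sum_list_replicate)
next
  case (enat M)
  have M: "M > 0" using assms(3) enat by (simp add: zero_enat_def)
  define q p where "q = n div M" and "p = n mod M"
  have n: "n = M * q + p" and p: "p < M" using M by (simp_all add: q_def p_def)
  \<comment> \<open>Truncated subtraction covers both positions of \<open>k\<close>: within the
    \<open>p\<close> larger parts or beyond them.\<close>
  have S: "sum_list (drop k (even_partition N n)) = (p - k) * (q + 1) + (M - p - (k - p)) * q"
    by (simp add: enat even_partition_def sum_list_replicate q_def p_def)
  consider "k \<ge> M" | "k < M" "r \<ge> q + 1" | "k < M" "r \<le> q" by linarith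
  then have "s + r > n \<or> s + r > r * M"
  proof cases
    case 1
    then have "r * M \<le> r * k" by simp
    then show ?thesis using assms(4) by linarith
  next
    case 2
    have "n \<le> (q + 1) * k + ((p - k) * (q + 1) + (M - p - (k - p)) * q)"
    proof (cases "k \<le> p")
      case True
      then obtain d where d: "p = k + d" using le_Suc_ex by blast
      obtain m where m: "M = p + m" using p by (metis less_imp_add_positive)
      show ?thesis unfolding n by (simp add: d m algebra_simps)
    next
      case False
      then obtain d where d: "k = p + d" by (metis le_Suc_ex nat_le_linear)
      obtain m where m: "M = k + m" using 2(1) by (metis less_imp_add_positive)
      show ?thesis unfolding n by (simp add: d m algebra_simps)
    qed
    also have "(q + 1) * k \<le> r * k" using 2(2) by (rule mult_le_mono1)
    finally show ?thesis using assms(4) S by linarith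
  next
    case 3
    have "r * M = r * k + r * (M - k)" using 3(1) by (simp flip: add_mult_distrib2)
    also have "r * (M - k) \<le> q * (M - k)" using 3(2) by (rule mult_le_mono1)
    also have "q * (M - k) \<le> (p - k) * (q + 1) + (M - p - (k - p)) * q"
    proof (cases "k \<le> p")
      case True
      then obtain d where d: "p = k + d" using le_Suc_ex by blast
      obtain m where m: "M = p + m" using p by (metis less_imp_add_positive)
      show ?thesis by (simp add: d m algebra_simps)
    next
      case False
      then obtain d where d: "k = p + d" by (metis le_Suc_ex nat_le_linear)
      then show ?thesis by (simp add: algebra_simps)
    qed
    finally show ?thesis using assms(4) S by linarith
  qed
  moreover have "s > r * (M - 1)" if "s + r > r * M"
    using that M by (cases M) auto
  ultimately show ?thesis using enat by blast
qed


section \<open>Comparison of the defining ideals\<close>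

text \<open>A generator of the weight space is fixed only up to a scalar; the rightmost factor
  \<open>cst c\<close> represents \<open>w\<close>.\<close>

definition cv_generators ::
    "'g::complex_lie_algebra set \<Rightarrow> ('g \<Rightarrow> complex) set \<Rightarrow> (('g \<Rightarrow> complex) \<Rightarrow> 'g)
      \<Rightarrow> (('g \<Rightarrow> complex) \<Rightarrow> nat list) \<Rightarrow> complex \<Rightarrow> ('g poly word \<Rightarrow>\<^sub>0 complex) set" where
  "cv_generators H D e xi c =
     {free_gen (monom (e \<alpha>) 1) ^ s * (free_gen (monom (e (- \<alpha>)) 0) ^ (s + r) * cst c) | \<alpha> s r.
        \<alpha> \<in> pos_roots H D \<and> s > 0 \<and> r > 0 \<and> (\<exists>k>0. s + r > r * k + sum_list (drop k (xi \<alpha>)))}"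

lemma (in env_left_ideal) K_mult_cst: "f \<in> K \<Longrightarrow> f * cst c \<in> K"
  using K_mult[of f "cst c"] by (simp add: cst_central)

lemma (in chevalley_data) weyl_idealI:
  assumes "left_ideal K" "current_ideal \<infinity> \<subseteq> K" "weyl_generators H D e lam \<subseteq> K"
    and "lam \<in> dominant_weights H D e"
  shows "weyl_ideal H D e K lam"
proof unfold_locales
  fix x h \<alpha> and r m :: nat
  show "free_gen (monom x r) \<in> K" if "x \<in> n_plus H D"
    using assms(3) weyl_generatorsI(1)[OF that] by (rule subsetD)
  show "free_gen (monom h r) - cst (if r = 0 then lam h else 0) \<in> K" if "h \<in> H"
    using assms(3) weyl_generatorsI(2)[OF that] by (rule subsetD)
  show "free_gen (monom (e (- \<alpha>)) 0) ^ (m + 1) \<in> K" if "\<alpha> \<in> D" "of_nat m = lam (coroot e \<alpha>)"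
    using assms(3) weyl_generatorsI(3)[of \<alpha> D m lam e H, OF that] by (rule subsetD)
qed (use assms in auto)

context chevalley_data
begin

context
  fixes lam :: "'g \<Rightarrow> complex" and N :: enat and c :: complex
  assumes lam: "lam \<in> dominant_weights H D e" and N: "N \<noteq> 0" and c: "c \<noteq> 0"
begin

lemma cv_kernel_subset_weyl_kernel:
  "left_ideal_hull (weyl_kernel H D e \<infinity> lam \<union> cv_generators H D e (xi_family e N lam) c)
    \<subseteq> weyl_kernel H D e N lam"
proof -
  define K where "K = weyl_kernel H D e N lam"
  note lK = weyl_kernel(1)[of H D e N lam, folded K_def]
    and I = weyl_kernel(2)[of N H D e lam, folded K_def]
    and T = weyl_kernel(3)[of H D e lam N, folded K_def]
  have tr: "trunc N x \<in> trunc_current N" for x :: "'g poly" by (simp add: trunc_current_iff)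
  \<comment> \<open>The projection to the truncated algebra is a Lie homomorphism, so truncating
    letters maps enveloping relations to enveloping relations.\<close>
  have "free_trunc N f \<in> current_ideal N" if "f \<in> current_ideal \<infinity>" for f :: "'g poly word \<Rightarrow>\<^sub>0 complex"
    using that
  proof induction
    case (gen r u v)
    have "free_trunc N r \<in> env_relations (trunc_current N) (trunc_lie N)"
      using gen(1)
    proof (cases rule: env_relations_cases)
      case (add x y)
      then show ?thesis using env_relationsI(1)[OF tr[of x] tr[of y]]
        by (simp add: word_map_diff word_map_gen trunc_add)
    next
      case (scale b x)
      then show ?thesis using env_relationsI(2)[OF tr[of x]]
        by (simp add: word_map_diff word_map_gen word_map_scale trunc_cscale)
    next
      case (lie x y)
      then show ?thesis using env_relationsI(3)[OF tr[of x] tr[of y], of "trunc_lie N"]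
        by (simp add: word_map_diff word_map_gen word_map_mult trunc_lie_def trunc_lie_trunc)
    qed
    then show ?case
      using word_map_range[of "trunc N"] unfolding word_map_mult trunc_current_def
      by (intro env_ideal.gen) auto
  qed (auto simp: word_map_add intro: env_ideal.zero env_ideal.add)
  then have env: "current_ideal \<infinity> \<subseteq> K" using I by blast
  interpret weyl_ideal H D e K lam by (rule weyl_idealI[OF lK env T lam])
  have cut: "xm \<alpha> a * g \<in> K" if "enat a \<ge> N" for \<alpha> a g
  proof -
    have "trunc N (monom (e (- \<alpha>)) a) = 0" using that by (simp add: trunc_monom leD)
    then have "free_trunc N (xm \<alpha> a * g) = free_gen 0 * free_trunc N g"
      by (simp add: xm_def word_map_mult word_map_gen)
    also have "\<dots> \<in> current_ideal N"
    proof -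
      \<comment> \<open>The letter \<open>free_gen 0\<close> is not zero in the free algebra; the
        scaling relation with scalar 0 puts it into the ideal.\<close>
      have "free_gen (cscale 0 0) - free_scale 0 (free_gen (0 :: 'g poly))
          \<in> env_relations (trunc_current N) (trunc_lie N)"
        by (rule env_relationsI(2)) (simp add: trunc_current_iff)
      moreover have "free_trunc N g \<in> free_alg (trunc_current N)"
        using word_map_range[of "trunc N" g] by (simp add: trunc_current_def)
      ultimately have "1 * (free_gen (cscale 0 0) - free_scale 0 (free_gen 0)) * free_trunc N g \<in> current_ideal N"
        using free_alg_1 by (intro env_ideal.gen)
      then show ?thesis by (simp add: free_scale_def)
    qed
    finally show ?thesis using I by blast
  qed
  have "free_gen (monom (e \<alpha>) 1) ^ s * (free_gen (monom (e (- \<alpha>)) 0) ^ (s + r) * cst c) \<in> K"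
    if \<alpha>: "\<alpha> \<in> Rp" and sr: "s > 0" "r > 0" "k > 0"
      "s + r > r * k + sum_list (drop k (xi_family e N lam \<alpha>))" for \<alpha> s r k
  \<comment> \<open>\<open>K_root_power\<close> requires a nonzero quotient; in the zero quotient
    every relation holds.\<close>
  proof (cases "1 \<in> K")
    case True
    then show ?thesis using K_mult[of 1] by simp
  next
    case False
    obtain n where n: "lam (coroot e \<alpha>) = of_nat n" "xm \<alpha> 0 ^ Suc n \<in> K"
      using K_root_power[OF \<alpha> False] .
    have "xi_family e N lam \<alpha> = even_partition N n" by (simp add: xi_family_def n(1))
    then consider "s + r > n" | M where "N = enat M" "s > r * (M - 1)"
      using sum_list_drop_even_partition[of k r N n s] sr N by auto
    then have "free_gen (monom (e \<alpha>) 1) ^ s * xm \<alpha> 0 ^ (s + r) \<in> K"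
    proof cases
      case 1
      then have "xm \<alpha> 0 ^ (s + r) * 1 \<in> K"
        using nilpotent_mono[of "xm \<alpha> 0" "Suc n" 1 "s + r"] n(2) by simp
      then show ?thesis using K_mult by simp
    next
      case 2
      obtain d where "comb \<alpha> r s d (free_gen (monom (e \<alpha>) 1) ^ s * xm \<alpha> 0 ^ (s + r))"
        using comb_e_pow[OF \<alpha> sr(2), of s] by blast
      then show ?thesis
      proof (rule K_comb[OF _ 2(2)])
        show "xm \<alpha> a * g \<in> K" if "M \<le> a" for a g using cut[of a] that 2(1) by simp
      qed
    qed
    from K_mult_cst[OF this, of c] show ?thesis by (simp add: xm_def mult.assoc)
  qed
  then have C: "cv_generators H D e (xi_family e N lam) c \<subseteq> K"
    unfolding cv_generators_def by blast
  have "{f. free_trunc \<infinity> f \<in> current_ideal \<infinity>} \<subseteq> K"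
  proof -
    have "free_trunc \<infinity> f = f" for f :: "'g poly word \<Rightarrow>\<^sub>0 complex"
      by (rule word_map_ident[of UNIV]) simp_all
    then show ?thesis using env by simp
  qed
  then have "weyl_kernel H D e \<infinity> lam \<subseteq> K"
    unfolding weyl_kernel_def using T by (intro left_ideal_hull_minimal lK) blast
  with C show ?thesis unfolding K_def[symmetric] by (intro left_ideal_hull_minimal lK) blast
qed

lemma weyl_kernel_subset_cv_kernel:
  "weyl_kernel H D e N lam
    \<subseteq> left_ideal_hull (weyl_kernel H D e \<infinity> lam \<union> cv_generators H D e (xi_family e N lam) c)"
proof -
  define K where "K = left_ideal_hull (weyl_kernel H D e \<infinity> lam \<union> cv_generators H D e (xi_family e N lam) c)"
  have lK: "left_ideal K" by (simp add: K_def left_ideal_hull)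
  have W: "weyl_kernel H D e \<infinity> lam \<subseteq> K" and C: "cv_generators H D e (xi_family e N lam) c \<subseteq> K"
    using left_ideal_hull_superset unfolding K_def by blast+
  have id: "free_trunc \<infinity> f = f" for f :: "'g poly word \<Rightarrow>\<^sub>0 complex"
    by (rule word_map_ident[of UNIV]) simp_all
  have env: "current_ideal \<infinity> \<subseteq> K" and T: "weyl_generators H D e lam \<subseteq> K"
    using W weyl_kernel(2)[of \<infinity> H D e lam] weyl_kernel(3)[of H D e lam \<infinity>] by (auto simp: id)
  interpret weyl_ideal H D e K lam by (rule weyl_idealI[OF lK env T lam])
  have pos: "r > 0" if "enat r \<ge> N" for r
    using that N by (metis enat_0 gr0I ile0_eq)
  have lower: "free_gen (monom (e (- \<alpha>)) r) \<in> K" if \<alpha>: "\<alpha> \<in> Rp" and r: "enat r \<ge> N" for \<alpha> r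
  proof -
    obtain M where M: "N = enat M" "M \<le> r" using r by (cases N) auto
    have "M > 0" using N M by (simp add: zero_enat_def)
    \<comment> \<open>Zero parts included, the even partition lists exactly \<open>M\<close> parts,
      so the tail beyond k = \<open>M\<close> is empty.\<close>
    then have "drop M (xi_family e N lam \<alpha>) = []"
      by (simp add: xi_family_def even_partition_def M(1))
    then have "r + 1 > 1 * M + sum_list (drop M (xi_family e N lam \<alpha>))" using M(2) by simp
    then have "free_gen (monom (e \<alpha>) 1) ^ r * (free_gen (monom (e (- \<alpha>)) 0) ^ (r + 1) * cst c)
        \<in> cv_generators H D e (xi_family e N lam) c"
      using \<alpha> pos[OF r] \<open>M > 0\<close> unfolding cv_generators_def by blast
    then have "free_gen (monom (e \<alpha>) 1) ^ r * (free_gen (monom (e (- \<alpha>)) 0) ^ (r + 1) * cst c) \<in> K"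
      using C by blast
    from K_mult_cst[OF this, of "inverse c"]
    have "free_gen (monom (e \<alpha>) 1) ^ r * xm \<alpha> 0 ^ (r + 1) \<in> K"
      using c by (simp add: mult.assoc mult_single xm_def)
    from K_f_of_cv[OF \<alpha> this] show ?thesis by (simp add: xm_def)
  qed
  \<comment> \<open>The Chevalley basis leaves three kinds of \<open>x\<close>: raising vectors kill
    the generator, coroots do so because r > 0, and the other root vectors are covered by
    \<open>lower\<close>.\<close>
  have monom: "free_gen (monom x r) * 1 \<in> K" if r: "enat r \<ge> N" for x r
  proof -
    have "x \<in> lie_vs.span (e ` Rt \<union> coroot e ` D)"
      using chevalley by (simp add: chevalley_basis_def)
    then show ?thesis
    proof (induction rule: lie_vs.span_induct_alt)
      case base
      then show ?case using gen_zero[of 1] by simp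
    next
      case (step b y z)
      have "free_gen (monom y r) * 1 \<in> K"
      proof (cases "y \<in> coroot e ` D")
        case True
        then have "y \<in> H" using coroot_H D_pos by blast
        then show ?thesis using K_H_pos[OF _ pos[OF r]] by simp
      next
        case False
        then obtain \<gamma> where g: "\<gamma> \<in> Rt" "y = e \<gamma>" using step(1) by blast
        show ?thesis
        proof (cases "\<gamma> \<in> Rp")
          case True
          then show ?thesis using K_n_plus[OF e_n_plus] g(2) by simp
        next
          case False
          then show ?thesis using lower[OF neg_root_pos[OF g(1)] r] g(2) by simp
        qed
      qed
      from K_scale[OF this, of b] have "free_gen (cscale b (monom y r)) * 1 \<in> K"
        using K_cong[OF gen_scale[of b "monom y r" 1]] by blast
      from K_add[OF this step.IH] show ?case
        using K_cong[OF gen_add[of "cscale b (monom y r)" "monom z r" 1]]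
        by (simp add: add_monom monom_cscale flip: add_monom)
    qed
  qed
  have cut1: "free_gen p * 1 \<in> K" if "trunc N p = 0" for p :: "'g poly"
  proof -
    have "p = (\<Sum>i\<le>degree p. monom (coeff p i) i)" by (rule poly_as_sum_of_monoms[symmetric])
    also have "\<dots> \<in> lie_vs.span {monom x r | x r. enat r \<ge> N}"
    proof (rule lie_vs.span_sum)
      fix i
      show "monom (coeff p i) i \<in> lie_vs.span {monom x r | x r. enat r \<ge> N}"
      proof (cases "enat i < N")
        case True
        then have "coeff p i = 0" using that coeff_trunc[of N p i] by simp
        then show ?thesis by (simp add: lie_vs.span_zero)
      next
        case False
        then show ?thesis by (intro lie_vs.span_base) (auto simp: not_less)
      qed
    qed
    finally show ?thesis by (rule gen_span) (use monom in auto)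
  qed
  \<comment> \<open>From the generator to any vector: \<open>p\<close> is commuted past the letters
    of \<open>g\<close>, and each bracket again truncates to 0, so the induction runs over all such
    \<open>p\<close>.\<close>
  have cut: "free_gen p * g \<in> K" if "trunc N p = 0" for p :: "'g poly" and g
    using that
  proof (induction g arbitrary: p rule: free_algebra_induct)
    case (cst d)
    then show ?case using K_mult_cst[OF cut1, of p d] by simp
  next
    case (gen x g)
    have "free_gen x * (free_gen p * g) + free_gen (lie p x) * g \<in> K"
      by (rule K_add[OF K_mult[OF gen.IH[OF gen.prems]] gen.IH[OF trunc_lie_eq_0(1)[OF gen.prems]]])
    then show ?case using K_cong[OF gen_lie[of p x g]] by blast
  next
    case (add g h)
    then show ?case by (simp add: distrib_left K_add)
  qed
  have cong: "free_gen x * g - free_gen (trunc N x) * g \<in> K" for x :: "'g poly" and g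
  proof -
    have "free_gen (x - trunc N x) * g \<in> K" by (rule cut) (simp add: trunc_diff)
    from K_add[OF gen_add[of "x - trunc N x" "trunc N x" g] this] show ?thesis
      by (simp add: algebra_simps)
  qed
  have trunc_cong: "f - free_trunc N f \<in> K" for f :: "'g poly word \<Rightarrow>\<^sub>0 complex"
  proof (induction f rule: free_algebra_induct)
    case (cst d)
    then show ?case by (simp add: word_map_cst K_zero)
  next
    case (gen x g)
    from K_add[OF K_mult[OF gen, of "free_gen x"] cong[of x "free_trunc N g"]]
    show ?case by (simp add: word_map_mult word_map_gen algebra_simps)
  next
    case (add g h)
    then show ?case using K_add[OF add] by (simp add: word_map_add algebra_simps)
  qed
  \<comment> \<open>By \<open>trunc_cong\<close> it remains to check the relations of the truncated
    algebra; their bracket differs from that of g[t] by a truncation, which \<open>cong\<close>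
    absorbs.\<close>
  have "f \<in> K" if "f \<in> current_ideal N" for f :: "'g poly word \<Rightarrow>\<^sub>0 complex"
    using that
  proof induction
    case (gen r u v)
    have "r * v \<in> K"
      using gen(1)
    proof (cases rule: env_relations_cases)
      case (add x y)
      show ?thesis unfolding add(1) using gen_add[of x y v] by (simp add: algebra_simps)
    next
      case (scale b x)
      show ?thesis unfolding scale(1) using gen_scale[of b x v] by (simp add: left_diff_distrib free_scale_mult_left)
    next
      case (lie x y)
      show ?thesis unfolding lie(1) using K_add[OF gen_lie[of x y v] cong[of "lie x y" v]]
        by (simp add: trunc_lie_def algebra_simps)
    qed
    then show ?case using K_mult by (simp add: mult.assoc)
  qed (auto intro: K_zero K_add)
  then have "{f. free_trunc N f \<in> current_ideal N} \<subseteq> K"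
    using K_cong[OF trunc_cong] by blast
  then show ?thesis
    unfolding K_def[symmetric] weyl_kernel_def[of H D e N] using T
    by (intro left_ideal_hull_minimal lK) blast
qed

end

end

theorem theorem2p4p1:
  fixes H :: "'g::complex_lie_algebra set"
    and D :: "('g \<Rightarrow> complex) set"
    and e :: "('g \<Rightarrow> complex) \<Rightarrow> 'g"
    and lam :: "'g \<Rightarrow> complex"
    and N :: enat
    and w :: "('g poly word \<Rightarrow>\<^sub>0 complex) set set"
  assumes "fin_dim_lie_algebra TYPE('g)"
    and "simple_lie_algebra TYPE('g)"
    and "cartan_subalgebra H"
    and "simple_root_system H D"
    and "chevalley_basis H D e"
    and "lam \<in> dominant_weights H D e"
    and "N \<noteq> 0"
    and "w \<in> carr (weyl_module H D e \<infinity> lam)"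
    and "weight_space H (weyl_module H D e \<infinity> lam) lam =
           range (\<lambda>c. msmult (weyl_module H D e \<infinity> lam) c w)"
  shows "graded_isomorphic
           (cv_module H D e lam w (xi_family e N lam))
           (weyl_module H D e N lam)"
proof -
  interpret chevalley_data H D e using assms(1,3,4,5) by unfold_locales
  let ?W = "weyl_module H D e \<infinity> lam" and ?K = "weyl_kernel H D e \<infinity> lam"
    and ?G = "mgrade (free_current \<infinity>) :: nat \<Rightarrow> ('g poly word \<Rightarrow>\<^sub>0 complex) set"
  obtain p where p: "presents ?W p ?K ?G" by (rule presents_weyl_module)
  obtain q where q: "presents (weyl_module H D e N lam) q (weyl_kernel H D e N lam) ?G"
    by (rule presents_weyl_module)
  note K = left_idealD[OF presentsD(1)[OF p]] left_ideal_scale[OF presentsD(1)[OF p]]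
  have "p 1 \<in> weight_space H ?W lam"
  proof -
    have "free_gen (monom h 0) - cst (lam h) \<in> ?K" if "h \<in> H" for h
      using weyl_generatorsI(2)[OF that, of 0 lam D e] weyl_kernel(3)[of H D e lam \<infinity>] by auto
    then show ?thesis
      by (simp add: weight_space_def presentsD[OF p] free_scale_def) (rule rangeI)
  qed
  \<comment> \<open>Since \<open>w\<close> spans the weight space, the image of 1 is a multiple of
    it; inverting the scalar represents \<open>w\<close> by a nonzero constant.\<close>
  then obtain a where a: "p 1 = msmult ?W a w" using assms(9) by auto
  obtain f where f: "w = p f" using assms(8) presentsD(2)[OF p] by auto
  have af: "1 - free_scale a f \<in> ?K"
    using a by (simp add: f presentsD(3,5)[OF p])
  obtain c where c: "c \<noteq> 0" "w = p (cst c)"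
  proof (cases "a = 0")
    \<comment> \<open>The image of 1 is then zero, hence so is the whole module, and any nonzero
      constant represents \<open>w\<close>.\<close>
    case True
    then have "1 \<in> ?K" using af by (simp add: free_scale_def)
    then have "g \<in> ?K" for g using K(3)[of 1 g] by simp
    then have "w = p (cst 1)" by (simp add: f presentsD(3)[OF p])
    then show ?thesis using that[of 1] by simp
  next
    case False
    have "free_scale (inverse a) (1 - free_scale a f) = cst (inverse a) - f"
      using False by (simp add: free_scale_def right_diff_distrib mult.assoc[symmetric] mult_single)
    then have "f - cst (inverse a) \<in> ?K" using K(4)[OF K(6)[OF af, of "inverse a"]] by simp
    then have "w = p (cst (inverse a))" by (simp add: f presentsD(3)[OF p])
    then show ?thesis using that[of "inverse a"] False by simp
  qed
  have "cv_relations H D e ?W w (xi_family e N lam) = p ` cv_generators H D e (xi_family e N lam) c"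
    unfolding cv_relations_def cv_generators_def c(2) presents_mact_pow[OF p] by blast
  then have cv: "cv_module H D e lam w (xi_family e N lam)
      = gmod_quot ?W (gmod_generated ?W (p ` cv_generators H D e (xi_family e N lam) c))"
    by (simp add: cv_module_def Let_def)
  have "left_ideal_hull (?K \<union> cv_generators H D e (xi_family e N lam) c) = weyl_kernel H D e N lam"
    using cv_kernel_subset_weyl_kernel[OF assms(6,7) c(1)]
      weyl_kernel_subset_cv_kernel[OF assms(6,7) c(1)] by (rule equalityI)
  with presents_quot_generated[OF p, of "cv_generators H D e (xi_family e N lam) c"]
  show ?thesis
    unfolding cv by (simp add: presents_graded_isomorphic[OF _ q])
qed

end
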